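(* Let $K$ be an $(n-1)$-dimensional simplicial complex on the vertex set $[m]$ which is a homology sphere over $\mathbb R$, endowed with an orientation, and let $\Delta$ be a complete multi-fan based on $K$ with characteristic function $\lambda\colon[m]\to V$. Then $\mathcal A^*(\Delta)\cong\mathbb R[K]/\Theta$ as graded algebras. Consequently $\dim\mathcal A^{2j}(\Delta)=h_j$, the $h$-number of $K$, for $j=0,\dots,n$.
   Context: $K$ is a homology sphere (Gorenstein* ) over $\mathbb R$ if for every simplex $I\in K$ (including $I=\varnothing$) the link $\mathrm{lk}_KI=\{J\subset[m]\setminus I: I\cup J\in K\}$ satisfies $\tilde H_j(\mathrm{lk}_KI;\mathbb R)=0$ for $j<n-1-|I|$ and $\tilde H_{n-1-|I|}(\mathrm{lk}_KI;\mathbb R)\cong\mathbb R$. Such $K$ is a pseudomanifold; an orientation is a choice of orientations of its $(n-1)$-simplices such that their sum is a cycle. Let $V$ be an oriented real $n$-dimensional vector space with an inner product (identify $V^*=V$). A multi-fan based on the oriented $K$: take $\lambda\colon[m]\to V$ such that $\{\lambda(i)\}_{i\in I}$ is a basis of $V$ for each maximal simplex $I$ of $K$; set $w(I)=+1$ if the orientation of $I$ from $K$ agrees with the orientation in which $(i_1,\dots,i_n)$ is positive iff $(\lambda(i_1),\dots,\lambda(i_n))$ is a positive basis, $w(I)=-1$ otherwise, and $w=0$ on $n$-subsets not in $K$. Then $\Delta=(w,\lambda)$ is a complete simplicial multi-fan. Volume polynomial and algebra. With $\deg x_i=2$, for maximal $I$ let $\{u^I_i\}$ be the basis of $V^*$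 dual to $\{\lambda(i)\}_{i\in I}$, $\iota_I\colon\mathbb R[x_1,\dots,x_m]\to\mathbb R[V^*]$ the homomorphism with $\iota_I(x_i)=u^I_i$ for $i\in I$ and $0$ otherwise, and $|\det\lambda_I|$ the volume of the parallelepiped on $\{\lambda(i)\}_{i\in I}$. For $x$ homogeneous of degree $2n$, $\int_\Delta x:=\sum_{I}\frac{w(I)\iota_I(x)}{|\det\lambda_I|\prod_{i\in I}\iota_I(x_i)}$ is a constant; $V_\Delta(c)=\frac1{n!}\int_\Delta(\sum c_ix_i)^n$; $\mathcal A^*(\Delta)=\mathbb R[\partial_1,\dots,\partial_m]/\{D:DV_\Delta=0\}$, $\partial_i=\partial/\partial c_i$, $\deg\partial_i=2$. $\mathbb R[K]=\mathbb R[x_1,\dots,x_m]/(x_{i_1}\cdots x_{i_k}:\{i_1,\dots,i_k\}\notin K)$ is the Stanley–Reisner ring ($\deg x_i=2$), and $\Theta\subset\mathbb R[K]$ is the ideal generated by the linear forms $\sum_{i=1}^m\langle u,\lambda(i)\rangle x_i$, $u\in V^*$. The $h$-numbers are defined by $\sum_{j=0}^nh_jt^{n-j}=\sum_{j=0}^nf_{j-1}(t-1)^{n-j}$, where $f_j$ is the number of $j$-dimensional simplices of $K$ and $f_{-1}=1$. *)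

theory Defs
  imports
    "HOL-Analysis.Analysis"
    "HOL-Library.Poly_Mapping"
    "HOL-Algebra.QuotRing"
    "HOL-Algebra.Embedded_Algebras"
    "Jordan_Normal_Form.Determinant"
begin

no_notation Matrix.vec_index (infixl \<open>$\<close> 100)

text \<open>
  The vertex set \<open>[m]\<close> is the universe of a finite linearly ordered type \<open>'v\<close>; the order only
  serves to write down simplicial boundaries and orientations.  A complex is its set of simplices,
  the empty simplex included; an element \<open>i\<close> of \<open>[m]\<close> with \<open>{i} \<notin> K\<close> (a ghost vertex) is permitted.
\<close>

section \<open>Simplicial complexes and homology spheres\<close>

definition abstract_simplicial_complex :: "'v set set \<Rightarrow> bool" where
  "abstract_simplicial_complex K \<longleftrightarrow>
     {} \<in> K \<and> (\<forall>I\<in>K. finite I) \<and> (\<forall>I\<in>K. \<forall>J. J \<subseteq> I \<longrightarrow> J \<in> K)"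

definition simplices :: "'v set set \<Rightarrow> int \<Rightarrow> 'v set set" where
  "simplices K j = {I \<in> K. int (card I) = j + 1}"

definition has_dimension :: "'v set set \<Rightarrow> int \<Rightarrow> bool" where
  "has_dimension K d \<longleftrightarrow> simplices K d \<noteq> {} \<and> (\<forall>I\<in>K. int (card I) \<le> d + 1)"

definition maximal_simplices :: "'v set set \<Rightarrow> 'v set set" where
  "maximal_simplices K = {I \<in> K. \<forall>J\<in>K. I \<subseteq> J \<longrightarrow> J = I}"

definition link :: "'v set set \<Rightarrow> 'v set \<Rightarrow> 'v set set" where
  "link K I = {J. J \<inter> I = {} \<and> I \<union> J \<in> K}"

text \<open>
  The entry of a chain at \<open>I\<close> is the coefficient of the simplex \<open>I\<close> oriented by the increasing
  order of its vertices.  The empty simplex has degree \<open>-1\<close>, so the homology is reduced.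
\<close>

type_synonym 'v chain = "(real, 'v set) Finite_Cartesian_Product.vec"

definition chains :: "'v::{finite,linorder} set set \<Rightarrow> int \<Rightarrow> 'v chain set" where
  "chains K j = {c. \<forall>I. I \<notin> simplices K j \<longrightarrow> c $ I = 0}"

definition boundary :: "'v::{finite,linorder} chain \<Rightarrow> 'v chain" where
  "boundary c = (\<chi> J. \<Sum>i\<in>-J. (-1) ^ card {k\<in>J. k < i} * c $ (insert i J))"

definition cycles :: "'v::{finite,linorder} set set \<Rightarrow> int \<Rightarrow> 'v chain set" where
  "cycles K j = {z \<in> chains K j. boundary z = 0}"

definition boundaries :: "'v::{finite,linorder} set set \<Rightarrow> int \<Rightarrow> 'v chain set" where
  "boundaries K j = boundary ` chains K (j + 1)"

definition homology_class :: "'v::{finite,linorder} set set \<Rightarrow> int \<Rightarrow> 'v chain \<Rightarrow> 'v chain set" where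
  "homology_class K j z = {z + b | b. b \<in> boundaries K j}"

definition reduced_homology :: "'v::{finite,linorder} set set \<Rightarrow> int \<Rightarrow> 'v chain set set" where
  "reduced_homology K j = homology_class K j ` cycles K j"

definition homology_zero :: "'v::{finite,linorder} set set \<Rightarrow> int \<Rightarrow> bool" where
  "homology_zero K j \<longleftrightarrow> reduced_homology K j = {homology_class K j 0}"

text \<open>An isomorphism of real vector spaces; an additive one would not determine the dimension.\<close>

definition homology_iso_real :: "'v::{finite,linorder} set set \<Rightarrow> int \<Rightarrow> bool" where
  "homology_iso_real K j \<longleftrightarrow>
     (\<exists>\<phi> :: 'v chain set \<Rightarrow> real. bij_betw \<phi> (reduced_homology K j) UNIV \<and>
        (\<forall>x\<in>cycles K j. \<forall>y\<in>cycles K j.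
           \<phi> (homology_class K j (x + y)) = \<phi> (homology_class K j x) + \<phi> (homology_class K j y)) \<and>
        (\<forall>r. \<forall>x\<in>cycles K j. \<phi> (homology_class K j (r *\<^sub>R x)) = r * \<phi> (homology_class K j x)))"

definition homology_sphere :: "nat \<Rightarrow> 'v::{finite,linorder} set set \<Rightarrow> bool" where
  "homology_sphere n K \<longleftrightarrow>
     (\<forall>I\<in>K. (\<forall>j. j < int n - 1 - int (card I) \<longrightarrow> homology_zero (link K I) j) \<and>
            homology_iso_real (link K I) (int n - 1 - int (card I)))"

text \<open>
  \<open>\<epsilon> $ I = 1\<close> if the chosen orientation of the \<open>(n-1)\<close>-simplex \<open>I\<close> is the one given by the increasing
  order of its vertices, and \<open>-1\<close> if it is the opposite one; as a chain, \<open>\<epsilon>\<close> is the sum of the oriented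
  \<open>(n-1)\<close>-simplices.
\<close>

definition orientation :: "nat \<Rightarrow> 'v::{finite,linorder} set set \<Rightarrow> 'v chain \<Rightarrow> bool" where
  "orientation n K \<epsilon> \<longleftrightarrow>
     (\<forall>I\<in>simplices K (int n - 1). \<epsilon> $ I = 1 \<or> \<epsilon> $ I = -1) \<and> \<epsilon> \<in> cycles K (int n - 1)"

definition f_number :: "'v set set \<Rightarrow> int \<Rightarrow> nat" where
  "f_number K j = card (simplices K j)"

definition h_number :: "nat \<Rightarrow> 'v set set \<Rightarrow> nat \<Rightarrow> int" where
  "h_number n K j =
     Polynomial.coeff (\<Sum>i\<le>n. Polynomial.smult (int (f_number K (int i - 1))) ([:-1, 1:] ^ (n - i))) (n - j)"

section \<open>Multi-fans based on an oriented complex\<close>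

text \<open>
  The orientation of the Euclidean space \<open>V\<close> is recorded by a positive orthonormal basis
  \<open>e\<close>.  As \<open>e\<close> is orthonormal, the absolute value of the determinant below is the volume of the
  parallelepiped on the vectors \<open>\<lambda>(i)\<close>, \<open>i \<in> I\<close>; its sign decides whether these vectors,
  listed by increasing \<open>i\<close>, form a positive basis.
\<close>

definition orthonormal_basis :: "'a::euclidean_space list \<Rightarrow> bool" where
  "orthonormal_basis e \<longleftrightarrow> length e = DIM('a) \<and>
     (\<forall>i<DIM('a). \<forall>j<DIM('a). inner (e ! i) (e ! j) = (if i = j then 1 else 0))"

definition char_det :: "'a::euclidean_space list \<Rightarrow> ('v::linorder \<Rightarrow> 'a) \<Rightarrow> 'v set \<Rightarrow> real" where
  "char_det e lam I =
     Determinant.det (mat DIM('a) DIM('a)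
       (\<lambda>(r, c). inner (lam (sorted_list_of_set I ! r)) (e ! c)))"

definition characteristic_function ::
    "'v set set \<Rightarrow> ('v \<Rightarrow> 'a::euclidean_space) \<Rightarrow> bool" where
  "characteristic_function K lam \<longleftrightarrow>
     (\<forall>I\<in>maximal_simplices K.
        inj_on lam I \<and> independent (lam ` I) \<and> span (lam ` I) = UNIV)"

definition multifan_weight ::
    "'a::euclidean_space list \<Rightarrow> 'v::{finite,linorder} set set \<Rightarrow> 'v chain \<Rightarrow> ('v \<Rightarrow> 'a)
       \<Rightarrow> 'v set \<Rightarrow> real" where
  "multifan_weight e K \<epsilon> lam I =
     (if I \<in> simplices K (int DIM('a) - 1)
      then (if \<epsilon> $ I = sgn (char_det e lam I) then 1 else -1)
      else 0)"

section \<open>Polynomials\<close>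

text \<open>The polynomial ring \<open>\<real>[x\<^sub>1,\<dots>,x\<^sub>m]\<close>, as finitely supported functions on exponent vectors.\<close>

type_synonym 'v mpoly = "('v \<Rightarrow>\<^sub>0 nat) \<Rightarrow>\<^sub>0 real"

definition const :: "real \<Rightarrow> 'v mpoly" where
  "const r = Poly_Mapping.single 0 r"

definition var :: "'v \<Rightarrow> 'v mpoly" where
  "var i = Poly_Mapping.single (Poly_Mapping.single i 1) 1"

definition poly_eval :: "('v::finite \<Rightarrow> real) \<Rightarrow> 'v mpoly \<Rightarrow> real" where
  "poly_eval a p = (\<Sum>\<alpha>\<in>Poly_Mapping.keys p.
     Poly_Mapping.lookup p \<alpha> * (\<Prod>i\<in>UNIV. a i ^ Poly_Mapping.lookup \<alpha> i))"

text \<open>Homogeneous polynomials of degree \<open>d\<close>, where each variable has degree 2.\<close>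

definition homogeneous :: "nat \<Rightarrow> 'v::finite mpoly set" where
  "homogeneous d =
     {p. \<forall>\<alpha>\<in>Poly_Mapping.keys p. 2 * (\<Sum>i\<in>UNIV. Poly_Mapping.lookup \<alpha> i) = d}"

definition partial :: "'v \<Rightarrow> 'v mpoly \<Rightarrow> 'v mpoly" where
  "partial i p = (\<Sum>\<alpha>\<in>Poly_Mapping.keys p.
     Poly_Mapping.single (\<alpha> - Poly_Mapping.single i 1)
       (real (Poly_Mapping.lookup \<alpha> i) * Poly_Mapping.lookup p \<alpha>))"

text \<open>\<open>diff_op D p\<close> is \<open>D(\<partial>\<^sub>1,\<dots>,\<partial>\<^sub>m) p\<close>.\<close>

definition diff_op :: "'v::{finite,linorder} mpoly \<Rightarrow> 'v mpoly \<Rightarrow> 'v mpoly" where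
  "diff_op D p = (\<Sum>\<alpha>\<in>Poly_Mapping.keys D.
     const (Poly_Mapping.lookup D \<alpha>) *
     foldr (\<lambda>i. partial i ^^ Poly_Mapping.lookup \<alpha> i) (sorted_list_of_set UNIV) p)"

section \<open>The volume polynomial\<close>

definition dual_vector :: "('v \<Rightarrow> 'a::euclidean_space) \<Rightarrow> 'v set \<Rightarrow> 'v \<Rightarrow> 'a" where
  "dual_vector lam I i = (THE u. \<forall>j\<in>I. inner u (lam j) = (if i = j then 1 else 0))"

text \<open>
  Elements of \<open>\<real>[V\<^sup>*]\<close> are treated as polynomial functions on \<open>V\<close>: \<open>iota lam I x v\<close> is the value
  of \<open>\<iota>\<^sub>I(x)\<close> at \<open>v\<close>.
\<close>

definition iota ::
    "('v::finite \<Rightarrow> 'a::euclidean_space) \<Rightarrow> 'v set \<Rightarrow> 'v mpoly \<Rightarrow> 'a \<Rightarrow> real" where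
  "iota lam I x v = poly_eval (\<lambda>i. if i \<in> I then inner (dual_vector lam I i) v else 0) x"

text \<open>
  The constant to which the rational function \<open>\<Sum>\<^sub>I w(I) \<iota>\<^sub>I(x) / (|det \<lambda>\<^sub>I| \<Prod>\<^sub>i \<iota>\<^sub>I(x\<^sub>i))\<close> on \<open>V\<close> is equal
  for \<open>x\<close> homogeneous of degree \<open>2n\<close>, wherever no denominator vanishes.
\<close>

definition mf_integral ::
    "'a::euclidean_space list \<Rightarrow> ('v::{finite,linorder} set \<Rightarrow> real) \<Rightarrow> ('v \<Rightarrow> 'a)
       \<Rightarrow> 'v mpoly \<Rightarrow> real" where
  "mf_integral e w lam x =
     (THE c. \<forall>v. (\<forall>I. w I \<noteq> 0 \<longrightarrow> (\<forall>i\<in>I. iota lam I (var i) v \<noteq> 0)) \<longrightarrow>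
        (\<Sum>I | w I \<noteq> 0. w I * iota lam I x v /
            (\<bar>char_det e lam I\<bar> * (\<Prod>i\<in>I. iota lam I (var i) v))) = c)"

definition volume_polynomial ::
    "'a::euclidean_space list \<Rightarrow> ('v::{finite,linorder} set \<Rightarrow> real) \<Rightarrow> ('v \<Rightarrow> 'a)
       \<Rightarrow> 'v mpoly" where
  "volume_polynomial e w lam =
     (THE p. \<forall>c. poly_eval c p =
        mf_integral e w lam ((\<Sum>i\<in>UNIV. const (c i) * var i) ^ DIM('a)) / fact DIM('a))"

section \<open>Graded algebras\<close>

text \<open>
  A graded real algebra: a ring with the structure map \<open>scalar\<close> from \<open>\<real>\<close> and the homogeneous
  components \<open>component\<close>.
\<close>

record 'b graded_algebra = "'b ring" +
  scalar :: "real \<Rightarrow> 'b"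
  component :: "nat \<Rightarrow> 'b set"

definition graded_algebra_iso :: "'b graded_algebra \<Rightarrow> 'c graded_algebra \<Rightarrow> ('b \<Rightarrow> 'c) set" where
  "graded_algebra_iso A B =
     {\<phi> \<in> ring_iso A B. (\<forall>r. \<phi> (scalar A r) = scalar B r) \<and>
                        (\<forall>d. \<phi> ` component A d = component B d)}"

definition poly_algebra :: "'v::finite mpoly graded_algebra" where
  "poly_algebra =
     \<lparr>carrier = UNIV, mult = (*), one = 1, zero = 0, add = (+),
      scalar = const, component = homogeneous\<rparr>"

definition quotient_algebra :: "'b graded_algebra \<Rightarrow> 'b set \<Rightarrow> 'b set graded_algebra" where
  "quotient_algebra A I =
     \<lparr>carrier = carrier (A Quot I), mult = mult (A Quot I), one = one (A Quot I),
      zero = zero (A Quot I), add = add (A Quot I),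
      scalar = (\<lambda>r. I +>\<^bsub>A\<^esub> scalar A r),
      component = (\<lambda>d. (\<lambda>a. I +>\<^bsub>A\<^esub> a) ` component A d)\<rparr>"

definition component_dim :: "'b graded_algebra \<Rightarrow> nat \<Rightarrow> nat \<Rightarrow> bool" where
  "component_dim A d k \<longleftrightarrow> ring.dimension A k (range (scalar A)) (component A d)"

definition multifan_algebra ::
    "'a::euclidean_space list \<Rightarrow> ('v::{finite,linorder} set \<Rightarrow> real) \<Rightarrow> ('v \<Rightarrow> 'a)
       \<Rightarrow> 'v mpoly set graded_algebra" where
  "multifan_algebra e w lam =
     quotient_algebra poly_algebra {D. diff_op D (volume_polynomial e w lam) = 0}"

definition SR_ideal :: "'v::finite set set \<Rightarrow> 'v mpoly set" where
  "SR_ideal K = genideal poly_algebra {\<Prod>i\<in>S. var i | S. S \<notin> K}"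

definition SR_ring :: "'v::finite set set \<Rightarrow> 'v mpoly set graded_algebra" where
  "SR_ring K = quotient_algebra poly_algebra (SR_ideal K)"

definition theta_ideal ::
    "'v::finite set set \<Rightarrow> ('v \<Rightarrow> 'a::euclidean_space) \<Rightarrow> 'v mpoly set set" where
  "theta_ideal K lam = genideal (SR_ring K)
     {SR_ideal K +>\<^bsub>poly_algebra\<^esub> (\<Sum>i\<in>UNIV. const (inner u (lam i)) * var i) | u. u \<in> UNIV}"

end

(*
  Write J for the ideal generated by the non-face monomials and the linear forms, and N for the
  number of facets.

  For every exponent vector the complex R[K] -> sum of R[I] over |I| = n -> sum over |I| = n-1 -> ...
  is the augmented chain complex of a link, so the homology sphere condition makes it exact.  By the
  depth lemma a generic flag of linear forms is then a regular sequence on R[K], which gives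
  dim (R/J)_j = h_j, and the Euler characteristics of the links give h_j = h_(n-j).

  For a generic vector v let p_I be the point with coordinates iota_I(x_i)(v), I a facet.  Evaluation
  at these points maps the polynomials of degree < k onto a subspace G_k of R^N, and G_(n+1) = R^N.
  Since dim G_(k+1) - dim G_k <= h_k and the h_k sum to N, all these are equalities; hence a form a of
  degree k whose values lie in G_k belongs to J.  As h_n = 1, exactly one functional up to a factor
  kills G_n.  Testing it on the monomials of ridges shows that its normalised coefficients form a
  cycle, so it is the integral of the multi-fan; in particular the integral is constant in v on forms
  of degree n and kills J.  The bilinear form it defines on R^N makes G_k and G_(n+1-k) orthogonal, and
  by the symmetry of the h_k they are exact annihilators of each other.  So the integral induces a
  perfect pairing on R/J, and the annihilator of the volume polynomial, whose coefficients are the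
  integrals of the monomials, is J.
*)

theory Submission
  imports Defs "HOL-Library.Function_Algebras" "HOL-Computational_Algebra.Polynomial_FPS"
begin

section \<open>Polynomials\<close>

text \<open>The forms must be regular face by face: a summand R[I] with |I| = k sees only the first
  k of them, and the depth lemma gains exactly one form at each step of the complex. This dictates
  \<open>flag\<close>: on the span of \<open>lam\<close> over a face I the first |I| functionals
  must stay independent. A flag of length n still spans all functionals, so its ideal is the J of
  the theorem. The points p_I are useful because a linear form theta_u has the same value <u,v> at
  all of them. Their ideal deforms J by replacing theta_u with theta_u - <u,v>, and multiplication
  by theta_u becomes a scalar. So the graded ring R/J is traded for the algebra R^N filtered by the
  G_k, in which a nondegenerate form is merely a weight without zeros; duality turns into counting
  dimensions of orthogonal complements, with no canonical modules. The vector v is auxiliary, and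
  the poles of the integral are never cancelled by hand: degree n of R/J is a line spanned by the
  monomial of a facet, and the integral of that monomial is visibly free of v.\<close>

abbreviation lkp :: "('a \<Rightarrow>\<^sub>0 'b::zero) \<Rightarrow> 'a \<Rightarrow> 'b" where "lkp \<equiv> Poly_Mapping.lookup"

abbreviation supp :: "('a \<Rightarrow>\<^sub>0 nat) \<Rightarrow> 'a set" where "supp \<equiv> Poly_Mapping.keys"

abbreviation mono :: "('v \<Rightarrow>\<^sub>0 nat) \<Rightarrow> 'v mpoly" where "mono \<alpha> \<equiv> Poly_Mapping.single \<alpha> 1"

text \<open>The theorem gives every variable degree 2; the proof counts ordinary degree and
  translates back with \<open>homogeneous_even\<close>.\<close>

definition tdeg :: "('v::finite \<Rightarrow>\<^sub>0 nat) \<Rightarrow> nat" where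
  "tdeg \<alpha> = (\<Sum>i\<in>UNIV. lkp \<alpha> i)"

definition hdeg :: "nat \<Rightarrow> 'v::finite mpoly set" where
  "hdeg d = {p. \<forall>\<alpha>\<in>Poly_Mapping.keys p. tdeg \<alpha> = d}"

lemma homogeneous_even: "homogeneous (2 * d) = hdeg d"
  by (auto simp: homogeneous_def hdeg_def tdeg_def)

lemma supp_add: "supp (\<alpha> + \<beta>) = supp \<alpha> \<union> supp \<beta>"
  by (auto simp: in_keys_iff lookup_add)

lemma tdeg_add: "tdeg (\<alpha> + \<beta>) = tdeg \<alpha> + tdeg \<beta>"
  by (simp add: tdeg_def lookup_add sum.distrib)

lemma tdeg_single [simp]: "tdeg (Poly_Mapping.single i k) = k"
  by (simp add: tdeg_def lookup_single when_def)

lemma tdeg_0 [simp]: "tdeg 0 = 0"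
  by (simp add: tdeg_def)

lemma const_0 [simp]: "const 0 = 0" and const_1 [simp]: "const 1 = 1"
  by (simp_all add: const_def)

lemma const_add: "const (a + b) = const a + const b"
  by (simp add: const_def single_add)

lemma const_mult: "const (a * b) = const a * const b"
  by (simp add: const_def mult_single)

lemma const_sum: "const (sum f A) = (\<Sum>x\<in>A. const (f x))"
  by (induction A rule: infinite_finite_induct) (auto simp: const_add)

lemma const_mult_single: "const r * Poly_Mapping.single \<alpha> c = Poly_Mapping.single \<alpha> (r * c)"
  by (simp add: const_def mult_single)

lemma mpoly_eq_sum_single:
  "p = (\<Sum>\<alpha>\<in>Poly_Mapping.keys p. Poly_Mapping.single \<alpha> (lkp p \<alpha>))"
proof (rule poly_mapping_eqI)
  fix \<beta>
  show "lkp p \<beta> = lkp (\<Sum>\<alpha>\<in>Poly_Mapping.keys p. Poly_Mapping.single \<alpha> (lkp p \<alpha>)) \<beta>"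
    by (auto simp: lookup_sum lookup_single when_def in_keys_iff)
qed

lemma mpoly_induct [case_names single add]:
  fixes p :: "('a \<Rightarrow>\<^sub>0 'b::comm_monoid_add)"
  assumes single: "\<And>\<alpha> c. P (Poly_Mapping.single \<alpha> c)"
    and add: "\<And>p q. P p \<Longrightarrow> P q \<Longrightarrow> P (p + q)"
  shows "P p"
proof -
  have "P (\<Sum>\<alpha>\<in>A. Poly_Mapping.single \<alpha> (lkp p \<alpha>))" if "finite A" for A
    using that
  proof (induction A)
    case empty
    \<comment> \<open>The zero polynomial is a monomial with coefficient 0, which is why the rule
      has no case for it.\<close>
    show ?case using single[of undefined 0] by simp
  qed (simp add: single add)
  from this[of "Poly_Mapping.keys p"] show ?thesis
    using poly_mapping_eqI[of p "\<Sum>\<alpha>\<in>Poly_Mapping.keys p. Poly_Mapping.single \<alpha> (lkp p \<alpha>)"]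
    by (auto simp: lookup_sum lookup_single when_def in_keys_iff)
qed

lemma lkp_const_mult [simp]: "lkp (const r * p) \<alpha> = r * lkp p \<alpha>"
  by (induction p rule: mpoly_induct)
    (auto simp: const_mult_single lookup_single when_def distrib_left lookup_add)

lemma lkp_mono_mult [simp]: "lkp (mono \<beta> * p) (\<beta> + \<alpha>) = lkp p \<alpha>"
  by (induction p rule: mpoly_induct)
    (auto simp: mult_single lookup_single when_def distrib_left lookup_add)

lemma keys_sum_subset: "Poly_Mapping.keys (sum f A) \<subseteq> (\<Union>x\<in>A. Poly_Mapping.keys (f x))"
proof (induction A rule: infinite_finite_induct)
  case (insert x F)
  then show ?case using keys_add[of "f x" "sum f F"] by auto
qed auto

lemma keys_const_mult: "Poly_Mapping.keys (const r * p) \<subseteq> Poly_Mapping.keys p"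
  by (auto simp: in_keys_iff)

lemma hdeg_0 [simp]: "0 \<in> hdeg d"
  by (simp add: hdeg_def)

lemma hdeg_add: "p \<in> hdeg d \<Longrightarrow> q \<in> hdeg d \<Longrightarrow> p + q \<in> hdeg d"
  using keys_add[of p q] by (auto simp: hdeg_def)

lemma hdeg_sum: "(\<And>x. x \<in> A \<Longrightarrow> f x \<in> hdeg d) \<Longrightarrow> sum f A \<in> hdeg d"
  by (induction A rule: infinite_finite_induct) (auto intro: hdeg_add)

lemma hdeg_const_mult: "p \<in> hdeg d \<Longrightarrow> const r * p \<in> hdeg d"
  using keys_const_mult[of r p] by (auto simp: hdeg_def)

lemma hdeg_single: "tdeg \<alpha> = d \<Longrightarrow> Poly_Mapping.single \<alpha> c \<in> hdeg d"
  by (simp add: hdeg_def)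

lemma hdeg_mult: "p \<in> hdeg d \<Longrightarrow> q \<in> hdeg e \<Longrightarrow> p * q \<in> hdeg (d + e)"
  using keys_mult[of p q] by (fastforce simp: hdeg_def tdeg_add)

lemma var_hdeg: "var i \<in> hdeg 1"
  unfolding var_def by (rule hdeg_single) simp

text \<open>One operation for two purposes: homogeneous components (\<open>hcomp\<close>) and
  setting the variables outside a face to zero (\<open>trunc\<close>).\<close>

definition restr :: "('a \<Rightarrow> bool) \<Rightarrow> ('a \<Rightarrow>\<^sub>0 real) \<Rightarrow> ('a \<Rightarrow>\<^sub>0 real)" where
  "restr P p = (\<Sum>\<alpha>\<in>{\<alpha>\<in>Poly_Mapping.keys p. P \<alpha>}. Poly_Mapping.single \<alpha> (lkp p \<alpha>))"

lemma lkp_restr [simp]: "lkp (restr P p) \<alpha> = (if P \<alpha> then lkp p \<alpha> else 0)"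
  by (auto simp: restr_def lookup_sum lookup_single when_def in_keys_iff)

lemma restr_add: "restr P (p + q) = restr P p + restr P q"
  by (rule poly_mapping_eqI) (simp add: lookup_add)

lemma restr_0 [simp]: "restr P 0 = 0"
  by (rule poly_mapping_eqI) simp

lemma restr_diff: "restr P (p - q) = restr P p - restr P q"
  by (rule poly_mapping_eqI) (simp add: lookup_minus)

lemma restr_sum: "restr P (sum f A) = (\<Sum>x\<in>A. restr P (f x))"
  by (induction A rule: infinite_finite_induct) (auto simp: restr_add)

lemma restr_const_mult: "restr P (const r * p) = const r * restr P p"
  by (rule poly_mapping_eqI) simp

lemma restr_single: "restr P (Poly_Mapping.single \<alpha> c) = (if P \<alpha> then Poly_Mapping.single \<alpha> c else 0)"
  by (rule poly_mapping_eqI) (auto simp: lookup_single when_def)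

lemma restr_restr: "restr P (restr Q p) = restr (\<lambda>\<alpha>. P \<alpha> \<and> Q \<alpha>) p"
  by (rule poly_mapping_eqI) simp

lemma keys_restr: "Poly_Mapping.keys (restr P p) = {\<alpha>\<in>Poly_Mapping.keys p. P \<alpha>}"
  by (auto simp: in_keys_iff split: if_splits)

lemma restr_eq_self: "(\<And>\<alpha>. \<alpha> \<in> Poly_Mapping.keys p \<Longrightarrow> P \<alpha>) \<Longrightarrow> restr P p = p"
  by (rule poly_mapping_eqI) (auto simp: in_keys_iff)

abbreviation hcomp :: "nat \<Rightarrow> 'v::finite mpoly \<Rightarrow> 'v mpoly" where
  "hcomp d \<equiv> restr (\<lambda>\<alpha>. tdeg \<alpha> = d)"

lemma hcomp_hdeg [simp]: "hcomp d p \<in> hdeg d"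
  by (auto simp: hdeg_def keys_restr)

lemma hcomp_eq_self: "p \<in> hdeg d \<Longrightarrow> hcomp d p = p"
  by (rule restr_eq_self) (auto simp: hdeg_def)

lemma hcomp_eq_0: "p \<in> hdeg d \<Longrightarrow> d \<noteq> e \<Longrightarrow> hcomp e p = 0"
  by (rule poly_mapping_eqI) (auto simp: hdeg_def in_keys_iff)

lemma sum_hcomp:
  assumes "\<And>\<alpha>. \<alpha> \<in> Poly_Mapping.keys p \<Longrightarrow> tdeg \<alpha> \<le> N"
  shows "p = (\<Sum>d\<le>N. hcomp d p)"
  using assms by (intro poly_mapping_eqI) (auto simp: lookup_sum in_keys_iff)

lemma ex_sum_hcomp: "\<exists>N. p = (\<Sum>d\<le>N. hcomp d p)"
  by (rule exI[of _ "Max (tdeg ` Poly_Mapping.keys p)"], rule sum_hcomp) simp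

lemma hcomp_mult_hdeg:
  assumes q: "q \<in> hdeg e"
  shows "hcomp (d + e) (q * p) = q * hcomp d p"
proof (induction p rule: mpoly_induct)
  case (single \<alpha> c)
  have "q * Poly_Mapping.single \<alpha> c \<in> hdeg (e + tdeg \<alpha>)"
    by (rule hdeg_mult[OF q hdeg_single]) simp
  then show ?case
    by (auto simp: restr_single hcomp_eq_self hcomp_eq_0 add.commute)
qed (simp add: distrib_left restr_add)

lemma hcomp_mult_low:
  assumes q: "q \<in> hdeg e" and "d < e"
  shows "hcomp d (q * p) = 0"
proof (induction p rule: mpoly_induct)
  case (single \<alpha> c)
  have "q * Poly_Mapping.single \<alpha> c \<in> hdeg (e + tdeg \<alpha>)"
    by (rule hdeg_mult[OF q hdeg_single]) simp
  then show ?case using assms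
    by (intro hcomp_eq_0) auto
qed (simp add: distrib_left restr_add)

abbreviation trunc :: "'v set \<Rightarrow> 'v mpoly \<Rightarrow> 'v mpoly" where
  "trunc I \<equiv> restr (\<lambda>\<alpha>. supp \<alpha> \<subseteq> I)"

text \<open>\<open>trunc I\<close> kills the variables outside \<open>I\<close>: the support of a
  product monomial is the union of the supports, so it stays in \<open>I\<close> exactly when both
  do.\<close>

lemma trunc_mult: "trunc I (p * q) = trunc I p * trunc I q"
proof (induction p rule: mpoly_induct)
  case (single \<alpha> c)
  show ?case
    by (induction q rule: mpoly_induct)
      (auto simp: mult_single restr_single restr_add distrib_left supp_add)
qed (simp add: distrib_right restr_add)

text \<open>Covers both evaluation at a point and substitution of polynomials.\<close>

definition subst :: "(real \<Rightarrow> 'b::comm_ring_1) \<Rightarrow> ('v::finite \<Rightarrow> 'b) \<Rightarrow> 'v mpoly \<Rightarrow> 'b" where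
  "subst h f p = (\<Sum>\<alpha>\<in>Poly_Mapping.keys p. h (lkp p \<alpha>) * (\<Prod>i\<in>UNIV. f i ^ lkp \<alpha> i))"

locale coeff_hom =
  fixes h :: "real \<Rightarrow> 'b::comm_ring_1"
  assumes h_add: "h (a + b) = h a + h b" and h_mult: "h (a * b) = h a * h b" and h_1: "h 1 = 1"
begin

lemma h_0: "h 0 = 0"
  using h_add[of 0 0] by simp

lemma subst_superset:
  assumes "finite A" "Poly_Mapping.keys p \<subseteq> A"
  shows "subst h f p = (\<Sum>\<alpha>\<in>A. h (lkp p \<alpha>) * (\<Prod>i\<in>UNIV. f i ^ lkp \<alpha> i))"
  unfolding subst_def using assms
  by (intro sum.mono_neutral_left) (auto simp: in_keys_iff h_0)

lemma subst_add: "subst h f (p + q) = subst h f p + subst h f q"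
proof -
  let ?A = "Poly_Mapping.keys p \<union> Poly_Mapping.keys q"
  have "Poly_Mapping.keys (p + q) \<subseteq> ?A" by (rule keys_add)
  then show ?thesis
    by (simp add: subst_superset[of ?A] lookup_add h_add distrib_right sum.distrib)
qed

lemma subst_single: "subst h f (Poly_Mapping.single \<alpha> c) = h c * (\<Prod>i\<in>UNIV. f i ^ lkp \<alpha> i)"
  by (simp add: subst_def h_0)

lemma subst_mult: "subst h f (p * q) = subst h f p * subst h f q"
proof (induction p rule: mpoly_induct)
  case (single \<alpha> c)
  show ?case
    by (induction q rule: mpoly_induct)
      (simp_all add: mult_single subst_single subst_add distrib_left distrib_right h_mult
        lookup_add power_add prod.distrib mult_ac)
qed (simp add: distrib_right subst_add)

lemma subst_const: "subst h f (const r) = h r"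
  by (simp add: const_def subst_single)

lemma subst_0: "subst h f 0 = 0"
  by (simp add: subst_def)

lemma subst_1: "subst h f 1 = 1"
  using subst_const[of f 1] by (simp add: h_1)

lemma subst_var: "subst h f (var i) = f i"
proof -
  have "(\<Prod>j\<in>UNIV. f j ^ lkp (Poly_Mapping.single i 1) j) = (\<Prod>j\<in>UNIV. if j = i then f j else 1)"
    by (rule prod.cong) (auto simp: lookup_single when_def)
  then show ?thesis by (simp add: var_def subst_single h_1)
qed

lemma subst_sum: "subst h f (sum g A) = (\<Sum>x\<in>A. subst h f (g x))"
  by (induction A rule: infinite_finite_induct) (auto simp: subst_add subst_0)

lemma subst_minus: "subst h f (- p) = - subst h f p"
  using subst_add[of f p "- p"] by (simp add: subst_0 add_eq_0_iff)

lemma subst_diff: "subst h f (p - q) = subst h f p - subst h f q"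
  using subst_add[of f p "- q"] by (simp add: subst_minus)

lemma subst_prod: "subst h f (prod g A) = (\<Prod>x\<in>A. subst h f (g x))"
  by (induction A rule: infinite_finite_induct) (auto simp: subst_mult subst_1)

end

lemma poly_eval_subst: "poly_eval = subst (\<lambda>x. x)"
  by (intro ext) (simp add: poly_eval_def subst_def)

interpretation eval: coeff_hom "\<lambda>x::real. x"
  rewrites "subst (\<lambda>x::real. x) = poly_eval"
  by (unfold_locales) (auto simp: poly_eval_subst)

interpretation csubst: coeff_hom const
  by (unfold_locales) (auto simp: const_add const_mult)

lemma mono_eq_prod_var: "mono (\<alpha> :: 'v::finite \<Rightarrow>\<^sub>0 nat) = (\<Prod>i\<in>UNIV. var i ^ lkp \<alpha> i)"
proof -
  have p: "var i ^ k = mono (Poly_Mapping.single i k)" for i :: 'v and k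
    by (induction k) (auto simp: var_def mult_single single_add[symmetric])
  have "(\<Prod>i\<in>A. mono (g i)) = mono (\<Sum>i\<in>A. g i)" for A :: "'v set" and g :: "'v \<Rightarrow> ('v \<Rightarrow>\<^sub>0 nat)"
    by (induction A rule: infinite_finite_induct) (auto simp: mult_single)
  moreover have "(\<Sum>i\<in>UNIV. Poly_Mapping.single i (lkp \<alpha> i)) = \<alpha>"
    by (rule poly_mapping_eqI) (simp add: lookup_sum lookup_single when_def sum.delta')
  ultimately show ?thesis by (simp add: p)
qed

lemma mpoly_eq_sum: "p = (\<Sum>\<alpha>\<in>Poly_Mapping.keys p. const (lkp p \<alpha>) * mono \<alpha>)"
  using mpoly_eq_sum_single[of p] by (simp add: const_mult_single)

text \<open>Squarefree monomials: those of facets separate the points p_I, those of ridges yield the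
  cycle condition, those of nonfaces generate the Stanley-Reisner ideal.\<close>

definition expo :: "'v set \<Rightarrow> ('v \<Rightarrow>\<^sub>0 nat)" where
  "expo I = (\<Sum>i\<in>I. Poly_Mapping.single i 1)"

lemma lkp_expo: "finite I \<Longrightarrow> lkp (expo I) i = (if i \<in> I then 1 else 0)"
  by (simp add: expo_def lookup_sum lookup_single when_def)

lemma supp_expo: "finite I \<Longrightarrow> supp (expo I) = I"
  by (auto simp: in_keys_iff lkp_expo split: if_splits)

lemma tdeg_expo: "tdeg (expo I) = card (I :: 'v::finite set)"
  by (simp add: tdeg_def lkp_expo sum.If_cases)

lemma prod_var: "(\<Prod>i\<in>I. var i) = mono (expo (I :: 'v::finite set))"
proof -
  have "(\<Prod>i\<in>A. mono (g i)) = mono (\<Sum>i\<in>A. g i)" for A :: "'v set" and g :: "'v \<Rightarrow> ('v \<Rightarrow>\<^sub>0 nat)"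
    by (induction A rule: infinite_finite_induct) (auto simp: mult_single)
  then show ?thesis by (simp add: var_def expo_def)
qed

lemma poly_eval_const_mult: "poly_eval a (const r * p) = r * poly_eval a p"
  by (simp add: eval.subst_mult eval.subst_const)

section \<open>Dimensions of subspaces\<close>

text \<open>Polynomials form an infinite-dimensional space, so finiteness enters through a finite
  \<open>F\<close> whose span contains \<open>W\<close>; graded pieces provide one.\<close>

lemma (in vector_space) finite_basis_extend:
  assumes "subspace W" "finite F" "W \<subseteq> span F" "S \<subseteq> W" "independent S"
  obtains B where "S \<subseteq> B" "B \<subseteq> W" "independent B" "span B = W" "finite B" "card B = dim W"
proof -
  obtain B where B: "S \<subseteq> B" "B \<subseteq> W" "independent B" "W \<subseteq> span B"
    using maximal_independent_subset_extend[OF assms(4,5)] by metis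
  have "finite B"
    using independent_span_bound[of F B] B assms by auto
  moreover have "span B = W"
    using B assms(1) by (simp add: span_minimal subset_antisym)
  ultimately show ?thesis
    using that B by (metis basis_card_eq_dim)
qed

text \<open>Rank-nullity for the map from \<open>W\<close> to the quotient of \<open>U'\<close> +
  f(\<open>W\<close>) by \<open>U'\<close>, written without quotients. Later \<open>f\<close>
  multiplies by a linear form and \<open>U'\<close> is a graded piece of the ideal generated so
  far.\<close>

lemma (in vector_space_pair) dim_exact:
  assumes lf: "Vector_Spaces.linear s1 s2 f"
    and W: "vs1.subspace W" "finite F" "W \<subseteq> vs1.span F"
    and U': "vs2.subspace U'" "finite F'" "U' \<subseteq> vs2.span F'"
  shows "vs2.dim {u + f x |u x. u \<in> U' \<and> x \<in> W} + vs1.dim {x \<in> W. f x \<in> U'} = vs2.dim U' + vs1.dim W"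
proof -
  define U where "U = {x \<in> W. f x \<in> U'}"
  interpret f: Vector_Spaces.linear s1 s2 f by fact
  have subU: "vs1.subspace U"
    using W(1) U'(1)
    by (auto simp: U_def vs1.subspace_def vs2.subspace_def f.add f.scale f.zero)
  have UF: "U \<subseteq> vs1.span F" and UW: "U \<subseteq> W" using W(3) by (auto simp: U_def)
  obtain B1 where B1: "B1 \<subseteq> U" "vs1.independent B1" "vs1.span B1 = U" "finite B1" "card B1 = vs1.dim U"
    by (rule vs1.finite_basis_extend[OF subU W(2) UF empty_subsetI vs1.independent_empty]) auto
  obtain B where B: "B1 \<subseteq> B" "B \<subseteq> W" "vs1.independent B" "vs1.span B = W" "finite B" "card B = vs1.dim W"
    by (rule vs1.finite_basis_extend[OF W subset_trans[OF B1(1) UW] B1(2)]) auto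
  obtain B2 where B2: "B2 \<subseteq> U'" "vs2.independent B2" "vs2.span B2 = U'" "finite B2" "card B2 = vs2.dim U'"
    by (rule vs2.finite_basis_extend[OF U' empty_subsetI vs2.independent_empty]) auto
  \<comment> \<open>\<open>B1\<close> spans the preimage of \<open>U'\<close> in \<open>W\<close>,
    and \<open>B - B1\<close> spans a complement. Adding complement vectors one at a time keeps
    their images distinct and independent modulo \<open>U'\<close>.\<close>
  have ind: "vs2.independent (B2 \<union> f ` S) \<and> card (B2 \<union> f ` S) = card B2 + card S"
    if "finite S" "S \<subseteq> B - B1" for S
    using that
  proof (induction S rule: finite_induct)
    case empty
    then show ?case using B2 by simp
  next
    case (insert s S)
    have "f s \<notin> vs2.span (B2 \<union> f ` S)"
    proof
      assume "f s \<in> vs2.span (B2 \<union> f ` S)"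
      then obtain u t where ut: "u \<in> vs2.span B2" "t \<in> vs1.span S" "f s = u + f t"
        unfolding vs2.span_Un f.span_image by auto
      have "t \<in> W"
        using ut(2) insert.prems B vs1.span_mono[of S B] by auto
      moreover have "s \<in> W" using insert.prems B by auto
      ultimately have "s - t \<in> W" by (intro vs1.subspace_diff[OF W(1)])
      moreover have "f (s - t) = u" using ut by (simp add: f.diff)
      ultimately have "s - t \<in> U" using ut B2 by (auto simp: U_def)
      then have "s - t \<in> vs1.span (B1 \<union> S)"
        using B1(3) vs1.span_mono[of B1 "B1 \<union> S"] by (metis Un_upper1 subsetD)
      moreover have "t \<in> vs1.span (B1 \<union> S)" using ut vs1.span_mono[of S "B1 \<union> S"] by auto
      ultimately have "s \<in> vs1.span (B1 \<union> S)" using vs1.span_add[of "s - t" _ t] by simp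
      moreover have "B1 \<union> S \<subseteq> B - {s}" using insert B by auto
      ultimately have "s \<in> vs1.span (B - {s})" using vs1.span_mono by blast
      then show False using B(3) insert.prems unfolding vs1.dependent_def by auto
    qed
    moreover from this have "f s \<notin> B2 \<union> f ` S" by (metis vs2.span_base)
    ultimately show ?case using insert B2(4) by (auto simp: vs2.independent_insertI)
  qed
  have "vs2.span (B2 \<union> f ` (B - B1)) = {u + f x |u x. u \<in> U' \<and> x \<in> W}"
  proof (intro equalityI subsetI)
    fix y assume "y \<in> vs2.span (B2 \<union> f ` (B - B1))"
    then obtain u t where ut: "u \<in> vs2.span B2" "t \<in> vs1.span (B - B1)" "y = u + f t"
      unfolding vs2.span_Un f.span_image by auto
    moreover have "t \<in> W" using ut(2) B vs1.span_mono[of "B - B1" B] by auto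
    ultimately show "y \<in> {u + f x |u x. u \<in> U' \<and> x \<in> W}"
      using B2(3) by auto
  next
    fix y assume "y \<in> {u + f x |u x. u \<in> U' \<and> x \<in> W}"
    then obtain u x where ux: "u \<in> U'" "x \<in> W" "y = u + f x" by auto
    then have "x \<in> vs1.span (B1 \<union> (B - B1))" using B by (simp add: Un_absorb1)
    then obtain b t where bt: "b \<in> vs1.span B1" "t \<in> vs1.span (B - B1)" "x = b + t"
      unfolding vs1.span_Un by auto
    have "u + f b \<in> vs2.span B2"
      using bt B1 ux B2 U'(1) by (auto simp: U_def vs2.subspace_def)
    moreover have "f t \<in> vs2.span (f ` (B - B1))" using bt f.span_image by auto
    moreover have "y = (u + f b) + f t" using ux bt by (simp add: f.add add.assoc)
    ultimately show "y \<in> vs2.span (B2 \<union> f ` (B - B1))"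
      unfolding vs2.span_Un by auto
  qed
  then have "vs2.dim {u + f x |u x. u \<in> U' \<and> x \<in> W} = card (B2 \<union> f ` (B - B1))"
    using ind[of "B - B1"] B(5) vs2.dim_span_eq_card_independent[of "B2 \<union> f ` (B - B1)"] by simp
  also have "\<dots> + vs1.dim U = vs2.dim U' + vs1.dim W"
    using ind[of "B - B1"] B B1 B2 card_mono[OF B(5) B(1)] by (simp add: card_Diff_subset)
  finally show ?thesis by (simp add: U_def)
qed

lemma dim_ker_image:
  fixes f :: "'a::euclidean_space \<Rightarrow> 'b::euclidean_space"
  assumes "linear f" "subspace W"
  shows "dim (f ` W) + dim {x \<in> W. f x = 0} = dim W"
proof -
  have im: "{u + f x |u x. u \<in> {0} \<and> x \<in> W} = f ` W" by auto
  have "dim {u + f x |u x. u \<in> {0} \<and> x \<in> W} + dim {x \<in> W. f x \<in> {0}} = dim ({0} :: 'b set) + dim W"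
    by (rule real_vector.dim_exact[of f W Basis "{0}" "{}"])
      (use assms in \<open>simp_all add: subspace_def\<close>)
  then show ?thesis unfolding im by simp
qed

lemma dim_coordinate_subspace:
  fixes S :: "'n::finite set"
  shows "dim {x :: real^'n. \<forall>i. i \<notin> S \<longrightarrow> x $ i = 0} = card S"
proof -
  let ?B = "(\<lambda>i. axis i (1::real)) ` S" and ?V = "{x :: real^'n. \<forall>i. i \<notin> S \<longrightarrow> x $ i = 0}"
  have inj: "inj_on (\<lambda>i. axis i (1::real)) S"
    by (auto intro!: inj_onI simp: axis_eq_axis)
  have ind: "independent ?B"
    by (rule independent_mono[OF independent_Basis]) (auto simp: Basis_vec_def)
  have sub: "?B \<subseteq> ?V" by (auto simp: axis_def)
  have span: "?V \<subseteq> span ?B"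
  proof
    fix x assume "x \<in> ?V"
    then have x: "x $ j = 0" if "j \<notin> S" for j using that by auto
    have "x $ j = (\<Sum>i\<in>S. (x $ i) *\<^sub>R axis i 1) $ j" for j
    proof -
      have "(\<Sum>i\<in>S. (x $ i) *\<^sub>R axis i 1) $ j = (\<Sum>i\<in>S. if i = j then x $ i else 0)"
        unfolding sum_component by (rule sum.cong[OF refl]) (simp add: axis_def)
      then show ?thesis using x by (simp add: sum.delta)
    qed
    then have "x = (\<Sum>i\<in>S. (x $ i) *\<^sub>R axis i 1)"
      by (intro iffD2[OF Finite_Cartesian_Product.vec_eq_iff] allI)
    also have "\<dots> \<in> span ?B" by (intro span_sum span_scale span_base) auto
    finally show "x \<in> span ?B" .
  qed
  have "dim ?V = card ?B" by (rule dim_unique[OF sub span ind refl])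
  then show ?thesis by (simp add: card_image inj)
qed

section \<open>Chains of faces containing a fixed simplex\<close>

definition sg :: "'v::linorder \<Rightarrow> 'v set \<Rightarrow> real" where
  "sg i J = (-1) ^ card {k\<in>J. k < i}"

lemma boundary_nth: "boundary c $ J = (\<Sum>i\<in>-J. sg i J * c $ (insert i J))"
  by (simp add: boundary_def sg_def)

lemma linear_boundary: "linear boundary"
  by (intro linearI)
    (simp_all add: Finite_Cartesian_Product.vec_eq_iff boundary_nth distrib_left sum.distrib sum_distrib_left mult_ac)

lemma sg_sq [simp]: "sg i J * sg i J = 1"
  by (simp add: sg_def flip: power_add)

lemma sg_insert: "finite J \<Longrightarrow> l \<notin> J \<Longrightarrow> sg i (insert l J) = (if l < i then - sg i J else sg i J)"
proof -
  assume J: "finite J" "l \<notin> J"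
  have "{k\<in>insert l J. k < i} = (if l < i then insert l {k\<in>J. k < i} else {k\<in>J. k < i})" by auto
  then show ?thesis using J by (simp add: sg_def)
qed

lemma sg_Un: "finite I \<Longrightarrow> finite J \<Longrightarrow> I \<inter> J = {} \<Longrightarrow> sg i (I \<union> J) = sg i I * sg i J"
proof -
  assume "finite I" "finite J" "I \<inter> J = {}"
  moreover have "{k\<in>I \<union> J. k < i} = {k\<in>I. k < i} \<union> {k\<in>J. k < i}" by auto
  moreover have "{k\<in>I. k < i} \<inter> {k\<in>J. k < i} = {}" using calculation by auto
  ultimately show ?thesis by (simp add: sg_def card_Un_disjoint power_add)
qed

lemma boundary_boundary: "boundary (boundary c) = 0"
proof -
  have "boundary (boundary c) $ J = 0" for J
  proof -
    let ?t = "\<lambda>(i, l). sg i J * sg l (insert i J) * c $ (insert l (insert i J))"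
    let ?P = "{(i, l). i \<notin> J \<and> l \<notin> J \<and> i \<noteq> l}"
    have "boundary (boundary c) $ J = (\<Sum>i\<in>-J. \<Sum>l\<in>-insert i J. ?t (i, l))"
      by (simp add: boundary_nth sum_distrib_left mult.assoc)
    also have "\<dots> = sum ?t (SIGMA i:-J. -insert i J)"
      by (subst sum.Sigma) auto
    also have "(SIGMA i:-J. -insert i J) = ?P" by auto
    finally have e: "boundary (boundary c) $ J = sum ?t ?P" .
    \<comment> \<open>The two signs multiply to \<open>sg i J * sg l J\<close>, negated exactly when
      i < l, so exchanging i and l reverses the term.\<close>
    have anti: "?t (l, i) = - ?t (i, l)" if "(i, l) \<in> ?P" for i l
      using that by (cases "i < l") (auto simp: sg_insert insert_commute)
    have "sum ?t ?P = sum (\<lambda>(i, l). ?t (l, i)) ?P"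
      by (rule sum.reindex_bij_witness[of _ "\<lambda>(i, l). (l, i)" "\<lambda>(i, l). (l, i)"]) auto
    also have "\<dots> = sum (\<lambda>x. - ?t x) ?P"
      using anti by (intro sum.cong) auto
    also have "\<dots> = - sum ?t ?P" by (simp add: sum_negf)
    finally show ?thesis using e by simp
  qed
  then show ?thesis by (simp add: Finite_Cartesian_Product.vec_eq_iff)
qed

section \<open>Relative chains of an open star and their comparison with the link\<close>

text \<open>Chains of \<open>K\<close> modulo the faces that do not contain \<open>\<sigma>\<close>;
  k counts vertices, so the empty face has index 0. They reappear as the coefficients of a monomial
  with support \<open>\<sigma>\<close>.\<close>

definition star_chains :: "'v::{finite,linorder} set set \<Rightarrow> 'v set \<Rightarrow> nat \<Rightarrow> 'v chain set" where
  "star_chains K \<sigma> k = {c. \<forall>I. \<not> (\<sigma> \<subseteq> I \<and> I \<in> K \<and> card I = k) \<longrightarrow> c $ I = 0}"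

definition star_boundary :: "'v::{finite,linorder} set \<Rightarrow> 'v chain \<Rightarrow> 'v chain" where
  "star_boundary \<sigma> c = (\<chi> I. if \<sigma> \<subseteq> I then boundary c $ I else 0)"

definition star_cycles :: "'v::{finite,linorder} set set \<Rightarrow> 'v set \<Rightarrow> nat \<Rightarrow> 'v chain set" where
  "star_cycles K \<sigma> k = {c \<in> star_chains K \<sigma> k. star_boundary \<sigma> c = 0}"

lemma star_boundary_nth: "star_boundary \<sigma> c $ I = (if \<sigma> \<subseteq> I then boundary c $ I else 0)"
  by (simp add: star_boundary_def)

lemma linear_star_boundary: "linear (star_boundary \<sigma>)"
  by (intro linearI)
    (simp_all add: Finite_Cartesian_Product.vec_eq_iff star_boundary_nth linear_add[OF linear_boundary] linear_scale[OF linear_boundary])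

text \<open>At a face containing \<open>\<sigma>\<close> the boundary only reads larger faces, which
  contain \<open>\<sigma>\<close> too, so the discarded entries are never seen.\<close>

lemma star_boundary_star_boundary: "star_boundary \<sigma> (star_boundary \<sigma> c) = 0"
proof -
  have "boundary (star_boundary \<sigma> c) $ I = boundary (boundary c) $ I" if "\<sigma> \<subseteq> I" for I
    unfolding boundary_nth[of _ I] using that by (intro sum.cong) (auto simp: star_boundary_nth)
  then show ?thesis by (simp add: Finite_Cartesian_Product.vec_eq_iff star_boundary_nth boundary_boundary)
qed

lemma subspace_star_chains: "subspace (star_chains K \<sigma> k)"
  by (auto simp: subspace_def star_chains_def)

lemma star_boundary_star_chains:
  assumes "abstract_simplicial_complex K" "c \<in> star_chains K \<sigma> (Suc k)"
  shows "star_boundary \<sigma> c \<in> star_chains K \<sigma> k"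
proof -
  have "boundary c $ I = 0" if "\<sigma> \<subseteq> I" "\<not> (I \<in> K \<and> card I = k)" for I
  proof -
    have "c $ insert i I = 0" if "i \<notin> I" for i
    proof -
      have "I \<subseteq> insert i I" by auto
      then have "insert i I \<in> K \<Longrightarrow> I \<in> K"
        using assms(1) unfolding abstract_simplicial_complex_def by blast
      then show ?thesis
        using assms(2) \<open>\<not> (I \<in> K \<and> card I = k)\<close> that unfolding star_chains_def by auto
    qed
    then show ?thesis by (auto simp: boundary_nth intro!: sum.neutral)
  qed
  then show ?thesis by (auto simp: star_chains_def star_boundary_nth)
qed

lemma star_boundary_star_chains_0: "c \<in> star_chains K \<sigma> 0 \<Longrightarrow> star_boundary \<sigma> c = 0"
  by (auto simp: Finite_Cartesian_Product.vec_eq_iff star_chains_def star_boundary_nth boundary_nth intro!: sum.neutral)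

text \<open>The sign by which the identification of the faces containing \<open>\<sigma>\<close> with the faces of the link
  of \<open>\<sigma>\<close> becomes a chain map.\<close>

definition link_sign :: "'v::{finite,linorder} set \<Rightarrow> 'v set \<Rightarrow> real" where
  "link_sign \<sigma> J = (\<Prod>j\<in>J. sg j \<sigma>)"

lemma link_sign_sq [simp]: "link_sign \<sigma> J * link_sign \<sigma> J = 1"
  by (simp add: link_sign_def flip: prod.distrib)

lemma link_sign_nonzero [simp]: "link_sign \<sigma> J \<noteq> 0"
  by (simp add: link_sign_def sg_def)

definition to_link :: "'v::{finite,linorder} set \<Rightarrow> 'v chain \<Rightarrow> 'v chain" where
  "to_link \<sigma> c = (\<chi> J. if J \<inter> \<sigma> = {} then link_sign \<sigma> J * c $ (\<sigma> \<union> J) else 0)"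

definition of_link :: "'v::{finite,linorder} set \<Rightarrow> 'v chain \<Rightarrow> 'v chain" where
  "of_link \<sigma> c = (\<chi> I. if \<sigma> \<subseteq> I then link_sign \<sigma> (I - \<sigma>) * c $ (I - \<sigma>) else 0)"

text \<open>Adjoining i to J multiplies \<open>link_sign\<close> by \<open>sg i \<sigma>\<close>,
  which is the factor between \<open>sg i J\<close> and \<open>sg i (\<sigma> \<union> J)\<close>;
  hence the transfer commutes with boundaries.\<close>

lemma boundary_to_link:
  "boundary (to_link \<sigma> c) $ J = (if J \<inter> \<sigma> = {} then link_sign \<sigma> J * boundary c $ (\<sigma> \<union> J) else 0)"
proof (cases "J \<inter> \<sigma> = {}")
  case True
  have "boundary (to_link \<sigma> c) $ J = (\<Sum>i\<in>-J. sg i J * to_link \<sigma> c $ (insert i J))"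
    by (rule boundary_nth)
  also have "\<dots> = (\<Sum>i\<in>-(\<sigma> \<union> J). sg i J * to_link \<sigma> c $ (insert i J))"
    by (rule sum.mono_neutral_right) (auto simp: to_link_def)
  also have "\<dots> = (\<Sum>i\<in>-(\<sigma> \<union> J). link_sign \<sigma> J * (sg i (\<sigma> \<union> J) * c $ (insert i (\<sigma> \<union> J))))"
    using True by (intro sum.cong) (auto simp: to_link_def link_sign_def sg_Un Int_commute)
  finally show ?thesis using True by (simp add: boundary_nth sum_distrib_left)
next
  case False
  then show ?thesis
    by (auto simp: boundary_nth to_link_def intro!: sum.neutral)
qed

lemma to_link_of_link:
  assumes "\<And>J. J \<inter> \<sigma> \<noteq> {} \<Longrightarrow> c $ J = 0"
  shows "to_link \<sigma> (of_link \<sigma> c) = c"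
proof -
  have "\<sigma> \<union> J - \<sigma> = J" if "J \<inter> \<sigma> = {}" for J using that by auto
  then show ?thesis using assms
    by (auto simp: Finite_Cartesian_Product.vec_eq_iff to_link_def of_link_def simp flip: mult.assoc)
qed

lemma to_link_cycles:
  assumes "c \<in> star_cycles K \<sigma> k" "int k = j + 1 + int (card \<sigma>)"
  shows "to_link \<sigma> c \<in> cycles (link K \<sigma>) j"
proof -
  have "to_link \<sigma> c \<in> chains (link K \<sigma>) j"
    using assms unfolding chains_def star_cycles_def star_chains_def
    by (auto simp: to_link_def simplices_def link_def card_Un_disjoint Int_commute)
  moreover have "boundary (to_link \<sigma> c) = 0"
    using assms(1)
    by (auto simp: Finite_Cartesian_Product.vec_eq_iff boundary_to_link star_cycles_def star_boundary_nth)
      (metis Un_upper1)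
  ultimately show ?thesis by (simp add: cycles_def)
qed

lemma homology_zeroD:
  assumes "homology_zero K j" "z \<in> cycles K j"
  shows "z \<in> boundaries K j"
proof -
  have 0: "0 \<in> boundaries K j"
    unfolding boundaries_def
    by (rule image_eqI[of _ _ 0]) (auto simp: linear_0[OF linear_boundary] chains_def)
  have "homology_class K j z = homology_class K j 0"
    using assms by (auto simp: homology_zero_def reduced_homology_def)
  moreover have "z \<in> homology_class K j z"
    unfolding homology_class_def using 0 by force
  ultimately show ?thesis by (auto simp: homology_class_def)
qed

text \<open>The homology of the link vanishes below the top; a face with k vertices above
  \<open>\<sigma>\<close> becomes a link simplex of dimension k - 1 -
  |\<open>\<sigma>\<close>|.\<close>

lemma star_exact:
  assumes K: "abstract_simplicial_complex K" and hs: "homology_sphere n K" and "\<sigma> \<in> K" "k < n"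
    and c: "c \<in> star_cycles K \<sigma> k"
  shows "\<exists>b\<in>star_chains K \<sigma> (Suc k). star_boundary \<sigma> b = c"
proof (cases "card \<sigma> \<le> k")
  case True
  let ?j = "int k - 1 - int (card \<sigma>)"
  have "homology_zero (link K \<sigma>) ?j"
    using hs assms(3,4) unfolding homology_sphere_def by auto
  then have "to_link \<sigma> c \<in> boundaries (link K \<sigma>) ?j"
    using to_link_cycles[OF c, of ?j] by (intro homology_zeroD) auto
  then obtain b where b: "b \<in> chains (link K \<sigma>) (?j + 1)" "boundary b = to_link \<sigma> c"
    unfolding boundaries_def by auto
  have b0: "b $ J = 0" if "\<not> (J \<inter> \<sigma> = {} \<and> \<sigma> \<union> J \<in> K \<and> card J + card \<sigma> = Suc k)" for J
    using b(1) that True by (auto simp: chains_def simplices_def link_def)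
  have tob: "to_link \<sigma> (of_link \<sigma> b) = b"
    by (rule to_link_of_link) (auto intro: b0)
  have "of_link \<sigma> b \<in> star_chains K \<sigma> (Suc k)"
  proof -
    have "b $ (I - \<sigma>) = 0" if "\<sigma> \<subseteq> I" "\<not> (I \<in> K \<and> card I = Suc k)" for I
    proof (rule b0)
      have "\<sigma> \<union> (I - \<sigma>) = I" "card (I - \<sigma>) + card \<sigma> = card I"
        using that by (auto simp: card_Diff_subset card_mono)
      then show "\<not> ((I - \<sigma>) \<inter> \<sigma> = {} \<and> \<sigma> \<union> (I - \<sigma>) \<in> K \<and> card (I - \<sigma>) + card \<sigma> = Suc k)"
        using that by simp
    qed
    then show ?thesis by (auto simp: star_chains_def of_link_def)
  qed
  moreover have "star_boundary \<sigma> (of_link \<sigma> b) = c"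
  proof -
    have "boundary (of_link \<sigma> b) $ I = c $ I" if "\<sigma> \<subseteq> I" for I
    proof -
      have I: "\<sigma> \<union> (I - \<sigma>) = I" "(I - \<sigma>) \<inter> \<sigma> = {}" using that by auto
      have "boundary b $ (I - \<sigma>) = to_link \<sigma> c $ (I - \<sigma>)" by (simp add: b)
      then show ?thesis
        using boundary_to_link[of \<sigma> "of_link \<sigma> b" "I - \<sigma>"] I
        by (simp add: tob to_link_def[of \<sigma> c])
    qed
    moreover have "c $ I = 0" if "\<not> \<sigma> \<subseteq> I" for I
      using c that by (auto simp: star_cycles_def star_chains_def)
    ultimately show ?thesis by (auto simp: Finite_Cartesian_Product.vec_eq_iff star_boundary_nth)
  qed
  ultimately show ?thesis by blast
next
  case False
  have "\<not> (\<sigma> \<subseteq> I \<and> I \<in> K \<and> card I = k)" for I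
    using False card_mono[of I \<sigma>] by auto
  then have "c $ I = 0" for I
    using c unfolding star_cycles_def star_chains_def by blast
  then have "c = 0" by (simp add: Finite_Cartesian_Product.vec_eq_iff)
  then show ?thesis
    using subspace_0[OF subspace_star_chains] linear_0[OF linear_star_boundary] by metis
qed

text \<open>In the top degree there are no boundaries, so a homology class is a single cycle and the
  isomorphism with the reals acts on cycles; z0 is the one it sends to 1.\<close>

lemma cycles_top_dim1:
  assumes "homology_iso_real L j" "\<And>J. J \<in> L \<Longrightarrow> int (card J) \<le> j + 1"
  shows "\<exists>z0\<in>cycles L j. z0 \<noteq> 0 \<and> (\<forall>z\<in>cycles L j. \<exists>r. z = r *\<^sub>R z0)"
proof -
  obtain \<phi> where bij: "bij_betw \<phi> (reduced_homology L j) UNIV"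
    and sc: "\<And>r x. x \<in> cycles L j \<Longrightarrow> \<phi> (homology_class L j (r *\<^sub>R x)) = r * \<phi> (homology_class L j x)"
    using assms(1) unfolding homology_iso_real_def by blast
  have "chains L (j + 1) = {0}"
    using assms(2) by (fastforce simp: chains_def simplices_def Finite_Cartesian_Product.vec_eq_iff)
  then have "boundaries L j = {0}"
    by (simp add: boundaries_def linear_0[OF linear_boundary])
  then have cl: "homology_class L j z = {z}" for z
    by (simp add: homology_class_def)
  have rsc: "r *\<^sub>R z \<in> cycles L j" if "z \<in> cycles L j" for r z
    using that by (auto simp: cycles_def chains_def linear_scale[OF linear_boundary])
  have "1 \<in> \<phi> ` (\<lambda>z. {z}) ` cycles L j"
    using bij by (simp add: bij_betw_def reduced_homology_def cl[abs_def])
  then obtain z0 where z0: "z0 \<in> cycles L j" "\<phi> {z0} = 1" by auto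
  have inj: "inj_on \<phi> ((\<lambda>z. {z}) ` cycles L j)"
    using bij by (simp add: bij_betw_def reduced_homology_def cl[abs_def])
  have "z0 \<noteq> 0"
  proof
    assume "z0 = 0"
    then show False using sc[OF z0(1), of 0] z0(2) by (simp add: cl)
  qed
  moreover have "\<exists>r. z = r *\<^sub>R z0" if "z \<in> cycles L j" for z
  proof -
    have "\<phi> {z} = \<phi> {\<phi> {z} *\<^sub>R z0}" using sc[OF z0(1), of "\<phi> {z}"] z0(2) by (simp add: cl)
    then have "{z} = {\<phi> {z} *\<^sub>R z0}"
      by (rule inj_onD[OF inj]) (use that rsc[OF z0(1)] in auto)
    then have "z = \<phi> {z} *\<^sub>R z0" by simp
    then show ?thesis by (rule exI)
  qed
  ultimately show ?thesis using z0(1) by (intro bexI[of _ z0] conjI ballI)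
qed

text \<open>The top cycles of the link form a line, so any nonzero \<open>e\<close> generates. With
  \<open>e\<close> the restricted orientation this makes the generator explicit.\<close>

lemma star_cycles_top:
  assumes hs: "homology_sphere n K" and dimK: "\<And>I. I \<in> K \<Longrightarrow> card I \<le> n" and "\<sigma> \<in> K"
    and c: "c \<in> star_cycles K \<sigma> n" and e: "e \<in> star_cycles K \<sigma> n" "e \<noteq> 0"
  shows "\<exists>r. c = r *\<^sub>R e"
proof -
  let ?j = "int n - 1 - int (card \<sigma>)"
  have "int (card J) \<le> ?j + 1" if "J \<in> link K \<sigma>" for J
    using dimK[of "\<sigma> \<union> J"] that card_Un_disjoint[of \<sigma> J] by (auto simp: link_def Int_commute)
  moreover have "homology_iso_real (link K \<sigma>) ?j"
    using hs \<open>\<sigma> \<in> K\<close> by (auto simp: homology_sphere_def)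
  ultimately obtain z0 where z0: "\<forall>z\<in>cycles (link K \<sigma>) ?j. \<exists>r. z = r *\<^sub>R z0"
    using cycles_top_dim1 by blast
  have nth: "x $ I = (if \<sigma> \<subseteq> I then link_sign \<sigma> (I - \<sigma>) * to_link \<sigma> x $ (I - \<sigma>) else 0)"
    if "x \<in> star_cycles K \<sigma> n" for x I
  proof -
    have "\<sigma> \<union> I = I" if "\<sigma> \<subseteq> I" using that by auto
    then show ?thesis using that
      by (auto simp: star_cycles_def star_chains_def to_link_def simp flip: mult.assoc)
  qed
  have "\<exists>r. to_link \<sigma> c = r *\<^sub>R z0" "\<exists>s. to_link \<sigma> e = s *\<^sub>R z0"
    by (rule bspec[OF z0 to_link_cycles[OF c]], simp, rule bspec[OF z0 to_link_cycles[OF e(1)]], simp)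
  then obtain r s where r: "to_link \<sigma> c = r *\<^sub>R z0" and s: "to_link \<sigma> e = s *\<^sub>R z0"
    by (elim exE)
  have "s \<noteq> 0"
  proof
    assume "s = 0"
    then have "e $ I = 0" for I by (subst nth[OF e(1)]) (simp add: s)
    then have "e = 0" by (simp add: Finite_Cartesian_Product.vec_eq_iff)
    with e show False by simp
  qed
  then have rs: "to_link \<sigma> c = (r / s) *\<^sub>R to_link \<sigma> e" by (simp add: r s)
  have "c $ I = (r / s) * e $ I" for I by (subst nth[OF c], subst nth[OF e(1)]) (simp add: rs)
  then have "c = (r / s) *\<^sub>R e" by (simp add: Finite_Cartesian_Product.vec_eq_iff)
  then show ?thesis by blast
qed

text \<open>Euler characteristic of the link, with the signs of \<open>K\<close>: exactness makes
  the alternating sum of dimensions telescope, and only the line of top cycles is left.\<close>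

lemma star_euler:
  assumes K: "abstract_simplicial_complex K" and hs: "homology_sphere n K"
    and dimK: "\<And>I. I \<in> K \<Longrightarrow> card I \<le> n" and "\<sigma> \<in> K"
    and e: "e \<in> star_cycles K \<sigma> n" "e \<noteq> 0"
  shows "(\<Sum>I | I \<in> K \<and> \<sigma> \<subseteq> I. (-1) ^ card I) = (-1 :: int) ^ n"
proof -
  let ?T = "star_chains K \<sigma>" and ?Z = "star_cycles K \<sigma>"
  have subZ: "?Z k = {c \<in> ?T k. star_boundary \<sigma> c = 0}" for k
    by (simp add: star_cycles_def)
  have dimT: "dim (?T k) = card {I. \<sigma> \<subseteq> I \<and> I \<in> K \<and> card I = k}" for k
    using dim_coordinate_subspace[of "{I. \<sigma> \<subseteq> I \<and> I \<in> K \<and> card I = k}"]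
    by (simp add: star_chains_def)
  have T0: "dim (?T 0) = dim (?Z 0)"
  proof -
    have "?Z 0 = ?T 0" using star_boundary_star_chains_0 by (auto simp: star_cycles_def)
    then show ?thesis by simp
  qed
  have step: "dim (?T (Suc k)) = dim (?Z k) + dim (?Z (Suc k))" if "k < n" for k
  proof -
    have "star_boundary \<sigma> ` ?T (Suc k) = ?Z k"
    proof
      show "star_boundary \<sigma> ` ?T (Suc k) \<subseteq> ?Z k"
        using star_boundary_star_chains[OF K] star_boundary_star_boundary
        by (auto simp: star_cycles_def)
      show "?Z k \<subseteq> star_boundary \<sigma> ` ?T (Suc k)"
        using star_exact[OF K hs \<open>\<sigma> \<in> K\<close> that] by force
    qed
    then show ?thesis
      using dim_ker_image[OF linear_star_boundary subspace_star_chains, of \<sigma> K \<sigma> "Suc k"]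
      by (simp add: subZ)
  qed
  have Zn: "dim (?Z n) = 1"
  proof -
    have "span {e} = ?Z n"
    proof
      have "subspace (?Z n)"
        unfolding star_cycles_def using subspace_star_chains[of K \<sigma> n] linear_star_boundary[of \<sigma>]
        by (auto simp: subspace_def linear_0 linear_add linear_scale)
      then show "span {e} \<subseteq> ?Z n" using e by (simp add: span_minimal)
      show "?Z n \<subseteq> span {e}"
        using star_cycles_top[OF hs dimK \<open>\<sigma> \<in> K\<close> _ e] by (auto simp: span_singleton)
    qed
    then show ?thesis using e dim_span[of "{e}"] by simp
  qed
  \<comment> \<open>Each chain space splits into the cycles of its own index and those of the index
    below, so a partial sum leaves only the last cycle space.\<close>
  have alt: "(\<Sum>k\<le>m. (-1 :: int) ^ k * int (dim (?T k))) = (-1) ^ m * int (dim (?Z m))" if "m \<le> n" for m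
    using that
  proof (induction m)
    case 0
    then show ?case by (simp add: T0)
  next
    case (Suc m)
    then show ?case by (simp add: step algebra_simps)
  qed
  have "(\<Sum>I | I \<in> K \<and> \<sigma> \<subseteq> I. (-1) ^ card I) =
      (\<Sum>k\<le>n. \<Sum>I | I \<in> {I. I \<in> K \<and> \<sigma> \<subseteq> I} \<and> card I = k. (-1 :: int) ^ card I)"
    using dimK by (intro sum.group[symmetric]) auto
  also have "\<dots> = (\<Sum>k\<le>n. (-1 :: int) ^ k * int (dim (?T k)))"
  proof (rule sum.cong[OF refl])
    fix k
    have "{I \<in> {I. I \<in> K \<and> \<sigma> \<subseteq> I}. card I = k} = {I. \<sigma> \<subseteq> I \<and> I \<in> K \<and> card I = k}" by auto
    then show "(\<Sum>I | I \<in> {I. I \<in> K \<and> \<sigma> \<subseteq> I} \<and> card I = k. (-1 :: int) ^ card I)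
        = (-1) ^ k * int (dim (?T k))"
      by (simp add: dimT)
  qed
  also have "\<dots> = (-1) ^ n" using alt[of n] Zn by simp
  finally show ?thesis .
qed

section \<open>Regular sequences\<close>

text \<open>Phrased with commuting additive operators, regularity applies directly to families of
  polynomials indexed by faces.\<close>

locale commuting_ops =
  fixes T :: "nat \<Rightarrow> 'm::ab_group_add \<Rightarrow> 'm"
  assumes T_additive: "Modules.additive (T a)" and T_comm: "T a (T b x) = T b (T a x)"
begin

definition img :: "nat \<Rightarrow> 'm set \<Rightarrow> 'm set" where
  "img j A = {(\<Sum>a<j. T a (z a)) |z. \<forall>a. z a \<in> A}"

text \<open>Regular sequences in the weak sense: the final quotient may be zero.\<close>

definition regular :: "nat \<Rightarrow> 'm set \<Rightarrow> bool" where
  "regular k A \<longleftrightarrow> (\<forall>j<k. \<forall>z\<in>A. T j z \<in> img j A \<longrightarrow> z \<in> img j A)"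

context
  fixes M :: "'m set" and d :: "'m \<Rightarrow> 'm"
  assumes M_0: "0 \<in> M" and M_add: "x \<in> M \<Longrightarrow> y \<in> M \<Longrightarrow> x + y \<in> M"
    and M_minus: "x \<in> M \<Longrightarrow> - x \<in> M" and M_T: "x \<in> M \<Longrightarrow> T a x \<in> M"
    and d_additive: "Modules.additive d" and d_T: "d (T a x) = T a (d x)"
begin

lemma M_sum: "(\<And>x. x \<in> X \<Longrightarrow> f x \<in> M) \<Longrightarrow> sum f X \<in> M"
  by (induction X rule: infinite_finite_induct) (auto simp: M_0 M_add)

lemma img_kernel:
  assumes reg: "regular k (d ` M)" and "j \<le> k" "d x = 0" "x \<in> img j M"
  shows "x \<in> img j {m \<in> M. d m = 0}"
  using assms(2-4)
proof (induction j arbitrary: x)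
  case 0
  then show ?case using M_0 additive.zero[OF d_additive]
    by (auto simp: img_def intro!: exI[of _ "\<lambda>_. 0"])
next
  case (Suc j)
  obtain z where z: "x = (\<Sum>a<Suc j. T a (z a))" "\<And>a. z a \<in> M"
    using Suc.prems(3) unfolding img_def by auto
  have "d x = (\<Sum>a<j. T a (d (z a))) + T j (d (z j))"
    by (simp add: z(1) additive.add[OF d_additive] additive.sum[OF d_additive] d_T)
  then have "T j (d (z j)) = (\<Sum>a<j. T a (d (- z a)))"
    using Suc.prems(2)
    by (simp add: additive.minus[OF d_additive] additive.minus[OF T_additive] sum_negf
        eq_neg_iff_add_eq_0 add.commute)
  moreover have "\<forall>a. d (- z a) \<in> d ` M" using z(2) M_minus by auto
  ultimately have "T j (d (z j)) \<in> img j (d ` M)"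
    unfolding img_def by (intro CollectI exI[of _ "\<lambda>a. d (- z a)"]) auto
  then have "d (z j) \<in> img j (d ` M)"
    using reg Suc.prems(1) z(2) unfolding regular_def by auto
  then obtain c where c: "d (z j) = (\<Sum>a<j. T a (c a))" "\<forall>a. c a \<in> d ` M"
    unfolding img_def by auto
  then have "\<forall>a. \<exists>m. m \<in> M \<and> d m = c a" by (metis imageE)
  then obtain m where m: "\<And>a. m a \<in> M" "\<And>a. d (m a) = c a" by metis
  \<comment> \<open>Correcting \<open>z j\<close> by the lifted coefficients lands in the kernel;
    since the operators commute, the correction can be absorbed into the earlier
    coefficients.\<close>
  define y where "y = z j - (\<Sum>a<j. T a (m a))"
  have yM: "y \<in> M"
    using M_add[OF z(2)[of j] M_minus[OF M_sum[of "{..<j}" "\<lambda>a. T a (m a)", OF M_T[OF m(1)]]]]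
    by (simp add: y_def)
  have dy: "d y = 0"
    by (simp add: y_def additive.diff[OF d_additive] additive.sum[OF d_additive] d_T m(2) c(1))
  have x: "x = (\<Sum>a<j. T a (z a + T j (m a))) + T j y"
    by (simp add: z(1) y_def additive.add[OF T_additive] additive.diff[OF T_additive]
        additive.sum[OF T_additive] sum.distrib T_comm[of j])
  have "x - T j y \<in> img j M"
    unfolding img_def using x z(2) m(1) M_add M_T
    by (intro CollectI exI[of _ "\<lambda>a. z a + T j (m a)"]) auto
  moreover have "d (x - T j y) = 0"
    using Suc.prems(2) dy by (simp add: additive.diff[OF d_additive] d_T additive.zero[OF T_additive])
  ultimately have "x - T j y \<in> img j {m \<in> M. d m = 0}"
    using Suc by simp
  then obtain w where w: "x - T j y = (\<Sum>a<j. T a (w a))" "\<And>a. w a \<in> {m \<in> M. d m = 0}"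
    unfolding img_def by auto
  have "x = (\<Sum>a<Suc j. T a ((w(j := y)) a))"
    using w(1) by (simp add: algebra_simps)
  moreover have "\<forall>a. (w(j := y)) a \<in> {m \<in> M. d m = 0}" using w(2) yM dy by auto
  ultimately show ?case unfolding img_def by blast
qed

text \<open>The depth lemma for \<open>0 \<rightarrow> ker d \<rightarrow> M \<rightarrow> d M \<rightarrow> 0\<close>.\<close>

lemma regular_kernel:
  assumes "regular k (d ` M)" "regular (Suc k) M"
  shows "regular (Suc k) {m \<in> M. d m = 0}"
  unfolding regular_def
proof (intro allI impI ballI)
  fix j z
  assume j: "j < Suc k" and z: "z \<in> {m \<in> M. d m = 0}" and "T j z \<in> img j {m \<in> M. d m = 0}"
  then have "T j z \<in> img j M" unfolding img_def by blast
  then have "z \<in> img j M" using assms(2) j z unfolding regular_def by auto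
  then show "z \<in> img j {m \<in> M. d m = 0}"
    using img_kernel[OF assms(1), of j z] j z by auto
qed

end

end

section \<open>The face complex\<close>

definition theta :: "('v::finite \<Rightarrow> 'a::euclidean_space) \<Rightarrow> 'a \<Rightarrow> 'v mpoly" where
  "theta lam u = (\<Sum>i\<in>UNIV. const (inner u (lam i)) * var i)"

lemma theta_hdeg: "theta lam u \<in> hdeg 1"
  unfolding theta_def by (intro hdeg_sum hdeg_const_mult var_hdeg)

definition act :: "'v mpoly \<Rightarrow> ('v::finite set \<Rightarrow> 'v mpoly) \<Rightarrow> ('v set \<Rightarrow> 'v mpoly)" where
  "act p g = (\<lambda>I. trunc I (p * g I))"

definition dif :: "('v::{finite,linorder} set \<Rightarrow> 'v mpoly) \<Rightarrow> ('v set \<Rightarrow> 'v mpoly)" where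
  "dif g = (\<lambda>J. \<Sum>i\<in>-J. const (sg i J) * trunc J (g (insert i J)))"

text \<open>Term k of the complex: the direct sum, over the faces with k vertices, of the polynomial
  rings in their variables; \<open>dif\<close> restricts to faces with one vertex less.\<close>

definition face_module :: "'v::finite set set \<Rightarrow> nat \<Rightarrow> ('v set \<Rightarrow> 'v mpoly) set" where
  "face_module K k = {g. \<forall>I. trunc I (g I) = g I \<and> (g I \<noteq> 0 \<longrightarrow> I \<in> K \<and> card I = k)}"

definition coeff_chain :: "('v \<Rightarrow>\<^sub>0 nat) \<Rightarrow> ('v::{finite,linorder} set \<Rightarrow> 'v mpoly) \<Rightarrow> 'v chain" where
  "coeff_chain \<alpha> g = (\<chi> I. lkp (g I) \<alpha>)"

lemma trunc_trunc: "J \<subseteq> I \<Longrightarrow> trunc J (trunc I p) = trunc J p"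
  by (rule poly_mapping_eqI) auto

lemma additive_act: "Modules.additive (act p)"
  by unfold_locales (auto simp: act_def distrib_left restr_add plus_fun_def)

lemma act_act: "act p (act q g) = act (p * q) g"
  by (simp add: act_def trunc_mult restr_restr mult.assoc)

lemma act_comm: "act p (act q g) = act q (act p g)"
  by (simp add: act_act mult.commute)

lemma additive_dif: "Modules.additive dif"
  by unfold_locales (auto simp: dif_def restr_add distrib_left sum.distrib plus_fun_def)

lemma dif_act: "dif (act p g) = act p (dif g)"
proof
  fix J
  have "dif (act p g) J = (\<Sum>i\<in>-J. const (sg i J) * trunc J (p * g (insert i J)))"
    by (simp add: dif_def act_def trunc_trunc subset_insertI)
  also have "\<dots> = act p (dif g) J"
    by (simp add: act_def dif_def sum_distrib_left restr_sum restr_restr trunc_mult[of J "_ * _"]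
        restr_const_mult mult.left_commute[of p] trunc_mult[of J p])
  finally show "dif (act p g) J = act p (dif g) J" .
qed

text \<open>The complex splits over exponent vectors: \<open>\<alpha>\<close> occurs only on faces
  containing its support, and there \<open>dif\<close> is the boundary of the star. Exactness is
  thereby a question about links.\<close>

lemma lkp_dif: "lkp (dif g J) \<alpha> = star_boundary (supp \<alpha>) (coeff_chain \<alpha> g) $ J"
  by (simp add: dif_def lookup_sum star_boundary_nth boundary_nth coeff_chain_def)

lemma dif_eq_0_iff: "dif g = 0 \<longleftrightarrow> (\<forall>\<alpha>. star_boundary (supp \<alpha>) (coeff_chain \<alpha> g) = 0)"
proof -
  have "dif g = 0 \<longleftrightarrow> (\<forall>J \<alpha>. lkp (dif g J) \<alpha> = 0)"
    by (auto simp: fun_eq_iff intro: poly_mapping_eqI)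
  then show ?thesis by (auto simp: lkp_dif Finite_Cartesian_Product.vec_eq_iff)
qed

lemma coeff_chain_face_module:
  assumes "g \<in> face_module K k"
  shows "coeff_chain \<alpha> g \<in> star_chains K (supp \<alpha>) k"
proof -
  have "lkp (g I) \<alpha> = 0" if "\<not> (supp \<alpha> \<subseteq> I \<and> I \<in> K \<and> card I = k)" for I
  proof -
    have "trunc I (g I) = g I" "g I \<noteq> 0 \<longrightarrow> I \<in> K \<and> card I = k"
      using assms by (auto simp: face_module_def)
    then show ?thesis using that by (metis lkp_restr lookup_zero)
  qed
  then show ?thesis by (auto simp: star_chains_def coeff_chain_def)
qed

lemma face_moduleI:
  assumes "\<And>\<alpha>. coeff_chain \<alpha> g \<in> star_chains K (supp \<alpha>) k"
  shows "g \<in> face_module K k"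
proof -
  have 0: "lkp (g I) \<alpha> = 0" if "\<not> (supp \<alpha> \<subseteq> I \<and> I \<in> K \<and> card I = k)" for I \<alpha>
    using assms[of \<alpha>] that by (auto simp: star_chains_def coeff_chain_def)
  have "trunc I (g I) = g I" for I
    by (rule restr_eq_self) (use 0 in \<open>auto simp: in_keys_iff\<close>)
  moreover have "I \<in> K \<and> card I = k" if "g I \<noteq> 0" for I
    using that 0 by (metis lookup_zero poly_mapping_eqI)
  ultimately show ?thesis by (auto simp: face_module_def)
qed

lemma face_module_0: "0 \<in> face_module K k"
  by (simp add: face_module_def)

lemma face_module_add: "g \<in> face_module K k \<Longrightarrow> h \<in> face_module K k \<Longrightarrow> g + h \<in> face_module K k"
  by (auto simp: face_module_def restr_add plus_fun_def) (metis add_0)+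

lemma restr_minus: "restr P (- p) = - restr P p"
  by (rule poly_mapping_eqI) simp

lemma face_module_minus: "g \<in> face_module K k \<Longrightarrow> - g \<in> face_module K k"
  by (auto simp: face_module_def fun_Compl_def restr_minus)

lemma face_module_act: "g \<in> face_module K k \<Longrightarrow> act p g \<in> face_module K k"
  by (auto simp: face_module_def act_def restr_restr) (metis mult_zero_right restr_0)+

text \<open>Inverse of \<open>coeff_chain\<close>; the finiteness assumption is what makes the
  entries polynomials.\<close>

lemma assemble_chains:
  assumes "finite A" "\<And>\<alpha>. \<alpha> \<notin> A \<Longrightarrow> b \<alpha> = 0"
  obtains h where "\<And>\<alpha>. coeff_chain \<alpha> h = b \<alpha>"
proof
  define h where "h = (\<lambda>I. \<Sum>\<alpha>\<in>A. Poly_Mapping.single \<alpha> (b \<alpha> $ I))"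
  show "coeff_chain \<alpha> h = b \<alpha>" for \<alpha>
    using assms
    by (auto simp: Finite_Cartesian_Product.vec_eq_iff coeff_chain_def h_def lookup_sum lookup_single
        when_def)
qed

lemma finite_coeff_chain: "finite {\<alpha>. coeff_chain \<alpha> g \<noteq> 0}"
proof (rule finite_subset)
  show "{\<alpha>. coeff_chain \<alpha> g \<noteq> 0} \<subseteq> (\<Union>I. Poly_Mapping.keys (g I))"
    by (auto simp: Finite_Cartesian_Product.vec_eq_iff coeff_chain_def in_keys_iff)
qed auto

lemma coeff_chain_eqI: "(\<And>\<alpha>. coeff_chain \<alpha> g = coeff_chain \<alpha> h) \<Longrightarrow> g = h"
  by (auto simp: fun_eq_iff Finite_Cartesian_Product.vec_eq_iff coeff_chain_def intro!: poly_mapping_eqI)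

lemma coeff_chain_dif: "coeff_chain \<alpha> (dif g) = star_boundary (supp \<alpha>) (coeff_chain \<alpha> g)"
  by (simp add: Finite_Cartesian_Product.vec_eq_iff coeff_chain_def[of \<alpha> "dif g"] lkp_dif)

lemma star_chains_nonface:
  assumes "abstract_simplicial_complex K" "c \<in> star_chains K \<sigma> k" "c \<noteq> 0"
  shows "\<sigma> \<in> K"
proof -
  obtain I where "c $ I \<noteq> 0" using assms(3) by (auto simp: Finite_Cartesian_Product.vec_eq_iff)
  then have "\<sigma> \<subseteq> I" "I \<in> K" using assms(2) by (auto simp: star_chains_def)
  then show ?thesis using assms(1) unfolding abstract_simplicial_complex_def by blast
qed

text \<open>Checked one exponent at a time, where it is \<open>star_exact\<close> for the support of
  that exponent.\<close>

lemma face_module_exact: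
  assumes K: "abstract_simplicial_complex K" and hs: "homology_sphere n K" and "k < n"
  shows "dif ` face_module K (Suc k) = {g \<in> face_module K k. dif g = 0}"
proof (intro equalityI subsetI)
  fix g assume "g \<in> dif ` face_module K (Suc k)"
  then obtain h where h: "h \<in> face_module K (Suc k)" "g = dif h" by auto
  have "g \<in> face_module K k"
    by (rule face_moduleI)
      (simp add: h(2) coeff_chain_dif star_boundary_star_chains[OF K coeff_chain_face_module[OF h(1)]])
  moreover have "dif g = 0"
    by (simp add: dif_eq_0_iff h(2) coeff_chain_dif star_boundary_star_boundary)
  ultimately show "g \<in> {g \<in> face_module K k. dif g = 0}" by simp
next
  fix g assume "g \<in> {g \<in> face_module K k. dif g = 0}"
  then have g: "g \<in> face_module K k" "dif g = 0" by auto
  \<comment> \<open>A zero chain gets the preimage zero, so that only finitely many exponents occur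
    and the choices assemble to polynomials.\<close>
  have "\<exists>b. b \<in> star_chains K (supp \<alpha>) (Suc k) \<and> star_boundary (supp \<alpha>) b = coeff_chain \<alpha> g
      \<and> (coeff_chain \<alpha> g = 0 \<longrightarrow> b = 0)" for \<alpha>
  proof (cases "coeff_chain \<alpha> g = 0")
    case True
    then show ?thesis
      using subspace_0[OF subspace_star_chains] linear_0[OF linear_star_boundary] by auto
  next
    case False
    have c: "coeff_chain \<alpha> g \<in> star_chains K (supp \<alpha>) k" by (rule coeff_chain_face_module[OF g(1)])
    then have "coeff_chain \<alpha> g \<in> star_cycles K (supp \<alpha>) k"
      using g(2) by (simp add: star_cycles_def dif_eq_0_iff)
    then show ?thesis
      using star_exact[OF K hs star_chains_nonface[OF K c False] \<open>k < n\<close>] False by blast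
  qed
  then obtain b where b: "\<And>\<alpha>. b \<alpha> \<in> star_chains K (supp \<alpha>) (Suc k)"
    "\<And>\<alpha>. star_boundary (supp \<alpha>) (b \<alpha>) = coeff_chain \<alpha> g" "\<And>\<alpha>. coeff_chain \<alpha> g = 0 \<Longrightarrow> b \<alpha> = 0"
    by metis
  obtain h where h: "\<And>\<alpha>. coeff_chain \<alpha> h = b \<alpha>"
    by (rule assemble_chains[OF finite_coeff_chain[of g], of b]) (use b(3) in auto)
  have "h \<in> face_module K (Suc k)" by (rule face_moduleI) (simp add: h b(1))
  moreover have "dif h = g" by (rule coeff_chain_eqI) (simp add: coeff_chain_dif h b(2))
  ultimately show "g \<in> dif ` face_module K (Suc k)" by blast
qed

section \<open>Linear forms restricted to a face\<close>

lemma lin_comb_ideal_closed: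
  fixes l :: "nat \<Rightarrow> 'r::comm_ring_1" and j :: nat
  defines "L \<equiv> {(\<Sum>a<j. l a * z a) |z. True}"
  shows "0 \<in> L" "x \<in> L \<Longrightarrow> y \<in> L \<Longrightarrow> x + y \<in> L" "x \<in> L \<Longrightarrow> r * x \<in> L"
proof -
  show "0 \<in> L" unfolding L_def by (intro CollectI exI[of _ "\<lambda>_. 0"]) simp
  show "x + y \<in> L" if xy: "x \<in> L" "y \<in> L"
  proof -
    obtain z w where "x = (\<Sum>a<j. l a * z a)" "y = (\<Sum>a<j. l a * w a)" using xy unfolding L_def by auto
    then show ?thesis unfolding L_def
      by (intro CollectI exI[of _ "\<lambda>a. z a + w a"]) (simp add: distrib_left sum.distrib)
  qed
  show "r * x \<in> L" if x: "x \<in> L"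
  proof -
    obtain z where "x = (\<Sum>a<j. l a * z a)" using x unfolding L_def by auto
    then show ?thesis unfolding L_def
      by (intro CollectI exI[of _ "\<lambda>a. r * z a"]) (simp add: sum_distrib_left mult.left_commute)
  qed
qed

text \<open>The polynomials congruent to their own substitution modulo the ideal of \<open>l\<close>
  are closed under sums and products and contain constants and variables.\<close>

lemma subst_congruent:
  fixes p :: "'v::finite mpoly" and l :: "nat \<Rightarrow> 'v mpoly"
  assumes f: "\<And>i. \<exists>z. var i - f i = (\<Sum>a<j. l a * z a)"
  shows "\<exists>z. p - subst const f p = (\<Sum>a<j. l a * z a)"
proof -
  define L where "L = {(\<Sum>a<j. l a * z a) |z. True}"
  note L = lin_comb_ideal_closed[where l = l and j = j, folded L_def]
  define G where "G = {p. p - subst const f p \<in> L}"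
  have mult: "p * q \<in> G" if "p \<in> G" "q \<in> G" for p q
  proof -
    have "p * q - subst const f (p * q)
        = q * (p - subst const f p) + subst const f p * (q - subst const f q)"
      by (simp add: csubst.subst_mult algebra_simps)
    then show ?thesis using that L(2,3) by (simp add: G_def)
  qed
  have const: "const r \<in> G" for r using L(1) by (simp add: G_def csubst.subst_const)
  have var: "var i \<in> G" for i using f[of i] by (auto simp: G_def csubst.subst_var L_def)
  have add: "p + q \<in> G" if "p \<in> G" "q \<in> G" for p q
  proof -
    have "p + q - subst const f (p + q) = (p - subst const f p) + (q - subst const f q)"
      by (simp add: csubst.subst_add)
    then show ?thesis using that L(2) by (simp only: G_def mem_Collect_eq)
  qed
  have power: "p ^ k \<in> G" if "p \<in> G" for p k
    using that by (induction k) (use const[of 1] mult in auto)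
  have prod: "(\<Prod>i\<in>X. g i) \<in> G" if "\<And>i. i \<in> X \<Longrightarrow> g i \<in> G" for g and X :: "'v set"
    using that by (induction X rule: infinite_finite_induct) (use const[of 1] mult in auto)
  have "p \<in> G"
  proof (induction p rule: mpoly_induct)
    case (single \<alpha> c)
    have "Poly_Mapping.single \<alpha> c = const c * mono \<alpha>" by (simp add: const_mult_single)
    also have "\<dots> \<in> G" unfolding mono_eq_prod_var by (intro mult const prod power var)
    finally show ?case .
  qed (rule add)
  then show ?thesis by (auto simp: G_def L_def)
qed

lemma trunc_theta: "trunc I (theta lam u) = (\<Sum>i\<in>I. const (inner u (lam i)) * var i)"
proof -
  have "trunc I (var i) = (if i \<in> I then var i else 0)" for i :: 'a
    by (auto simp: var_def restr_single)
  then have "trunc I (theta lam u) = (\<Sum>i\<in>UNIV. if i \<in> I then const (inner u (lam i)) * var i else 0)"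
    unfolding theta_def restr_sum by (intro sum.cong) (auto simp: restr_const_mult)
  then show ?thesis by (simp add: sum.If_cases)
qed

text \<open>The substitution \<open>x\<^sub>i \<mapsto> x\<^sub>i - \<Sum>\<^sub>b y\<^sub>b(i) l\<^sub>b\<close>, where \<open>y\<close> is dual to the linear forms \<open>l\<close>, kills
  \<open>l\<^sub>a\<close> for \<open>a < j\<close> and fixes \<open>l\<^sub>j\<close>.\<close>

lemma regular_on_face:
  fixes lam :: "'v::{finite,linorder} \<Rightarrow> 'a::euclidean_space" and u y :: "nat \<Rightarrow> 'a"
  assumes "j < k" and y: "\<And>b. b < k \<Longrightarrow> y b \<in> span (lam ` I)"
    and dual: "\<And>a b. a < k \<Longrightarrow> b < k \<Longrightarrow> inner (u a) (y b) = (if a = b then 1 else 0)"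
    and p: "trunc I p = p"
    and eq: "trunc I (theta lam (u j) * p) = (\<Sum>a<j. trunc I (theta lam (u a) * z a))"
  shows "\<exists>w. (\<forall>a. trunc I (w a) = w a) \<and> p = (\<Sum>a<j. trunc I (theta lam (u a) * w a))"
proof -
  define l where "l a = trunc I (theta lam (u a))" for a
  have "\<exists>\<eta>. y b = (\<Sum>i\<in>I. \<eta> i *\<^sub>R lam i)" if "b < k" for b
  proof -
    have "y b \<in> span (lam ` I)" by (rule y[OF that])
    then show ?thesis
    proof (induction rule: span_induct_alt)
      case base
      show ?case by (rule exI[of _ "\<lambda>_. 0"]) simp
    next
      case (step c x w)
      then obtain i \<eta> where i: "i \<in> I" "x = lam i" "w = (\<Sum>i\<in>I. \<eta> i *\<^sub>R lam i)" by auto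
      have "(\<Sum>i'\<in>I. (\<eta>(i := \<eta> i + c)) i' *\<^sub>R lam i')
          = (\<Sum>i'\<in>I. \<eta> i' *\<^sub>R lam i' + (if i' = i then c *\<^sub>R lam i else 0))"
        by (rule sum.cong) (auto simp: scaleR_add_left)
      also have "\<dots> = c *\<^sub>R x + w" using i by (simp add: sum.distrib add.commute)
      finally show ?case by metis
    qed
  qed
  then obtain \<eta> where \<eta>: "\<And>b. b < k \<Longrightarrow> y b = (\<Sum>i\<in>I. \<eta> b i *\<^sub>R lam i)" by metis
  have dual': "(\<Sum>i\<in>I. inner (u a) (lam i) * \<eta> b i) = (if a = b then 1 else 0)" if "a < k" "b < k" for a b
    using dual[OF that] by (simp add: \<eta>[OF that(2)] inner_sum_right mult.commute)
  define f where "f i = var i - (\<Sum>b<j. const (\<eta> b i) * l b)" for i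
  have l: "l a = (\<Sum>i\<in>I. const (inner (u a) (lam i)) * var i)" for a
    unfolding l_def by (rule trunc_theta)
  have sl: "subst const f (l a) = l a - (\<Sum>b<j. (if a = b then l b else 0))" if "a < k" for a
  proof -
    have "subst const f (l a) = (\<Sum>i\<in>I. const (inner (u a) (lam i)) * f i)"
      by (simp add: l csubst.subst_sum csubst.subst_mult csubst.subst_const csubst.subst_var)
    also have "\<dots> = l a - (\<Sum>i\<in>I. \<Sum>b<j. const (inner (u a) (lam i) * \<eta> b i) * l b)"
      by (simp add: f_def right_diff_distrib sum_subtractf l[of a] sum_distrib_left const_mult mult.assoc)
    also have "(\<Sum>i\<in>I. \<Sum>b<j. const (inner (u a) (lam i) * \<eta> b i) * l b)
        = (\<Sum>b<j. const (\<Sum>i\<in>I. inner (u a) (lam i) * \<eta> b i) * l b)"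
      by (subst sum.swap) (simp add: const_sum sum_distrib_right)
    also have "\<dots> = (\<Sum>b<j. (if a = b then l b else 0))"
    proof (rule sum.cong[OF refl])
      fix b assume "b \<in> {..<j}"
      then have "b < k" using \<open>j < k\<close> by simp
      then show "const (\<Sum>i\<in>I. inner (u a) (lam i) * \<eta> b i) * l b = (if a = b then l b else 0)"
        by (simp add: dual'[OF \<open>a < k\<close>])
    qed
    finally show ?thesis .
  qed
  have s0: "subst const f (l a) = 0" if "a < j" for a
    using sl[of a] that \<open>j < k\<close> by (simp add: sum.delta)
  have sj: "subst const f (l j) = l j"
    using sl[of j] \<open>j < k\<close> by simp
  \<comment> \<open>\<open>\<eta> j\<close> holds coordinates of \<open>y j\<close>, so
    \<open>l j\<close> takes there the value of the pairing of \<open>u j\<close> with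
    \<open>y j\<close>, which is 1.\<close>
  have lj: "l j \<noteq> 0"
  proof
    assume "l j = 0"
    then have "poly_eval (\<eta> j) (l j) = 0" by (simp add: eval.subst_0)
    then show False
      using dual'[OF \<open>j < k\<close> \<open>j < k\<close>]
      by (simp add: l eval.subst_sum poly_eval_const_mult eval.subst_var)
  qed
  have "l j * p = (\<Sum>a<j. l a * trunc I (z a))"
    using eq p by (simp add: trunc_mult l_def)
  \<comment> \<open>The right side dies and \<open>l j\<close> is fixed. Polynomials form a domain,
    so the image of p is zero and p is congruent to 0 modulo the earlier forms.\<close>
  then have "subst const f (l j * p) = subst const f (\<Sum>a<j. l a * trunc I (z a))" by simp
  then have "l j * subst const f p = 0"
    by (simp add: csubst.subst_mult csubst.subst_sum sj s0)
  then have sp: "subst const f p = 0" using lj by simp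
  have "\<exists>w. p - subst const f p = (\<Sum>a<j. l a * w a)"
  proof (rule subst_congruent)
    show "\<exists>z. var i - f i = (\<Sum>a<j. l a * z a)" for i
      by (intro exI[of _ "\<lambda>b. const (\<eta> b i)"]) (simp add: f_def mult.commute)
  qed
  then obtain w where w: "p = (\<Sum>a<j. l a * w a)" using sp by auto
  have "p = trunc I (\<Sum>a<j. l a * w a)" using p w by simp
  also have "\<dots> = (\<Sum>a<j. trunc I (theta lam (u a) * trunc I (w a)))"
    by (simp add: restr_sum trunc_mult l_def restr_restr)
  finally show ?thesis
    by (intro exI[of _ "\<lambda>a. trunc I (w a)"]) (simp add: restr_restr)
qed

section \<open>Homology spheres with a characteristic function\<close>

locale sphere_char =
  fixes n :: nat and K :: "'v::{finite,linorder} set set" and \<epsilon> :: "'v chain"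
    and lam :: "'v \<Rightarrow> 'a::euclidean_space"
  assumes DIM: "DIM('a) = n"
    and complex: "abstract_simplicial_complex K"
    and dimension: "has_dimension K (int n - 1)"
    and sphere: "homology_sphere n K"
    and orient: "orientation n K \<epsilon>"
    and char: "characteristic_function K lam"
begin

definition facets :: "'v set set" where
  "facets = {I \<in> K. card I = n}"

lemma simplices_facets: "simplices K (int n - 1) = facets"
  by (auto simp: simplices_def facets_def)

lemma face_subset: "I \<in> K \<Longrightarrow> J \<subseteq> I \<Longrightarrow> J \<in> K"
  using complex by (auto simp: abstract_simplicial_complex_def)

lemma empty_face: "{} \<in> K"
  using complex by (auto simp: abstract_simplicial_complex_def)

lemma card_face_le: "I \<in> K \<Longrightarrow> card I \<le> n"
  using dimension by (auto simp: has_dimension_def)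

lemma facetD: "I \<in> facets \<Longrightarrow> I \<in> K" "I \<in> facets \<Longrightarrow> card I = n"
  by (auto simp: facets_def)

lemma facet_eq: "I \<in> facets \<Longrightarrow> J \<in> facets \<Longrightarrow> I \<subseteq> J \<Longrightarrow> I = J"
  by (rule card_subset_eq) (auto simp: facets_def)

text \<open>Purity of \<open>K\<close> comes from \<open>lam\<close>: each maximal simplex is mapped
  to a basis of an n-dimensional space.\<close>

lemma maximal_card:
  assumes "I \<in> maximal_simplices K"
  shows "card I = n"
proof -
  have "inj_on lam I" "independent (lam ` I)" "span (lam ` I) = UNIV"
    using char assms by (auto simp: characteristic_function_def)
  then have "card (lam ` I) = dim (UNIV :: 'a set)"
    by (intro basis_card_eq_dim) auto
  then show ?thesis using \<open>inj_on lam I\<close> by (simp add: card_image DIM)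
qed

lemma facet_maximal:
  assumes "I \<in> facets"
  shows "I \<in> maximal_simplices K"
proof -
  have "J = I" if "J \<in> K" "I \<subseteq> J" for J
    using card_seteq[of J I] card_face_le[OF that(1)] that(2) facetD(2)[OF assms] by simp
  then show ?thesis using facetD(1)[OF assms] by (simp add: maximal_simplices_def)
qed

lemma facet_basis:
  assumes "I \<in> facets"
  shows "inj_on lam I" "independent (lam ` I)" "span (lam ` I) = UNIV"
  using char facet_maximal[OF assms] by (auto simp: characteristic_function_def)

lemma ex_facet:
  assumes "\<sigma> \<in> K"
  obtains I where "I \<in> facets" "\<sigma> \<subseteq> I"
proof -
  obtain I where I: "\<sigma> \<subseteq> I" "I \<in> K" "\<And>J. J \<in> K \<Longrightarrow> I \<subseteq> J \<Longrightarrow> I = J"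
    using finite_has_maximal2[of K \<sigma>] assms by auto
  then have "I \<in> maximal_simplices K" by (auto simp: maximal_simplices_def)
  then have "I \<in> facets" using maximal_card I by (auto simp: facets_def)
  then show ?thesis using that I(1) by auto
qed

lemma face_independent:
  assumes "I \<in> K"
  shows "inj_on lam I" "independent (lam ` I)"
proof -
  obtain F where "F \<in> facets" "I \<subseteq> F" by (rule ex_facet[OF assms])
  then show "inj_on lam I" "independent (lam ` I)"
    using inj_on_subset[OF facet_basis(1)] independent_mono[OF facet_basis(2) image_mono] by auto
qed

lemma eps_sq: "I \<in> facets \<Longrightarrow> \<epsilon> $ I = 1 \<or> \<epsilon> $ I = -1"
  using orient by (auto simp: orientation_def simplices_facets)

lemma eps_nonfacet: "I \<notin> facets \<Longrightarrow> \<epsilon> $ I = 0"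
  using orient by (auto simp: orientation_def cycles_def chains_def simplices_facets)

lemma boundary_eps: "boundary \<epsilon> = 0"
  using orient by (auto simp: orientation_def cycles_def)

text \<open>The orientation cut down to the facets above \<open>\<sigma>\<close>; it will generate
  the top cycles of the star.\<close>

definition star_eps :: "'v set \<Rightarrow> 'v chain" where
  "star_eps \<sigma> = (\<chi> I. if \<sigma> \<subseteq> I then \<epsilon> $ I else 0)"

lemma star_eps_cycle: "star_eps \<sigma> \<in> star_cycles K \<sigma> n"
proof -
  have "boundary (star_eps \<sigma>) $ I = boundary \<epsilon> $ I" if "\<sigma> \<subseteq> I" for I
    unfolding boundary_nth using that by (intro sum.cong) (auto simp: star_eps_def)
  then show ?thesis
    using eps_nonfacet
    by (auto simp: star_cycles_def star_chains_def star_eps_def facets_def star_boundary_nth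
        boundary_eps Finite_Cartesian_Product.vec_eq_iff)
qed

lemma star_eps_nonzero:
  assumes "\<sigma> \<in> K"
  shows "star_eps \<sigma> \<noteq> 0"
proof -
  obtain I where I: "I \<in> facets" "\<sigma> \<subseteq> I" by (rule ex_facet[OF assms])
  then have "star_eps \<sigma> $ I \<noteq> 0" using eps_sq[OF I(1)] by (auto simp: star_eps_def)
  then show ?thesis by auto
qed

section \<open>Generic flags of linear forms\<close>

lemma ex_generic:
  assumes "finite Y" "0 \<notin> Y"
  shows "\<exists>u::'b::euclidean_space. \<forall>y\<in>Y. inner u y \<noteq> 0"
proof -
  have "negligible (\<Union>y\<in>Y. {u. inner y u = 0})"
    using assms by (intro negligible_Union) (auto intro!: negligible_hyperplane)
  then have "(\<Union>y\<in>Y. {u. inner y u = 0}) \<noteq> UNIV" using non_negligible_UNIV by metis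
  then show ?thesis by (auto simp: inner_commute)
qed

text \<open>Independence of the first min(k, |I|) functionals on the span of each face, certified by
  dual vectors because \<open>regular_on_face\<close> builds its substitution from them.\<close>

definition flag :: "nat \<Rightarrow> (nat \<Rightarrow> 'a) \<Rightarrow> bool" where
  "flag k u \<longleftrightarrow> (\<forall>I\<in>K. \<exists>y. \<forall>b<min k (card I). y b \<in> span (lam ` I) \<and>
      (\<forall>a<min k (card I). inner (u a) (y b) = (if a = b then 1 else 0)))"

text \<open>On the span of a face with more than k vertices, k functionals have a nonzero common
  zero Y. The next functional only has to be nonzero at finitely many such Y, one for each
  face.\<close>

lemma flag_step_vector:
  assumes u: "flag k u" and I: "I \<in> K" "k < card I"
  shows "\<exists>y Y. (\<forall>b<k. y b \<in> span (lam ` I) \<and> (\<forall>a<k. inner (u a) (y b) = (if a = b then 1 else 0)))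
    \<and> Y \<in> span (lam ` I) \<and> Y \<noteq> 0 \<and> (\<forall>a<k. inner (u a) Y = 0)"
proof -
  have m: "min k (card I) = k" using I(2) by simp
  obtain y where "\<forall>b<k. y b \<in> span (lam ` I) \<and>
      (\<forall>a<k. inner (u a) (y b) = (if a = b then 1 else 0))"
    using bspec[OF u[unfolded flag_def] I(1)] unfolding m by (elim exE)
  then have y: "\<And>b. b < k \<Longrightarrow> y b \<in> span (lam ` I)"
    "\<And>a b. a < k \<Longrightarrow> b < k \<Longrightarrow> inner (u a) (y b) = (if a = b then 1 else 0)"
    by auto
  have "\<not> span (lam ` I) \<subseteq> span (y ` {..<k})"
  proof
    assume "span (lam ` I) \<subseteq> span (y ` {..<k})"
    then have "dim (span (lam ` I)) \<le> card (y ` {..<k})" by (intro dim_le_card) auto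
    also have "\<dots> \<le> k" using card_image_le[of "{..<k}" y] by simp
    also have "dim (span (lam ` I)) = card I"
      using face_independent[OF I(1)] by (simp add: dim_eq_card_independent card_image)
    finally show False using I(2) by simp
  qed
  then obtain z where z: "z \<in> span (lam ` I)" "z \<notin> span (y ` {..<k})" by auto
  define Y where "Y = z - (\<Sum>b<k. inner (u b) z *\<^sub>R y b)"
  have "Y \<in> span (lam ` I)"
    unfolding Y_def using z y(1) by (intro span_diff span_sum span_scale) auto
  moreover have "Y \<noteq> 0"
  proof
    assume "Y = 0"
    then have "z = (\<Sum>b<k. inner (u b) z *\<^sub>R y b)" by (simp add: Y_def)
    also have "\<dots> \<in> span (y ` {..<k})" by (intro span_sum span_scale span_base) auto
    finally show False using z by simp
  qed
  moreover have "inner (u a) Y = 0" if "a < k" for a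
  proof -
    have "(\<Sum>b<k. inner (u b) z * inner (u a) (y b)) = (\<Sum>b<k. if a = b then inner (u a) z else 0)"
      using y(2)[OF that] by (intro sum.cong) auto
    then show ?thesis using that by (simp add: Y_def inner_diff_right inner_sum_right)
  qed
  ultimately show ?thesis using y by (intro exI[of _ y] exI[of _ Y]) auto
qed

lemma ex_flag: "\<exists>u. flag k u"
proof (induction k)
  case 0
  then show ?case by (simp add: flag_def)
next
  case (Suc k)
  then obtain u where u: "flag k u" by auto
  let ?P = "\<lambda>I y Y. (\<forall>b<k. y b \<in> span (lam ` I) \<and>
      (\<forall>a<k. inner (u a) (y b) = (if a = b then 1 else 0)))
      \<and> Y \<in> span (lam ` I) \<and> Y \<noteq> 0 \<and> (\<forall>a<k. inner (u a) Y = 0)"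
  have "\<forall>I\<in>{I \<in> K. k < card I}. \<exists>y Y. ?P I y Y"
    using flag_step_vector[OF u] by simp
  from bchoice[OF this] obtain y where "\<forall>I\<in>{I \<in> K. k < card I}. \<exists>Y. ?P I (y I) Y" by (elim exE)
  from bchoice[OF this] obtain Y where yY: "\<forall>I\<in>{I \<in> K. k < card I}. ?P I (y I) (Y I)" by (elim exE)
  have y: "\<And>I b. I \<in> K \<Longrightarrow> k < card I \<Longrightarrow> b < k \<Longrightarrow> y I b \<in> span (lam ` I)"
    "\<And>I a b. I \<in> K \<Longrightarrow> k < card I \<Longrightarrow> b < k \<Longrightarrow> a < k \<Longrightarrow> inner (u a) (y I b) = (if a = b then 1 else 0)"
    and Y: "\<And>I. I \<in> K \<Longrightarrow> k < card I \<Longrightarrow> Y I \<in> span (lam ` I)"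
    "\<And>I. I \<in> K \<Longrightarrow> k < card I \<Longrightarrow> Y I \<noteq> 0"
    "\<And>I a. I \<in> K \<Longrightarrow> k < card I \<Longrightarrow> a < k \<Longrightarrow> inner (u a) (Y I) = 0"
    using yY by simp_all
  have "0 \<notin> Y ` {I \<in> K. k < card I}" using Y(2) by force
  then obtain w where w: "\<forall>y\<in>Y ` {I \<in> K. k < card I}. inner w y \<noteq> 0"
    using ex_generic[of "Y ` {I \<in> K. k < card I}"] by auto
  have "flag (Suc k) (u(k := w))"
    unfolding flag_def
  proof
    fix I assume I: "I \<in> K"
    show "\<exists>y. \<forall>b<min (Suc k) (card I). y b \<in> span (lam ` I) \<and>
      (\<forall>a<min (Suc k) (card I). inner ((u(k := w)) a) (y b) = (if a = b then 1 else 0))"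
    proof (cases "k < card I")
      case True
      define c where "c = inner w (Y I)"
      have c: "c \<noteq> 0" using w True I by (auto simp: c_def)
      \<comment> \<open>\<open>yk\<close> is normalised against the new functional \<open>w\<close>,
        and the old dual vectors are corrected so that \<open>w\<close> kills them.\<close>
      define yk where "yk = (1 / c) *\<^sub>R Y I"
      define y' where "y' b = (if b = k then yk else y I b - inner w (y I b) *\<^sub>R yk)" for b
      have yk: "yk \<in> span (lam ` I)" "inner w yk = 1" "\<And>a. a < k \<Longrightarrow> inner (u a) yk = 0"
        using Y[OF I True] c by (auto simp: yk_def c_def intro: span_scale)
      have "y' b \<in> span (lam ` I)" if "b < Suc k" for b
        using yk(1) y(1)[OF I True, of b] that
        by (auto simp: y'_def less_Suc_eq intro!: span_diff span_scale)
      moreover have "inner ((u(k := w)) a) (y' b) = (if a = b then 1 else 0)"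
        if "a < Suc k" "b < Suc k" for a b
        using yk y(2)[OF I True] that by (auto simp: y'_def less_Suc_eq inner_diff_right)
      moreover have "min (Suc k) (card I) = Suc k" using True by simp
      ultimately show ?thesis by (intro exI[of _ y']) simp
    next
      case False
      then have m: "min (Suc k) (card I) = card I" "min k (card I) = card I" by auto
      obtain y where "\<forall>b<card I. y b \<in> span (lam ` I) \<and>
          (\<forall>a<card I. inner (u a) (y b) = (if a = b then 1 else 0))"
        using bspec[OF u[unfolded flag_def] I] unfolding m(2) by (elim exE)
      then show ?thesis using False unfolding m by (intro exI[of _ y]) auto
    qed
  qed
  then show ?case by blast
qed

section \<open>The flag is a regular sequence on the face ring\<close>

definition nonface_polys :: "'v mpoly set" where
  "nonface_polys = {p. \<forall>\<alpha>\<in>Poly_Mapping.keys p. supp \<alpha> \<notin> K}"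

text \<open>Preimage in the polynomial ring of the ideal that the first k forms generate in R[K];
  working with it postpones cosets to the last section. For a flag and k = n it is J.\<close>

definition theta_sums :: "(nat \<Rightarrow> 'a) \<Rightarrow> nat \<Rightarrow> 'v mpoly set" where
  "theta_sums u k = {s + (\<Sum>a<k. theta lam (u a) * q a) |s q. s \<in> nonface_polys}"

lemma sum_fun_apply: "(\<Sum>x\<in>A. f x) I = (\<Sum>x\<in>A. f x I)"
  by (induction A rule: infinite_finite_induct) auto

lemma commuting_ops_theta: "commuting_ops (\<lambda>a. act (theta lam (u a)))"
  by (intro commuting_ops.intro additive_act act_comm)

text \<open>Each face is handled alone: on k variables the first k forms of the flag remain
  independent, and \<open>regular_on_face\<close> applies.\<close>

lemma regular_face_module:
  assumes u: "flag n u"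
  shows "commuting_ops.regular (\<lambda>a. act (theta lam (u a))) k (face_module K k)"
proof -
  interpret commuting_ops "\<lambda>a. act (theta lam (u a))" by (rule commuting_ops_theta)
  show ?thesis
    unfolding regular_def
  proof (intro allI impI ballI)
    fix j g
    assume "j < k" and g: "g \<in> face_module K k" and "act (theta lam (u j)) g \<in> img j (face_module K k)"
    then obtain z where z: "act (theta lam (u j)) g = (\<Sum>a<j. act (theta lam (u a)) (z a))"
      unfolding img_def by auto
    have "\<exists>w. (\<forall>a. trunc I (w a) = w a \<and> (w a \<noteq> 0 \<longrightarrow> I \<in> K \<and> card I = k))
        \<and> g I = (\<Sum>a<j. trunc I (theta lam (u a) * w a))" for I
    proof (cases "I \<in> K \<and> card I = k")
      case True
      then have "min n (card I) = k" using card_face_le[of I] by simp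
      then obtain y where "\<forall>b<k. y b \<in> span (lam ` I) \<and>
          (\<forall>a<k. inner (u a) (y b) = (if a = b then 1 else 0))"
        using bspec[OF u[unfolded flag_def], of I] True by auto
      then have y: "\<And>b. b < k \<Longrightarrow> y b \<in> span (lam ` I)"
        "\<And>a b. a < k \<Longrightarrow> b < k \<Longrightarrow> inner (u a) (y b) = (if a = b then 1 else 0)"
        by auto
      have eq: "trunc I (theta lam (u j) * g I) = (\<Sum>a<j. trunc I (theta lam (u a) * z a I))"
        using fun_cong[OF z, of I] by (simp add: act_def sum_fun_apply)
      have "trunc I (g I) = g I" using g by (auto simp: face_module_def)
      have "\<exists>w. (\<forall>a. trunc I (w a) = w a) \<and> g I = (\<Sum>a<j. trunc I (theta lam (u a) * w a))"
        by (rule regular_on_face[OF \<open>j < k\<close> _ _ \<open>trunc I (g I) = g I\<close> eq, of y]) (simp_all add: y)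
      then obtain w where
        "\<forall>a. trunc I (w a) = w a" "g I = (\<Sum>a<j. trunc I (theta lam (u a) * w a))" by (elim exE conjE)
      then show ?thesis using True by (intro exI[of _ w] conjI) simp_all
    next
      case False
      then have "g I = 0" using g by (auto simp: face_module_def)
      then show ?thesis by (intro exI[of _ "\<lambda>_. 0"]) simp
    qed
    then have "\<forall>I. \<exists>w. (\<forall>a. trunc I (w a) = w a \<and> (w a \<noteq> 0 \<longrightarrow> I \<in> K \<and> card I = k))
        \<and> g I = (\<Sum>a<j. trunc I (theta lam (u a) * w a))" by (rule allI)
    from choice[OF this] obtain w where W:
      "\<forall>I. (\<forall>a. trunc I (w I a) = w I a \<and> (w I a \<noteq> 0 \<longrightarrow> I \<in> K \<and> card I = k))
        \<and> g I = (\<Sum>a<j. trunc I (theta lam (u a) * w I a))" by (elim exE)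
    have w1: "trunc I (w I a) = w I a \<and> (w I a \<noteq> 0 \<longrightarrow> I \<in> K \<and> card I = k)" for I a
      by (rule spec[OF conjunct1[OF spec[OF W]]])
    have w2: "g I = (\<Sum>a<j. trunc I (theta lam (u a) * w I a))" for I
      by (rule conjunct2[OF spec[OF W]])
    have "g = (\<Sum>a<j. act (theta lam (u a)) (\<lambda>I. w I a))"
      by (rule ext) (simp add: sum_fun_apply act_def w2[symmetric])
    moreover have "(\<lambda>I. w I a) \<in> face_module K k" for a
      using w1 by (simp add: face_module_def)
    ultimately show "g \<in> img j (face_module K k)"
      unfolding img_def by (intro CollectI exI[of _ "\<lambda>a I. w I a"]) auto
  qed
qed

text \<open>Cycles of index k + 1 are the kernel of \<open>dif\<close> on the face module of index k
  + 1, and by exactness its image is the cycles of index k. The depth lemma thus gains one form per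
  index.\<close>

lemma regular_cycle_module:
  assumes u: "flag n u" and "k \<le> n"
  shows "commuting_ops.regular (\<lambda>a. act (theta lam (u a))) k {g \<in> face_module K k. dif g = 0}"
  using assms(2)
proof (induction k)
  case 0
  then show ?case by (simp add: commuting_ops.regular_def[OF commuting_ops_theta])
next
  case (Suc k)
  have "commuting_ops.regular (\<lambda>a. act (theta lam (u a))) k (dif ` face_module K (Suc k))"
    unfolding face_module_exact[OF complex sphere Suc_le_lessD[OF Suc.prems]]
    using Suc by (intro Suc.IH) simp
  then show ?case
    by (intro commuting_ops.regular_kernel[OF commuting_ops_theta] regular_face_module u)
      (auto simp: face_module_0 face_module_add face_module_minus face_module_act additive_dif dif_act)
qed

text \<open>Augmentation of the complex: restriction to all facets, with the orientation as signs so
  that the result is a cycle. It identifies R[K] with the cycles of index n.\<close>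

definition top_embed :: "'v mpoly \<Rightarrow> ('v set \<Rightarrow> 'v mpoly)" where
  "top_embed p = (\<lambda>I. const (\<epsilon> $ I) * trunc I p)"

lemma coeff_chain_top_embed: "coeff_chain \<alpha> (top_embed p) = lkp p \<alpha> *\<^sub>R star_eps (supp \<alpha>)"
  by (simp add: Finite_Cartesian_Product.vec_eq_iff coeff_chain_def top_embed_def star_eps_def)

lemma top_embed_cycle: "top_embed p \<in> {g \<in> face_module K n. dif g = 0}"
proof -
  have c: "coeff_chain \<alpha> (top_embed p) \<in> star_cycles K (supp \<alpha>) n" for \<alpha>
    using star_eps_cycle[of "supp \<alpha>"] linear_star_boundary[of "supp \<alpha>"]
    by (auto simp: coeff_chain_top_embed star_cycles_def star_chains_def linear_scale)
  then show ?thesis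
    by (auto intro!: face_moduleI simp: star_cycles_def dif_eq_0_iff)
qed

lemma top_embed_surj:
  assumes g: "g \<in> face_module K n" "dif g = 0"
  shows "\<exists>p. g = top_embed p"
proof -
  \<comment> \<open>The scalar is 0 wherever the chain is, so the polynomial built from the scalars
    has finite support.\<close>
  have "\<exists>r. coeff_chain \<alpha> g = r *\<^sub>R star_eps (supp \<alpha>) \<and> (coeff_chain \<alpha> g = 0 \<longrightarrow> r = 0)" for \<alpha>
  proof (cases "coeff_chain \<alpha> g = 0")
    case False
    have c: "coeff_chain \<alpha> g \<in> star_chains K (supp \<alpha>) n" by (rule coeff_chain_face_module[OF g(1)])
    have "supp \<alpha> \<in> K" by (rule star_chains_nonface[OF complex c False])
    moreover have "coeff_chain \<alpha> g \<in> star_cycles K (supp \<alpha>) n"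
      using c g(2) by (simp add: star_cycles_def dif_eq_0_iff)
    ultimately show ?thesis
      using star_cycles_top[OF sphere card_face_le _ _ star_eps_cycle star_eps_nonzero] False by blast
  qed simp
  then obtain r where r: "\<And>\<alpha>. coeff_chain \<alpha> g = r \<alpha> *\<^sub>R star_eps (supp \<alpha>)"
    "\<And>\<alpha>. coeff_chain \<alpha> g = 0 \<Longrightarrow> r \<alpha> = 0" by metis
  define p where "p = (\<Sum>\<alpha>\<in>{\<alpha>. coeff_chain \<alpha> g \<noteq> 0}. Poly_Mapping.single \<alpha> (r \<alpha>))"
  have "lkp p \<alpha> = r \<alpha>" for \<alpha>
    using finite_coeff_chain[of g] r(2)[of \<alpha>] by (auto simp: p_def lookup_sum lookup_single when_def)
  then have "g = top_embed p"
    by (intro coeff_chain_eqI) (simp add: coeff_chain_top_embed r(1))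
  then show ?thesis by blast
qed

lemma top_embed_eq_0_iff: "top_embed p = 0 \<longleftrightarrow> p \<in> nonface_polys"
proof -
  have "star_eps \<sigma> = 0" if "\<sigma> \<notin> K" for \<sigma>
    using that face_subset eps_nonfacet facetD(1)
    by (auto simp: star_eps_def Finite_Cartesian_Product.vec_eq_iff)
  then have *: "star_eps \<sigma> = 0 \<longleftrightarrow> \<sigma> \<notin> K" for \<sigma> using star_eps_nonzero by blast
  have "top_embed p = 0 \<longleftrightarrow> (\<forall>\<alpha>. coeff_chain \<alpha> (top_embed p) = 0)"
  proof
    assume "\<forall>\<alpha>. coeff_chain \<alpha> (top_embed p) = 0"
    then show "top_embed p = 0"
      by (intro coeff_chain_eqI) (simp add: coeff_chain_def Finite_Cartesian_Product.vec_eq_iff)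
  qed (simp add: coeff_chain_def Finite_Cartesian_Product.vec_eq_iff)
  also have "\<dots> \<longleftrightarrow> (\<forall>\<alpha>. lkp p \<alpha> = 0 \<or> supp \<alpha> \<notin> K)"
    by (simp add: coeff_chain_top_embed *)
  also have "\<dots> \<longleftrightarrow> p \<in> nonface_polys" by (auto simp: nonface_polys_def in_keys_iff)
  finally show ?thesis .
qed

lemma top_embed_add: "top_embed (p + q) = top_embed p + top_embed q"
  by (rule ext) (simp add: top_embed_def restr_add distrib_left)

lemma top_embed_diff: "top_embed (p - q) = top_embed p - top_embed q"
  by (rule ext) (simp add: top_embed_def restr_diff right_diff_distrib)

lemma top_embed_sum: "top_embed (sum f A) = (\<Sum>x\<in>A. top_embed (f x))"
proof (induction A rule: infinite_finite_induct)
  case empty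
  show ?case by (rule ext) (simp add: top_embed_def)
next
  case (infinite A)
  then show ?case by (auto intro!: ext simp: top_embed_def)
qed (simp add: top_embed_add)

lemma trunc_const: "trunc I (const c) = const c"
  by (simp add: const_def restr_single)

lemma top_embed_mult: "top_embed (p * q) = act p (top_embed q)"
  by (rule ext) (simp add: top_embed_def act_def trunc_mult restr_restr trunc_const mult.left_commute)

text \<open>Regularity on the cycles of index n is carried back along \<open>top_embed\<close>,
  which is onto those cycles and has kernel \<open>nonface_polys\<close>.\<close>

lemma theta_regular:
  assumes u: "flag n u" and "k < n" and p: "theta lam (u k) * p \<in> theta_sums u k"
  shows "p \<in> theta_sums u k"
proof -
  interpret commuting_ops "\<lambda>a. act (theta lam (u a))" by (rule commuting_ops_theta)
  let ?Z = "{g \<in> face_module K n. dif g = 0}"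
  obtain s q where sq: "theta lam (u k) * p = s + (\<Sum>a<k. theta lam (u a) * q a)" "s \<in> nonface_polys"
    using p unfolding theta_sums_def by auto
  have "top_embed s = 0" using sq(2) by (simp add: top_embed_eq_0_iff)
  then have "act (theta lam (u k)) (top_embed p) = (\<Sum>a<k. act (theta lam (u a)) (top_embed (q a)))"
    using arg_cong[OF sq(1), of top_embed] by (simp add: top_embed_add top_embed_sum top_embed_mult)
  then have "act (theta lam (u k)) (top_embed p) \<in> img k ?Z"
    using top_embed_cycle unfolding img_def
    by (intro CollectI exI[of _ "\<lambda>a. top_embed (q a)"]) auto
  then have "top_embed p \<in> img k ?Z"
    using regular_cycle_module[OF u order.refl] \<open>k < n\<close> top_embed_cycle[of p]
    unfolding regular_def by simp
  then obtain z where z: "top_embed p = (\<Sum>a<k. act (theta lam (u a)) (z a))" "\<forall>a. z a \<in> ?Z"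
    unfolding img_def by auto
  from z(2) have "\<forall>a. \<exists>p. z a = top_embed p" using top_embed_surj by blast
  then obtain r where "\<And>a. z a = top_embed (r a)" by metis
  then have "top_embed (p - (\<Sum>a<k. theta lam (u a) * r a)) = 0"
    using z(1) by (simp add: top_embed_diff top_embed_sum top_embed_mult)
  then have "p - (\<Sum>a<k. theta lam (u a) * r a) \<in> nonface_polys"
    by (simp add: top_embed_eq_0_iff)
  then show ?thesis unfolding theta_sums_def
    by (intro CollectI exI[of _ "p - (\<Sum>a<k. theta lam (u a) * r a)"] exI[of _ r]) simp
qed

end

section \<open>The Hilbert function\<close>

interpretation mp: vector_space "\<lambda>r (p :: 'v mpoly). const r * p"
  by unfold_locales (auto simp: algebra_simps const_add const_mult)

interpretation mpp: vector_space_pair "\<lambda>r (p :: 'v mpoly). const r * p" "\<lambda>r (p :: 'v mpoly). const r * p" ..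

lemma mp_subspaceI:
  "0 \<in> S \<Longrightarrow> (\<And>x y. x \<in> S \<Longrightarrow> y \<in> S \<Longrightarrow> x + y \<in> S) \<Longrightarrow> (\<And>r x. x \<in> S \<Longrightarrow> const r * x \<in> S) \<Longrightarrow> mp.subspace S"
  by (auto simp: mp.subspace_def)

lemma mp_span_mono:
  fixes S :: "('v \<Rightarrow>\<^sub>0 nat) set"
  assumes "finite S"
  shows "mp.span ((\<lambda>\<alpha>. mono \<alpha>) ` S) = {p :: 'v mpoly. Poly_Mapping.keys p \<subseteq> S}"
proof
  have "mp.subspace {p :: 'v mpoly. Poly_Mapping.keys p \<subseteq> S}"
  proof (rule mp_subspaceI)
    fix x y :: "'v mpoly" and r
    assume x: "x \<in> {p. Poly_Mapping.keys p \<subseteq> S}"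
    then show "const r * x \<in> {p. Poly_Mapping.keys p \<subseteq> S}" using keys_const_mult[of r x] by auto
    assume "y \<in> {p. Poly_Mapping.keys p \<subseteq> S}"
    then show "x + y \<in> {p. Poly_Mapping.keys p \<subseteq> S}" using x keys_add[of x y] by auto
  qed simp
  then show "mp.span ((\<lambda>\<alpha>. mono \<alpha>) ` S) \<subseteq> {p. Poly_Mapping.keys p \<subseteq> S}"
    by (intro mp.span_minimal) auto
  show "{p. Poly_Mapping.keys p \<subseteq> S} \<subseteq> mp.span ((\<lambda>\<alpha>. mono \<alpha>) ` S)"
  proof
    fix p :: "'v mpoly" assume "p \<in> {p. Poly_Mapping.keys p \<subseteq> S}"
    then have "(\<Sum>\<alpha>\<in>Poly_Mapping.keys p. const (lkp p \<alpha>) * mono \<alpha>) \<in> mp.span ((\<lambda>\<alpha>. mono \<alpha>) ` S)"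
      by (intro mp.span_sum mp.span_scale mp.span_base) auto
    then show "p \<in> mp.span ((\<lambda>\<alpha>. mono \<alpha>) ` S)" by (simp flip: mpoly_eq_sum)
  qed
qed

lemma mp_dim_keys:
  assumes "finite S"
  shows "mp.dim {p :: 'v mpoly. Poly_Mapping.keys p \<subseteq> S} = card S"
proof -
  let ?m = "\<lambda>\<alpha>. mono \<alpha> :: 'v mpoly"
  have inj: "inj_on ?m S"
  proof (rule inj_onI)
    fix \<alpha> \<beta> assume "?m \<alpha> = ?m \<beta>"
    then have "Poly_Mapping.keys (?m \<alpha>) = Poly_Mapping.keys (?m \<beta>)" by (rule arg_cong)
    then show "\<alpha> = \<beta>" by simp
  qed
  have "mp.independent (?m ` S)"
    unfolding mp.dependent_def
  proof
    assume "\<exists>a\<in>?m ` S. a \<in> mp.span (?m ` S - {a})"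
    then obtain \<alpha> where \<alpha>: "\<alpha> \<in> S" "?m \<alpha> \<in> mp.span (?m ` S - {?m \<alpha>})" by auto
    have "?m ` S - {?m \<alpha>} \<subseteq> ?m ` (S - {\<alpha>})" by auto
    then have "?m \<alpha> \<in> mp.span (?m ` (S - {\<alpha>}))" by (rule subsetD[OF mp.span_mono \<alpha>(2)])
    then have "?m \<alpha> \<in> {p. Poly_Mapping.keys p \<subseteq> S - {\<alpha>}}"
      using mp_span_mono[of "S - {\<alpha>}"] assms by simp
    then show False by simp
  qed
  then have "mp.dim (mp.span (?m ` S)) = card (?m ` S)" by (rule mp.dim_span_eq_card_independent)
  then show ?thesis using inj by (simp add: mp_span_mono[OF assms] card_image)
qed

lemma finite_tdeg: "finite {\<alpha> :: 'v::finite \<Rightarrow>\<^sub>0 nat. tdeg \<alpha> = d}"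
proof (rule finite_imageD)
  have "lkp \<alpha> i \<le> tdeg \<alpha>" for \<alpha> and i :: 'v
    unfolding tdeg_def by (rule member_le_sum) auto
  then have "lkp ` {\<alpha> :: 'v \<Rightarrow>\<^sub>0 nat. tdeg \<alpha> = d} \<subseteq> {f. \<forall>x. (x \<in> UNIV \<longrightarrow> f x \<in> {..d}) \<and> (x \<notin> UNIV \<longrightarrow> f x = 0)}"
    by auto
  then show "finite (lkp ` {\<alpha> :: 'v \<Rightarrow>\<^sub>0 nat. tdeg \<alpha> = d})"
    by (rule finite_subset) (intro finite_set_of_finite_funs, auto)
  show "inj_on lkp {\<alpha> :: 'v \<Rightarrow>\<^sub>0 nat. tdeg \<alpha> = d}"
    by (rule inj_onI, rule poly_mapping_eqI, erule fun_cong)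
qed

lemma hdeg_keys: "hdeg d = {p. Poly_Mapping.keys p \<subseteq> {\<alpha>. tdeg \<alpha> = d}}"
  by (auto simp: hdeg_def)

lemma mp_subspace_hdeg: "mp.subspace (hdeg d)"
  by (intro mp_subspaceI hdeg_0 hdeg_add hdeg_const_mult)

lemma mp_subspace_Int: "mp.subspace S \<Longrightarrow> mp.subspace T \<Longrightarrow> mp.subspace (S \<inter> T)"
  by (auto simp: mp.subspace_def)

lemma hdeg_fin:
  obtains F :: "'v::finite mpoly set" where "finite F" "hdeg d \<subseteq> mp.span F"
proof
  show "finite ((\<lambda>\<alpha>. mono \<alpha> :: 'v mpoly) ` {\<alpha>. tdeg \<alpha> = d})" using finite_tdeg by auto
  show "hdeg d \<subseteq> mp.span ((\<lambda>\<alpha>. mono \<alpha> :: 'v mpoly) ` {\<alpha>. tdeg \<alpha> = d})"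
    by (simp add: mp_span_mono[OF finite_tdeg] hdeg_keys)
qed

section \<open>Hilbert series of monomials sorted by support\<close>

text \<open>As a rational function this is the |\<open>\<sigma>\<close>|-th power of X / (1 - X);
  \<open>supp_series_power\<close> states it with cleared denominators.\<close>

definition supp_series :: "'v::finite set \<Rightarrow> int fps" where
  "supp_series \<sigma> = Abs_fps (\<lambda>d. int (card {\<alpha>. tdeg \<alpha> = d \<and> supp \<alpha> = \<sigma>}))"

lemma supp_series_empty: "supp_series {} = 1"
proof -
  have "{\<alpha> :: 'a \<Rightarrow>\<^sub>0 nat. tdeg \<alpha> = d \<and> supp \<alpha> = {}} = (if d = 0 then {0} else {})" for d
    by auto
  then show ?thesis by (intro fps_ext) (simp add: supp_series_def)
qed

text \<open>Dividing a monomial with support \<open>insert i \<sigma>\<close> by x_i leaves the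
  support unchanged or reduces it to \<open>\<sigma>\<close>, depending on whether x_i still
  occurs.\<close>

lemma supp_series_insert:
  assumes "i \<notin> \<sigma>"
  shows "(1 - fps_X) * supp_series (insert i \<sigma>) = fps_X * supp_series \<sigma>"
proof (rule fps_ext)
  fix d
  let ?e = "Poly_Mapping.single i (1::nat)"
  let ?S = "\<lambda>d \<sigma>. {\<alpha>. tdeg \<alpha> = d \<and> supp \<alpha> = \<sigma>}"
  have step: "card (?S (Suc d) (insert i \<sigma>)) = card (?S d (insert i \<sigma>)) + card (?S d \<sigma>)" for d
  proof -
    have "bij_betw (\<lambda>\<alpha>. \<alpha> + ?e) (?S d (insert i \<sigma>) \<union> ?S d \<sigma>) (?S (Suc d) (insert i \<sigma>))"
    proof (rule bij_betwI')
      fix \<beta> assume b: "\<beta> \<in> ?S (Suc d) (insert i \<sigma>)"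
      then have bi: "lkp \<beta> i \<noteq> 0" by (auto simp: in_keys_iff)
      have eq: "\<beta> = (\<beta> - ?e) + ?e"
        using bi by (intro poly_mapping_eqI) (auto simp: lookup_add lookup_minus lookup_single when_def)
      have "tdeg \<beta> = tdeg (\<beta> - ?e) + 1" by (subst eq) (simp add: tdeg_add)
      moreover have "insert i \<sigma> = supp (\<beta> - ?e) \<union> {i}"
        using b eq supp_add[of "\<beta> - ?e" ?e] by simp
      then have "supp (\<beta> - ?e) = insert i \<sigma> \<or> supp (\<beta> - ?e) = \<sigma>" using assms by auto
      ultimately show "\<exists>\<alpha>\<in>?S d (insert i \<sigma>) \<union> ?S d \<sigma>. \<beta> = \<alpha> + ?e"
        using eq b by (intro bexI[of _ "\<beta> - ?e"]) auto
    qed (auto simp: tdeg_add supp_add)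
    then have "card (?S (Suc d) (insert i \<sigma>)) = card (?S d (insert i \<sigma>) \<union> ?S d \<sigma>)"
      by (simp add: bij_betw_same_card)
    also have "\<dots> = card (?S d (insert i \<sigma>)) + card (?S d \<sigma>)"
    proof (rule card_Un_disjoint)
      show "finite (?S d (insert i \<sigma>))" "finite (?S d \<sigma>)"
        by (rule finite_subset[OF _ finite_tdeg[of d]]; auto)+
    qed (use assms in auto)
    finally show ?thesis .
  qed
  have "?S 0 (insert i \<sigma>) = {}"
    by (auto simp: tdeg_def in_keys_iff)
  then have "card (?S 0 (insert i \<sigma>)) = 0" by (simp only: card.empty)
  then show "fps_nth ((1 - fps_X) * supp_series (insert i \<sigma>)) d = fps_nth (fps_X * supp_series \<sigma>) d"
    using step[of "d - 1"] by (cases d) (simp_all add: left_diff_distrib supp_series_def)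
qed

lemma supp_series_power:
  fixes \<sigma> :: "'v::finite set"
  shows "(1 - fps_X) ^ card \<sigma> * supp_series \<sigma> = fps_X ^ card \<sigma>"
  using finite[of \<sigma>]
proof (induction \<sigma> rule: finite_induct)
  case (insert i \<sigma>)
  have "(1 - fps_X) ^ card (insert i \<sigma>) * supp_series (insert i \<sigma>)
      = (1 - fps_X) ^ card \<sigma> * ((1 - fps_X) * supp_series (insert i \<sigma>))"
    using insert by (simp add: mult_ac)
  also have "\<dots> = fps_X * ((1 - fps_X) ^ card \<sigma> * supp_series \<sigma>)"
    by (simp add: supp_series_insert[OF insert(2)] mult_ac)
  finally show ?case using insert by simp
qed (simp add: supp_series_empty)

lemma sum_Pow_powers:
  fixes a b :: "'r::comm_ring_1"
  assumes "finite I"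
  shows "(\<Sum>\<sigma>\<in>Pow I. a ^ card \<sigma> * b ^ (card I - card \<sigma>)) = (a + b) ^ card I"
  using assms
proof (induction I rule: finite_induct)
  case (insert i I)
  have inj: "inj_on (insert i) (Pow I)" using insert(2) by (auto simp: inj_on_def)
  have "(\<Sum>\<sigma>\<in>Pow (insert i I). a ^ card \<sigma> * b ^ (card (insert i I) - card \<sigma>))
      = (\<Sum>\<sigma>\<in>Pow I. a ^ card \<sigma> * b ^ (Suc (card I) - card \<sigma>))
      + (\<Sum>\<sigma>\<in>Pow I. a ^ card (insert i \<sigma>) * b ^ (Suc (card I) - card (insert i \<sigma>)))"
    unfolding Pow_insert using insert inj
    by (subst sum.union_disjoint) (auto simp: sum.reindex)
  also have "(\<Sum>\<sigma>\<in>Pow I. a ^ card \<sigma> * b ^ (Suc (card I) - card \<sigma>))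
      = (\<Sum>\<sigma>\<in>Pow I. b * (a ^ card \<sigma> * b ^ (card I - card \<sigma>)))"
    by (rule sum.cong) (use insert in \<open>auto simp: Suc_diff_le card_mono mult_ac\<close>)
  also have "(\<Sum>\<sigma>\<in>Pow I. a ^ card (insert i \<sigma>) * b ^ (Suc (card I) - card (insert i \<sigma>)))
      = (\<Sum>\<sigma>\<in>Pow I. a * (a ^ card \<sigma> * b ^ (card I - card \<sigma>)))"
  proof (rule sum.cong[OF refl])
    fix \<sigma> assume "\<sigma> \<in> Pow I"
    then have "card (insert i \<sigma>) = Suc (card \<sigma>)"
      using insert by (metis PowD card_insert_disjoint finite_subset subsetD)
    then show "a ^ card (insert i \<sigma>) * b ^ (Suc (card I) - card (insert i \<sigma>))
        = a * (a ^ card \<sigma> * b ^ (card I - card \<sigma>))" by simp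
  qed
  finally show ?case using insert by (simp add: sum_distrib_left[symmetric] distrib_right add.commute)
qed simp

text \<open>Reversing (t - 1)^m gives (1 - t)^m. The h-numbers are defined by powers of t - 1,
  whereas the Hilbert series produces powers of 1 - t.\<close>

lemma coeff_reflect_linear_power:
  fixes m :: nat
  assumes "j \<le> s + m"
  shows "Polynomial.coeff (Polynomial.monom 1 s * [:1, -1:] ^ m) j
    = Polynomial.coeff ([:-1, 1 :: int:] ^ m) (s + m - j)"
proof -
  have deg: "Polynomial.degree ([:-1, 1 :: int:] ^ m) = m" by (simp add: degree_power_eq)
  have "reflect_poly ([:-1, 1 :: int:] ^ m) = [:1, -1:] ^ m"
    by (simp add: reflect_poly_power reflect_poly_pCons)
  then have c: "Polynomial.coeff ([:1, -1 :: int:] ^ m) i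
      = (if m < i then 0 else Polynomial.coeff ([:-1, 1:] ^ m) (m - i))" for i
    by (metis coeff_reflect_poly deg)
  show ?thesis
  proof (cases "j < s")
    case True
    then have "Polynomial.coeff ([:-1, 1 :: int:] ^ m) (s + m - j) = 0"
      by (intro coeff_eq_0) (simp add: deg)
    then show ?thesis using True by (simp add: coeff_monom_mult)
  next
    case False
    then show ?thesis using assms by (auto simp: coeff_monom_mult c add.commute)
  qed
qed

context sphere_char
begin

lemma nonface_mult: "p \<in> nonface_polys \<Longrightarrow> q * p \<in> nonface_polys"
proof -
  assume p: "p \<in> nonface_polys"
  have "supp \<alpha> \<notin> K" if "\<alpha> \<in> Poly_Mapping.keys (q * p)" for \<alpha>
  proof -
    from subsetD[OF keys_mult that] obtain a b where "\<alpha> = a + b" "b \<in> Poly_Mapping.keys p" by auto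
    then have "supp b \<subseteq> supp \<alpha>" "supp b \<notin> K" using p by (auto simp: nonface_polys_def supp_add)
    then show ?thesis using face_subset by blast
  qed
  then show ?thesis by (simp add: nonface_polys_def)
qed

lemma nonface_0: "0 \<in> nonface_polys"
  by (simp add: nonface_polys_def)

lemma nonface_add: "p \<in> nonface_polys \<Longrightarrow> q \<in> nonface_polys \<Longrightarrow> p + q \<in> nonface_polys"
  using keys_add[of p q] by (auto simp: nonface_polys_def)

lemma nonface_restr: "p \<in> nonface_polys \<Longrightarrow> restr P p \<in> nonface_polys"
  by (auto simp: nonface_polys_def keys_restr)

lemma theta_sumsI: "s \<in> nonface_polys \<Longrightarrow> s + (\<Sum>a<k. theta lam (u a) * q a) \<in> theta_sums u k"
  unfolding theta_sums_def by (intro CollectI exI conjI) (rule refl)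

lemma theta_sums_0: "0 \<in> theta_sums u k"
  using theta_sumsI[OF nonface_0, where q = "\<lambda>_. 0"] by simp

lemma theta_sums_add:
  assumes "x \<in> theta_sums u k" "y \<in> theta_sums u k"
  shows "x + y \<in> theta_sums u k"
proof -
  obtain s q t r where "x = s + (\<Sum>a<k. theta lam (u a) * q a)" "s \<in> nonface_polys"
    "y = t + (\<Sum>a<k. theta lam (u a) * r a)" "t \<in> nonface_polys"
    using assms unfolding theta_sums_def by auto
  then have e: "x + y = (s + t) + (\<Sum>a<k. theta lam (u a) * (q a + r a))" and "s + t \<in> nonface_polys"
    by (simp_all add: distrib_left sum.distrib nonface_add)
  then show ?thesis unfolding e by (intro theta_sumsI)
qed

lemma theta_sums_mult:
  assumes "x \<in> theta_sums u k"
  shows "p * x \<in> theta_sums u k"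
proof -
  obtain s q where "x = s + (\<Sum>a<k. theta lam (u a) * q a)" "s \<in> nonface_polys"
    using assms unfolding theta_sums_def by auto
  then have e: "p * x = p * s + (\<Sum>a<k. theta lam (u a) * (p * q a))" and "p * s \<in> nonface_polys"
    by (simp_all add: distrib_left sum_distrib_left mult.left_commute nonface_mult)
  then show ?thesis unfolding e by (intro theta_sumsI)
qed

lemma hcomp_theta_mult: "hcomp (Suc d) (theta lam w * q) = theta lam w * hcomp d q"
  "hcomp 0 (theta lam w * q) = 0"
  using hcomp_mult_hdeg[OF theta_hdeg, of d lam w q] hcomp_mult_low[OF theta_hdeg, of 0 lam w q] by auto

lemma theta_sums_hcomp:
  assumes "x \<in> theta_sums u k"
  shows "hcomp d x \<in> theta_sums u k"
proof -
  obtain s q where x: "x = s + (\<Sum>a<k. theta lam (u a) * q a)" "s \<in> nonface_polys"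
    using assms unfolding theta_sums_def by auto
  show ?thesis
  proof (cases d)
    case 0
    then have "hcomp d x = hcomp d s + (\<Sum>a<k. theta lam (u a) * 0)"
      by (simp add: x restr_add restr_sum hcomp_theta_mult)
    then show ?thesis using theta_sumsI[OF nonface_restr[OF x(2)], where q = "\<lambda>_. 0"] by simp
  next
    case (Suc e)
    then have "hcomp d x = hcomp d s + (\<Sum>a<k. theta lam (u a) * hcomp e (q a))"
      by (simp add: x restr_add restr_sum hcomp_theta_mult)
    then show ?thesis using theta_sumsI[OF nonface_restr[OF x(2)], where q = "\<lambda>a. hcomp e (q a)"] by simp
  qed
qed

lemma theta_sums_Suc: "theta_sums u (Suc k) = {e + theta lam (u k) * q |e q. e \<in> theta_sums u k}"
proof (intro equalityI subsetI)
  fix x assume "x \<in> theta_sums u (Suc k)"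
  then obtain s q where "x = s + (\<Sum>a<Suc k. theta lam (u a) * q a)" "s \<in> nonface_polys"
    unfolding theta_sums_def by auto
  then have "x = (s + (\<Sum>a<k. theta lam (u a) * q a)) + theta lam (u k) * q k" by simp
  then show "x \<in> {e + theta lam (u k) * q |e q. e \<in> theta_sums u k}"
    using theta_sumsI[OF \<open>s \<in> nonface_polys\<close>]
    by (intro CollectI exI[of _ "s + (\<Sum>a<k. theta lam (u a) * q a)"] exI[of _ "q k"]) simp
next
  fix x assume "x \<in> {e + theta lam (u k) * q |e q. e \<in> theta_sums u k}"
  then obtain s q r where x: "x = s + (\<Sum>a<k. theta lam (u a) * q a) + theta lam (u k) * r"
    "s \<in> nonface_polys"
    unfolding theta_sums_def by auto
  then have e: "x = s + (\<Sum>a<Suc k. theta lam (u a) * (q(k := r)) a)" by simp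
  show "x \<in> theta_sums u (Suc k)" unfolding e by (rule theta_sumsI[OF x(2)])
qed

lemma mp_subspace_theta_sums: "mp.subspace (theta_sums u k)"
  by (intro mp_subspaceI theta_sums_0 theta_sums_add theta_sums_mult)

text \<open>Hilbert function of the quotient by \<open>theta_sums u k\<close>, taken as an integer
  difference so that it can be the coefficient of a power series.\<close>

definition quot_dim :: "(nat \<Rightarrow> 'a) \<Rightarrow> nat \<Rightarrow> nat \<Rightarrow> int" where
  "quot_dim u k d = int (mp.dim (hdeg d :: 'v mpoly set)) - int (mp.dim (theta_sums u k \<inter> hdeg d))"

lemma quot_dim_Suc_0: "quot_dim u (Suc k) 0 = quot_dim u k 0"
proof -
  have "theta_sums u (Suc k) \<inter> hdeg 0 = theta_sums u k \<inter> hdeg 0"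
  proof (intro equalityI subsetI)
    fix x assume x: "x \<in> theta_sums u (Suc k) \<inter> hdeg 0"
    then obtain e q where e: "x = e + theta lam (u k) * q" "e \<in> theta_sums u k"
      unfolding theta_sums_Suc by auto
    have "x = hcomp 0 x" using x by (simp add: hcomp_eq_self)
    also have "\<dots> = hcomp 0 e" by (simp add: e restr_add hcomp_theta_mult)
    finally show "x \<in> theta_sums u k \<inter> hdeg 0" using theta_sums_hcomp[OF e(2), of 0] x by simp
  next
    fix x assume "x \<in> theta_sums u k \<inter> hdeg 0"
    then show "x \<in> theta_sums u (Suc k) \<inter> hdeg 0"
      unfolding theta_sums_Suc by (intro IntI CollectI exI[of _ x] exI[of _ 0]) auto
  qed
  then show ?thesis by (simp add: quot_dim_def)
qed

text \<open>By regularity, multiplication by the next form is injective modulo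
  \<open>theta_sums u k\<close>; so the preimage occurring in \<open>dim_exact\<close> is the ideal
  itself, one degree lower.\<close>

lemma quot_dim_Suc_Suc:
  assumes u: "flag n u" and "k < n"
  shows "quot_dim u (Suc k) (Suc d) = quot_dim u k (Suc d) - quot_dim u k d"
proof -
  let ?W = "hdeg d :: 'v mpoly set" and ?U = "theta_sums u k \<inter> hdeg (Suc d)" and ?f = "(*) (theta lam (u k))"
  obtain F :: "'v mpoly set" where F: "finite F" "hdeg d \<subseteq> mp.span F" by (rule hdeg_fin)
  obtain F' :: "'v mpoly set" where F': "finite F'" "hdeg (Suc d) \<subseteq> mp.span F'" by (rule hdeg_fin)
  have lin: "Vector_Spaces.linear (\<lambda>r p. const r * p) (\<lambda>r p. const r * p) ?f"
    by unfold_locales (auto simp: distrib_left mult.left_commute)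
  have U: "mp.subspace ?U" by (intro mp_subspace_Int mp_subspace_theta_sums mp_subspace_hdeg)
  have hd: "theta lam (u k) * q \<in> hdeg (Suc d)" if "q \<in> hdeg d" for q
    using hdeg_mult[OF theta_hdeg that] by simp
  have eq1: "{e + ?f q |e q. e \<in> ?U \<and> q \<in> ?W} = theta_sums u (Suc k) \<inter> hdeg (Suc d)"
  proof (intro equalityI subsetI)
    fix x assume "x \<in> {e + ?f q |e q. e \<in> ?U \<and> q \<in> ?W}"
    then show "x \<in> theta_sums u (Suc k) \<inter> hdeg (Suc d)"
      unfolding theta_sums_Suc using hd by (auto intro: hdeg_add)
  next
    fix x assume x: "x \<in> theta_sums u (Suc k) \<inter> hdeg (Suc d)"
    then obtain e q where e: "x = e + theta lam (u k) * q" "e \<in> theta_sums u k"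
      unfolding theta_sums_Suc by auto
    have "x = hcomp (Suc d) x" using x by (simp add: hcomp_eq_self)
    also have "\<dots> = hcomp (Suc d) e + theta lam (u k) * hcomp d q"
      by (simp add: e restr_add hcomp_theta_mult)
    finally show "x \<in> {e + ?f q |e q. e \<in> ?U \<and> q \<in> ?W}"
      using theta_sums_hcomp[OF e(2), of "Suc d"]
      by (intro CollectI exI[of _ "hcomp (Suc d) e"] exI[of _ "hcomp d q"]) simp
  qed
  have eq2: "{q \<in> ?W. ?f q \<in> ?U} = theta_sums u k \<inter> hdeg d"
  proof (intro equalityI subsetI)
    fix q assume "q \<in> {q \<in> ?W. ?f q \<in> ?U}"
    then show "q \<in> theta_sums u k \<inter> hdeg d" using theta_regular[OF u \<open>k < n\<close>, of q] by simp
  next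
    fix q assume "q \<in> theta_sums u k \<inter> hdeg d"
    then show "q \<in> {q \<in> ?W. ?f q \<in> ?U}" using theta_sums_mult hd by simp
  qed
  have UF: "?U \<subseteq> mp.span F'" using F'(2) by (rule le_infI2)
  have "mp.dim {e + ?f q |e q. e \<in> ?U \<and> q \<in> ?W} + mp.dim {q \<in> ?W. ?f q \<in> ?U} = mp.dim ?U + mp.dim ?W"
    by (rule mpp.dim_exact[OF lin mp_subspace_hdeg F U F'(1) UF])
  then show ?thesis unfolding eq1 eq2 by (simp add: quot_dim_def)
qed

lemma quot_series_Suc:
  assumes "flag n u" and "k < n"
  shows "Abs_fps (quot_dim u (Suc k)) = (1 - fps_X) * Abs_fps (quot_dim u k)"
proof (rule fps_ext)
  fix d
  show "fps_nth (Abs_fps (quot_dim u (Suc k))) d = fps_nth ((1 - fps_X) * Abs_fps (quot_dim u k)) d"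
    by (cases d) (simp_all add: left_diff_distrib quot_dim_Suc_0 quot_dim_Suc_Suc[OF assms])
qed

lemma quot_series_0: "Abs_fps (quot_dim u 0) = (\<Sum>\<sigma>\<in>K. supp_series \<sigma>)"
proof (rule fps_ext)
  fix d
  let ?X = "{\<alpha> :: 'v \<Rightarrow>\<^sub>0 nat. tdeg \<alpha> = d}"
  have fin: "finite ?X" by (rule finite_tdeg)
  have "theta_sums u 0 \<inter> hdeg d = {p. Poly_Mapping.keys p \<subseteq> {\<alpha> \<in> ?X. supp \<alpha> \<notin> K}}"
    by (auto simp: theta_sums_def nonface_polys_def hdeg_def)
  then have "quot_dim u 0 d = int (card ?X) - int (card {\<alpha> \<in> ?X. supp \<alpha> \<notin> K})"
    using fin by (simp add: quot_dim_def hdeg_keys mp_dim_keys del: mem_Collect_eq)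
  also have "card ?X = card ({\<alpha> \<in> ?X. supp \<alpha> \<notin> K} \<union> {\<alpha> \<in> ?X. supp \<alpha> \<in> K})"
    by (rule arg_cong[of _ _ card]) auto
  also have "\<dots> = card {\<alpha> \<in> ?X. supp \<alpha> \<notin> K} + card {\<alpha> \<in> ?X. supp \<alpha> \<in> K}"
    using fin by (intro card_Un_disjoint) auto
  also have "{\<alpha> \<in> ?X. supp \<alpha> \<in> K} = (\<Union>\<sigma>\<in>K. {\<alpha>. tdeg \<alpha> = d \<and> supp \<alpha> = \<sigma>})" by auto
  also have "card \<dots> = (\<Sum>\<sigma>\<in>K. card {\<alpha>. tdeg \<alpha> = d \<and> supp \<alpha> = \<sigma>})"
    by (rule card_UN_disjoint) (auto intro: finite_subset[OF _ fin])
  finally show "fps_nth (Abs_fps (quot_dim u 0)) d = fps_nth (\<Sum>\<sigma>\<in>K. supp_series \<sigma>) d"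
    by (simp add: fps_sum_nth supp_series_def)
qed

section \<open>The h-polynomial and its symmetry\<close>

text \<open>Numerator of the Hilbert series of R[K] over the denominator (1 - X)^n.\<close>

definition h_poly :: "int Polynomial.poly" where
  "h_poly = (\<Sum>\<sigma>\<in>K. Polynomial.monom 1 (card \<sigma>) * [:1, -1:] ^ (n - card \<sigma>))"

lemma quot_series:
  assumes "flag n u"
  shows "Abs_fps (quot_dim u n) = fps_of_poly h_poly"
proof -
  have "Abs_fps (quot_dim u k) = (1 - fps_X) ^ k * (\<Sum>\<sigma>\<in>K. supp_series \<sigma>)" if "k \<le> n" for k
    using that
  proof (induction k)
    case (Suc k)
    have "Abs_fps (quot_dim u (Suc k)) = (1 - fps_X) * Abs_fps (quot_dim u k)"
      by (rule quot_series_Suc[OF assms]) (use Suc.prems in simp)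
    also have "Abs_fps (quot_dim u k) = (1 - fps_X) ^ k * (\<Sum>\<sigma>\<in>K. supp_series \<sigma>)"
      by (rule Suc.IH) (use Suc.prems in simp)
    finally show ?case by (simp only: power_Suc mult.assoc)
  qed (simp add: quot_series_0)
  then have "Abs_fps (quot_dim u n) = (\<Sum>\<sigma>\<in>K. (1 - fps_X) ^ n * supp_series \<sigma>)"
    by (simp only: sum_distrib_left order.refl)
  also have "\<dots> = (\<Sum>\<sigma>\<in>K. fps_X ^ card \<sigma> * (1 - fps_X) ^ (n - card \<sigma>))"
  proof (rule sum.cong[OF refl])
    fix \<sigma> assume "\<sigma> \<in> K"
    then have e: "(1 - fps_X :: int fps) ^ n = (1 - fps_X) ^ (n - card \<sigma>) * (1 - fps_X) ^ card \<sigma>"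
      using card_face_le by (simp flip: power_add)
    show "(1 - fps_X) ^ n * supp_series \<sigma> = fps_X ^ card \<sigma> * (1 - fps_X) ^ (n - card \<sigma>)"
      by (simp only: e mult.assoc supp_series_power) (rule mult.commute)
  qed
  also have "\<dots> = fps_of_poly h_poly"
  proof -
    have f: "fps_of_poly [:1, -1 :: int:] = 1 - fps_X"
      by (rule fps_ext) (auto simp: coeff_pCons fps_X_def split: nat.split)
    show ?thesis
      by (simp only: h_poly_def fps_of_poly_sum fps_of_poly_mult fps_of_poly_power fps_of_poly_monom' f)
  qed
  finally show ?thesis .
qed

lemma quot_dim_h_poly: "flag n u \<Longrightarrow> quot_dim u n d = Polynomial.coeff h_poly d"
  using arg_cong[OF quot_series, of u "\<lambda>f. fps_nth f d"] by simp

lemma degree_h_poly: "n < d \<Longrightarrow> Polynomial.coeff h_poly d = 0"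
proof -
  assume "n < d"
  have "Polynomial.coeff (Polynomial.monom 1 (card \<sigma>) * [:1, -1 :: int:] ^ (n - card \<sigma>)) d = 0" if "\<sigma> \<in> K" for \<sigma>
  proof (rule coeff_eq_0)
    have "Polynomial.degree (Polynomial.monom 1 (card \<sigma>) * [:1, -1 :: int:] ^ (n - card \<sigma>))
        \<le> card \<sigma> + (n - card \<sigma>)"
      by (rule order.trans[OF degree_mult_le])
        (intro add_mono degree_monom_le order.trans[OF degree_power_le], simp)
    also have "\<dots> < d" using card_face_le[OF that] \<open>n < d\<close> by simp
    finally show "Polynomial.degree (Polynomial.monom 1 (card \<sigma>) * [:1, -1 :: int:] ^ (n - card \<sigma>)) < d" .
  qed
  then show ?thesis by (simp add: h_poly_def coeff_sum)
qed

lemma h_number_eq: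
  "h_number n K j = Polynomial.coeff (\<Sum>I\<in>K. [:-1, 1:] ^ (n - card I)) (n - j)"
proof -
  have "(\<Sum>I\<in>K. [:-1, 1 :: int:] ^ (n - card I))
      = (\<Sum>i\<le>n. \<Sum>I | I \<in> K \<and> card I = i. [:-1, 1:] ^ (n - card I))"
    using card_face_le by (intro sum.group[symmetric]) auto
  also have "\<dots> = (\<Sum>i\<le>n. Polynomial.smult (int (f_number K (int i - 1))) ([:-1, 1:] ^ (n - i)))"
  proof (rule sum.cong[OF refl])
    fix i
    have "(\<Sum>I | I \<in> K \<and> card I = i. [:-1, 1 :: int:] ^ (n - card I))
        = of_nat (card {I \<in> K. card I = i}) * [:-1, 1:] ^ (n - i)" by simp
    also have "\<dots> = Polynomial.smult (int (card {I \<in> K. card I = i})) ([:-1, 1:] ^ (n - i))"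
      by (simp add: of_nat_mult_conv_smult)
    also have "card {I \<in> K. card I = i} = f_number K (int i - 1)"
      unfolding f_number_def by (rule arg_cong[of _ _ card]) (auto simp: simplices_def)
    finally show "(\<Sum>I | I \<in> K \<and> card I = i. [:-1, 1 :: int:] ^ (n - card I))
        = Polynomial.smult (int (f_number K (int i - 1))) ([:-1, 1:] ^ (n - i))"
      .
  qed
  finally show ?thesis by (simp add: h_number_def)
qed

lemma h_number_h_poly:
  assumes "j \<le> n"
  shows "h_number n K j = Polynomial.coeff h_poly j"
proof -
  have "Polynomial.coeff (Polynomial.monom 1 (card \<sigma>) * [:1, -1:] ^ (n - card \<sigma>)) j
      = Polynomial.coeff ([:-1, 1 :: int:] ^ (n - card \<sigma>)) (n - j)" if "\<sigma> \<in> K" for \<sigma>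
    using coeff_reflect_linear_power[of j "card \<sigma>" "n - card \<sigma>"] assms card_face_le[OF that] by simp
  then show ?thesis by (simp add: h_number_eq h_poly_def coeff_sum)
qed

lemma face_euler: "\<sigma> \<in> K \<Longrightarrow> (\<Sum>I | I \<in> K \<and> \<sigma> \<subseteq> I. (-1) ^ card I) = (-1 :: int) ^ n"
  using star_euler[OF complex sphere card_face_le _ star_eps_cycle star_eps_nonzero] by blast

text \<open>A factor (-1)^n at each \<open>\<sigma>\<close> is replaced by the Euler sum over the
  faces above \<open>\<sigma>\<close>. After exchanging the sums, the binomial theorem over the
  subsets of I collapses the inner sum because X + (1 - X) = 1.\<close>

lemma h_poly_alt: "h_poly = (\<Sum>I\<in>K. [:-1, 1:] ^ (n - card I))"
proof -
  let ?x = "[:0, 1 :: int:]" and ?y = "[:1, -1 :: int:]"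
  have sgn: "(-1) ^ n * (-1) ^ card I * ?y ^ (n - card I) = [:-1, 1:] ^ (n - card I)" if "I \<in> K" for I
  proof -
    have "(-1 :: int Polynomial.poly) ^ n * (-1) ^ card I = (-1) ^ (n - card I)"
      using card_face_le[OF that] by (simp add: minus_one_power_iff)
    then have "(-1) ^ n * (-1) ^ card I * ?y ^ (n - card I) = (- ?y) ^ (n - card I)"
      by (simp flip: power_mult_distrib)
    then show ?thesis by simp
  qed
  \<comment> \<open>Two factors (-1)^n are inserted: one is spent on the Euler sum, the other turns
    powers of 1 - X into powers of X - 1.\<close>
  have "h_poly = (\<Sum>\<sigma>\<in>K. (-1) ^ n * (-1) ^ n * (?x ^ card \<sigma> * ?y ^ (n - card \<sigma>)))"
  proof -
    have "(-1 :: int Polynomial.poly) ^ n * (-1) ^ n = 1" by (simp flip: power_mult_distrib)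
    then show ?thesis by (simp add: h_poly_def monom_altdef)
  qed
  also have "\<dots> = (\<Sum>\<sigma>\<in>K. \<Sum>I | I \<in> K \<and> \<sigma> \<subseteq> I. (-1) ^ n * (-1) ^ card I * (?x ^ card \<sigma> * ?y ^ (n - card \<sigma>)))"
  proof (rule sum.cong[OF refl])
    fix \<sigma> assume "\<sigma> \<in> K"
    have "(-1 :: int Polynomial.poly) ^ n = of_int (\<Sum>I | I \<in> K \<and> \<sigma> \<subseteq> I. (-1) ^ card I)"
      unfolding face_euler[OF \<open>\<sigma> \<in> K\<close>] by simp
    also have "\<dots> = (\<Sum>I | I \<in> K \<and> \<sigma> \<subseteq> I. (-1) ^ card I)" by simp
    finally show "(-1) ^ n * (-1) ^ n * (?x ^ card \<sigma> * ?y ^ (n - card \<sigma>))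
        = (\<Sum>I | I \<in> K \<and> \<sigma> \<subseteq> I. (-1) ^ n * (-1) ^ card I * (?x ^ card \<sigma> * ?y ^ (n - card \<sigma>)))"
      by (simp only: sum_distrib_left[symmetric] sum_distrib_right[symmetric])
  qed
  also have "\<dots> = (\<Sum>I\<in>K. \<Sum>\<sigma>\<in>Pow I. (-1) ^ n * (-1) ^ card I * (?x ^ card \<sigma> * ?y ^ (n - card \<sigma>)))"
  proof -
    have "{\<sigma> \<in> K. \<sigma> \<subseteq> I} = Pow I" if "I \<in> K" for I using face_subset that by auto
    then show ?thesis by (subst sum.swap_restrict) auto
  qed
  also have "\<dots> = (\<Sum>I\<in>K. [:-1, 1:] ^ (n - card I))"
  proof (rule sum.cong[OF refl])
    fix I assume I: "I \<in> K"
    have "(\<Sum>\<sigma>\<in>Pow I. (-1) ^ n * (-1) ^ card I * (?x ^ card \<sigma> * ?y ^ (n - card \<sigma>)))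
        = (\<Sum>\<sigma>\<in>Pow I. ((-1) ^ n * (-1) ^ card I * ?y ^ (n - card I)) * (?x ^ card \<sigma> * ?y ^ (card I - card \<sigma>)))"
    proof (rule sum.cong[OF refl])
      fix \<sigma> assume "\<sigma> \<in> Pow I"
      then have "card \<sigma> \<le> card I" by (auto intro: card_mono)
      then have "n - card \<sigma> = (n - card I) + (card I - card \<sigma>)" using card_face_le[OF I] by simp
      then show "(-1) ^ n * (-1) ^ card I * (?x ^ card \<sigma> * ?y ^ (n - card \<sigma>))
        = ((-1) ^ n * (-1) ^ card I * ?y ^ (n - card I)) * (?x ^ card \<sigma> * ?y ^ (card I - card \<sigma>))"
        by (simp add: power_add mult_ac)
    qed
    also have "\<dots> = ((-1) ^ n * (-1) ^ card I * ?y ^ (n - card I)) * (?x + ?y) ^ card I"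
      by (simp only: sum_distrib_left[symmetric] sum_Pow_powers[OF finite])
    also have "?x + ?y = 1" by (simp add: one_pCons)
    finally show "(\<Sum>\<sigma>\<in>Pow I. (-1) ^ n * (-1) ^ card I * (?x ^ card \<sigma> * ?y ^ (n - card \<sigma>)))
        = [:-1, 1:] ^ (n - card I)"
      using sgn[OF I] by simp
  qed
  finally show ?thesis .
qed

text \<open>The h-number is read off as coefficient n - j of the polynomial in
  \<open>h_poly_alt\<close>, and that polynomial is \<open>h_poly\<close> itself.\<close>

lemma dehn_sommerville: "j \<le> n \<Longrightarrow> Polynomial.coeff h_poly (n - j) = Polynomial.coeff h_poly j"
  using h_number_eq[of j] by (simp add: h_number_h_poly flip: h_poly_alt)

lemma h_poly_coeff_0: "Polynomial.coeff h_poly 0 = 1"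
proof -
  have "Polynomial.coeff h_poly 0 = (\<Sum>\<sigma>\<in>K. if \<sigma> = {} then 1 else 0)"
    unfolding poly_0_coeff_0[symmetric] h_poly_def poly_sum
    by (rule sum.cong) (auto simp: poly_monom card_gt_0_iff)
  then show ?thesis using empty_face by simp
qed

text \<open>At 1 every face with fewer than n vertices contributes 0.\<close>

lemma sum_h_poly: "(\<Sum>j\<le>n. Polynomial.coeff h_poly j) = int (card facets)"
proof -
  have "(\<Sum>j\<le>n. Polynomial.coeff h_poly j) = poly h_poly 1"
  proof -
    have "Polynomial.degree h_poly \<le> n" using degree_h_poly by (simp add: degree_le)
    then show ?thesis using degree_h_poly
      by (simp add: poly_altdef) (intro sum.mono_neutral_right, auto simp: coeff_eq_0)
  qed
  also have "\<dots> = (\<Sum>\<sigma>\<in>K. if card \<sigma> = n then 1 else 0)"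
    unfolding h_poly_def poly_sum using card_face_le
    by (intro sum.cong) (auto simp: poly_monom power_0_left dest: order.antisym)
  also have "\<dots> = int (card facets)" by (simp add: facets_def sum.If_cases Int_def)
  finally show ?thesis .
qed

end

section \<open>Determinants and the points of a generic fibre\<close>

lemma insort_takeWhile:
  assumes "i \<notin> set L"
  shows "insort i L = takeWhile (\<lambda>x. x < i) L @ i # dropWhile (\<lambda>x. x < i) L"
  using assms by (induction L) auto

lemma takeWhile_less_sorted:
  fixes L :: "'b::linorder list"
  shows "sorted L \<Longrightarrow> takeWhile (\<lambda>x. x < i) L = filter (\<lambda>x. x < i) L"
proof (induction L)
  case (Cons y L)
  have "filter (\<lambda>x. x < i) L = []" if "\<not> y < i"
    using Cons.prems that by (auto simp: filter_empty_conv)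
  then show ?case using Cons by auto
qed simp

text \<open>Links two sign conventions: the number of vertices below i is the exponent in the
  boundary and also the row at which i enters the determinant of a facet.\<close>

lemma sorted_list_insert_nth:
  fixes J :: "'b::linorder set"
  assumes "finite J" "i \<notin> J"
  defines "pos \<equiv> card {k\<in>J. k < i}"
  shows "pos \<le> card J"
    and "r \<le> card J \<Longrightarrow> sorted_list_of_set (insert i J) ! r =
      (if r < pos then sorted_list_of_set J ! r else if r = pos then i else sorted_list_of_set J ! (r - 1))"
proof -
  let ?L = "sorted_list_of_set J"
  have L: "set ?L = J" "sorted ?L" "distinct ?L" using assms(1) by auto
  have "sorted_list_of_set (insert i J) = insort i ?L"
    using assms by (simp add: sorted_list_of_set_insert_remove)
  also have "\<dots> = takeWhile (\<lambda>x. x < i) ?L @ i # dropWhile (\<lambda>x. x < i) ?L"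
    by (rule insort_takeWhile) (simp add: L assms)
  finally have eq: "sorted_list_of_set (insert i J)
      = takeWhile (\<lambda>x. x < i) ?L @ i # dropWhile (\<lambda>x. x < i) ?L" .
  have len: "length (takeWhile (\<lambda>x. x < i) ?L) = pos"
    unfolding takeWhile_less_sorted[OF L(2)] pos_def
    using distinct_card[of "filter (\<lambda>x. x < i) ?L"] L by simp
  show "pos \<le> card J" unfolding pos_def using assms(1) by (intro card_mono) auto
  have split: "?L = takeWhile (\<lambda>x. x < i) ?L @ dropWhile (\<lambda>x. x < i) ?L" by simp
  show "sorted_list_of_set (insert i J) ! r =
      (if r < pos then ?L ! r else if r = pos then i else ?L ! (r - 1))" if "r \<le> card J"
  proof (cases "r \<le> pos")
    case True
    then show ?thesis
      unfolding eq using len by (auto simp: nth_append takeWhile_nth)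
  next
    case False
    then have "?L ! (r - 1) = dropWhile (\<lambda>x. x < i) ?L ! (r - 1 - pos)"
      by (subst split) (simp add: nth_append len del: takeWhile_dropWhile_id)
    then show ?thesis
      unfolding eq using False len by (simp add: nth_append nth_Cons')
  qed
qed

context
  fixes e :: "'a::euclidean_space list" and lam :: "'v::linorder \<Rightarrow> 'a" and J :: "'v set"
  assumes J: "finite J" "Suc (card J) = DIM('a)"
begin

definition inserted_mat :: "'a \<Rightarrow> nat \<Rightarrow> real mat" where
  "inserted_mat x p = mat DIM('a) DIM('a) (\<lambda>(r, c).
     inner (if r < p then lam (sorted_list_of_set J ! r) else if r = p then x
            else lam (sorted_list_of_set J ! (r - 1))) (e ! c))"

definition minor :: "nat \<Rightarrow> real" where
  "minor c = Determinant.det (mat (card J) (card J) (\<lambda>(r, c').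
     inner (lam (sorted_list_of_set J ! r)) (e ! (if c' < c then c' else Suc c'))))"

text \<open>Generalised cross product of the vectors of the ridge \<open>J\<close> in the frame
  \<open>e\<close>, made from the minors complementary to an inserted row.\<close>

definition normal_vec :: 'a where
  "normal_vec = (\<Sum>c<DIM('a). ((-1) ^ c * minor c) *\<^sub>R (e ! c))"

lemma det_inserted_mat:
  assumes "p \<le> card J"
  shows "Determinant.det (inserted_mat x p) = (-1) ^ p * inner x normal_vec"
proof -
  let ?A = "inserted_mat x p"
  have A: "?A \<in> carrier_mat DIM('a) DIM('a)" by (simp add: inserted_mat_def)
  have p: "p < DIM('a)" using assms J by simp
  have del: "mat_delete ?A p c = mat (card J) (card J) (\<lambda>(r, c').
     inner (lam (sorted_list_of_set J ! r)) (e ! (if c' < c then c' else Suc c')))"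
    if "c < DIM('a)" for c
  proof (rule eq_matI)
    fix r c'
    assume "r < dim_row (mat (card J) (card J) (\<lambda>(r, c').
        inner (lam (sorted_list_of_set J ! r)) (e ! (if c' < c then c' else Suc c'))))"
      and "c' < dim_col (mat (card J) (card J) (\<lambda>(r, c').
        inner (lam (sorted_list_of_set J ! r)) (e ! (if c' < c then c' else Suc c'))))"
    then show "mat_delete ?A p c $$ (r, c') = mat (card J) (card J) (\<lambda>(r, c').
        inner (lam (sorted_list_of_set J ! r)) (e ! (if c' < c then c' else Suc c'))) $$ (r, c')"
      using J that p by (auto simp: mat_delete_def inserted_mat_def)
  qed (use J in \<open>auto simp: mat_delete_def inserted_mat_def\<close>)
  have "Determinant.det ?A = (\<Sum>c<DIM('a). ?A $$ (p, c) * cofactor ?A p c)"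
    by (rule laplace_expansion_row[OF A p])
  also have "\<dots> = (\<Sum>c<DIM('a). (-1) ^ p * inner x (((-1) ^ c * minor c) *\<^sub>R (e ! c)))"
  proof (rule sum.cong[OF refl])
    fix c assume "c \<in> {..<DIM('a)}"
    then have c: "c < DIM('a)" by simp
    have "cofactor ?A p c = (-1) ^ (p + c) * minor c"
      unfolding cofactor_def del[OF c] minor_def ..
    moreover have "?A $$ (p, c) = inner x (e ! c)" using p c by (simp add: inserted_mat_def)
    ultimately show "?A $$ (p, c) * cofactor ?A p c = (-1) ^ p * inner x (((-1) ^ c * minor c) *\<^sub>R (e ! c))"
      by (simp add: power_add)
  qed
  finally show ?thesis by (simp add: normal_vec_def inner_sum_right sum_distrib_left)
qed

text \<open>The incidence sign undoes the displacement of the row of i, so the determinants of all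
  facets at a ridge are pairings with a single normal vector.\<close>

lemma char_det_insert:
  assumes "i \<notin> J"
  shows "char_det e lam (insert i J) * (-1) ^ card {k\<in>J. k < i} = inner (lam i) normal_vec"
proof -
  let ?p = "card {k\<in>J. k < i}"
  note nth = sorted_list_insert_nth[OF J(1) assms]
  have "mat DIM('a) DIM('a) (\<lambda>(r, c). inner (lam (sorted_list_of_set (insert i J) ! r)) (e ! c))
      = inserted_mat (lam i) ?p"
    unfolding inserted_mat_def
  proof (rule cong_mat)
    fix r c assume "r < DIM('a)" "c < DIM('a)"
    then have "r \<le> card J" using J by simp
    then show "(case (r, c) of (r, c) \<Rightarrow> inner (lam (sorted_list_of_set (insert i J) ! r)) (e ! c))
      = (case (r, c) of (r, c) \<Rightarrow> inner (if r < ?p then lam (sorted_list_of_set J ! r)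
          else if r = ?p then lam i else lam (sorted_list_of_set J ! (r - 1))) (e ! c))"
      by (simp add: nth(2))
  qed auto
  then have "char_det e lam (insert i J) = (-1) ^ ?p * inner (lam i) normal_vec"
    by (simp add: char_det_def det_inserted_mat nth(1))
  moreover have "(-1 :: real) ^ ?p * (-1) ^ ?p = 1" by (simp flip: power_mult_distrib)
  ultimately show ?thesis by (simp add: mult.assoc mult.left_commute)
qed

text \<open>Inserting a vector of the ridge a second time gives a determinant with two equal
  rows.\<close>

lemma normal_vec_orthogonal:
  assumes "k \<in> J"
  shows "inner (lam k) normal_vec = 0"
proof -
  obtain r where r: "r < card J" "sorted_list_of_set J ! r = k"
    using assms J(1) by (metis in_set_conv_nth length_sorted_list_of_set set_sorted_list_of_set)
  have "Determinant.det (inserted_mat (lam k) 0) = 0"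
  proof (rule det_identical_rows[where i = 0 and j = "Suc r"])
    show "inserted_mat (lam k) 0 \<in> carrier_mat DIM('a) DIM('a)" by (simp add: inserted_mat_def)
    show "0 < DIM('a)" "Suc r < DIM('a)" using J r by auto
    then show "row (inserted_mat (lam k) 0) 0 = row (inserted_mat (lam k) 0) (Suc r)"
      using r by (intro eq_vecI) (auto simp: inserted_mat_def)
  qed simp
  then show ?thesis using det_inserted_mat[of 0 "lam k"] by simp
qed

end

locale multifan = sphere_char n K \<epsilon> lam
  for n :: nat and K :: "'v::{finite,linorder} set set" and \<epsilon> :: "'v chain"
    and lam :: "'v \<Rightarrow> 'a::euclidean_space" +
  fixes e :: "'a list" and w :: "'v set \<Rightarrow> real"
  assumes ortho: "orthonormal_basis e" and w: "w = multifan_weight e K \<epsilon> lam"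
begin

lemma facet_orthogonal:
  assumes "I \<in> facets" "\<And>i. i \<in> I \<Longrightarrow> inner x (lam i) = 0"
  shows "x = 0"
proof -
  have "inner x y = 0" if "y \<in> span (lam ` I)" for y
    using that by (induction rule: span_induct_alt) (auto simp: inner_add_right assms(2))
  then have "inner x x = 0" using facet_basis(3)[OF assms(1)] by auto
  then show ?thesis by simp
qed

lemma char_det_nonzero:
  assumes I: "I \<in> facets"
  shows "char_det e lam I \<noteq> 0"
proof
  let ?A = "mat DIM('a) DIM('a) (\<lambda>(r, c). inner (lam (sorted_list_of_set I ! r)) (e ! c))"
  assume "char_det e lam I = 0"
  then have "Determinant.det ?A = 0" by (simp add: char_det_def)
  then obtain x where x: "x \<in> carrier_vec DIM('a)" "x \<noteq> 0\<^sub>v DIM('a)" "?A *\<^sub>v x = 0\<^sub>v DIM('a)"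
    using det_0_iff_vec_prod_zero_field[of ?A "DIM('a)"] by auto
  define u where "u = (\<Sum>c<DIM('a). Matrix.vec_index x c *\<^sub>R (e ! c))"
  have "inner u (lam i) = 0" if "i \<in> I" for i
  proof -
    have "i \<in> set (sorted_list_of_set I)" using that by simp
    then obtain r where "r < length (sorted_list_of_set I)" and r: "sorted_list_of_set I ! r = i"
      unfolding in_set_conv_nth by auto
    then have "r < card I" by simp
    then have rn: "r < DIM('a)" using facetD(2)[OF I] DIM by simp
    have "Matrix.vec_index (?A *\<^sub>v x) r = 0" using x(3) rn by simp
    then show ?thesis using rn x(1) r
      by (subst inner_commute)
        (simp add: u_def inner_sum_right scalar_prod_def lessThan_atLeast0 mult.commute)
  qed
  then have "u = 0" by (rule facet_orthogonal[OF I])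
  have "Matrix.vec_index x c = 0" if "c < DIM('a)" for c
  proof -
    have "inner u (e ! c) = (\<Sum>c'<DIM('a). if c' = c then Matrix.vec_index x c' else 0)"
      unfolding u_def inner_sum_left using ortho that
      by (intro sum.cong) (auto simp: orthonormal_basis_def)
    then show ?thesis using that \<open>u = 0\<close> by simp
  qed
  then have "x = 0\<^sub>v DIM('a)" using x(1) by (intro eq_vecI) auto
  then show False using x(2) by simp
qed

lemma dual_vector_inner:
  assumes I: "I \<in> facets" and i: "i \<in> I" and j: "j \<in> I"
  shows "inner (dual_vector lam I i) (lam j) = (if i = j then 1 else 0)"
proof -
  obtain g :: "'a \<Rightarrow> real" where g: "linear g" "\<And>x. x \<in> lam ` I \<Longrightarrow> g x = (if x = lam i then 1 else 0)"
    using linear_independent_extend[OF facet_basis(2)[OF I], of "\<lambda>x. if x = lam i then 1 else 0"] by auto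
  define u where "u = adjoint g 1"
  have u: "inner u (lam j) = (if i = j then 1 else 0)" if "j \<in> I" for j
    using adjoint_works[OF g(1), of "lam j" 1] g(2)[of "lam j"] that i facet_basis(1)[OF I]
    by (auto simp: u_def inner_commute inj_on_eq_iff)
  have "dual_vector lam I i = u"
    unfolding dual_vector_def
  proof (rule the_equality)
    show "\<forall>j\<in>I. inner u (lam j) = (if i = j then 1 else 0)" using u by simp
    fix u' assume "\<forall>j\<in>I. inner u' (lam j) = (if i = j then 1 else 0)"
    then have "u' - u = 0" using u by (intro facet_orthogonal[OF I]) (simp add: inner_diff_left)
    then show "u' = u" by simp
  qed
  then show ?thesis using u[OF j] by simp
qed

section \<open>The points attached to a vector v and the facets\<close>

text \<open>Coordinates of v in the basis belonging to the facet \<open>I\<close> (see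
  \<open>pt_expand\<close>), extended by 0.\<close>

definition pt :: "'a \<Rightarrow> 'v set \<Rightarrow> 'v \<Rightarrow> real" where
  "pt v I i = (if i \<in> I then inner (dual_vector lam I i) v else 0)"

lemma iota_pt: "iota lam I x v = poly_eval (pt v I) x"
  by (simp add: iota_def pt_def[abs_def])

lemma pt_expand:
  assumes I: "I \<in> facets"
  shows "v = (\<Sum>i\<in>I. pt v I i *\<^sub>R lam i)"
proof -
  have "\<exists>c. v = (\<Sum>i\<in>I. c i *\<^sub>R lam i)"
  proof -
    have "v \<in> span (lam ` I)" using facet_basis(3)[OF I] by simp
    then obtain f where "v = (\<Sum>x\<in>lam ` I. f x *\<^sub>R x)" unfolding span_finite[OF finite_imageI[OF finite]] by auto
    then show ?thesis using facet_basis(1)[OF I] by (intro exI[of _ "f \<circ> lam"]) (simp add: sum.reindex)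
  qed
  then obtain c where c: "v = (\<Sum>i\<in>I. c i *\<^sub>R lam i)" by auto
  have "pt v I i = c i" if "i \<in> I" for i
  proof -
    have "inner (dual_vector lam I i) v = (\<Sum>j\<in>I. if i = j then c j else 0)"
      unfolding c inner_sum_right using that by (intro sum.cong) (auto simp: dual_vector_inner[OF I])
    then show ?thesis using that by (simp add: pt_def)
  qed
  then show ?thesis using c by simp
qed

text \<open>Pairing u with the expansion of v. The value is the same for every facet, which is why
  linear forms turn into scalars under evaluation.\<close>

lemma poly_eval_theta:
  assumes "I \<in> facets"
  shows "poly_eval (pt v I) (theta lam u) = inner u v"
proof -
  have "poly_eval (pt v I) (theta lam u) = (\<Sum>i\<in>UNIV. inner u (lam i) * pt v I i)"
    by (simp add: theta_def eval.subst_sum poly_eval_const_mult eval.subst_var)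
  also have "\<dots> = (\<Sum>i\<in>I. inner u (lam i) * pt v I i)"
    by (rule sum.mono_neutral_right) (auto simp: pt_def)
  also have "\<dots> = inner u (\<Sum>i\<in>I. pt v I i *\<^sub>R lam i)" by (simp add: inner_sum_right mult.commute)
  finally show ?thesis using pt_expand[OF assms, of v] by simp
qed

lemma poly_eval_expo: "poly_eval (pt v I) (mono (expo J)) = (\<Prod>i\<in>J. pt v I i)"
  by (simp add: eval.subst_prod eval.subst_var flip: prod_var)

lemma poly_eval_nonface:
  assumes "I \<in> facets" "p \<in> nonface_polys"
  shows "poly_eval (pt v I) p = 0"
proof -
  have z: "(\<Prod>i\<in>UNIV. pt v I i ^ lkp \<alpha> i) = 0" if "\<alpha> \<in> Poly_Mapping.keys p" for \<alpha>
  proof -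
    have "\<not> supp \<alpha> \<subseteq> I" using assms that face_subset facetD(1) by (auto simp: nonface_polys_def)
    then obtain i where "i \<in> supp \<alpha>" "i \<notin> I" by auto
    then have "pt v I i ^ lkp \<alpha> i = 0" by (simp add: pt_def in_keys_iff)
    then show ?thesis by (simp add: prod_zero_iff) blast
  qed
  show ?thesis unfolding poly_eval_def by (intro sum.neutral ballI) (simp only: z mult_zero_right)
qed

definition generic :: "'a \<Rightarrow> bool" where
  "generic v \<longleftrightarrow> (\<forall>I\<in>facets. \<forall>i\<in>I. pt v I i \<noteq> 0)"

lemma ex_generic_point: "\<exists>v. generic v"
proof -
  let ?Y = "(\<lambda>(I, i). dual_vector lam I i) ` (SIGMA I:facets. I)"
  have "dual_vector lam I i \<noteq> 0" if "I \<in> facets" "i \<in> I" for I i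
    using dual_vector_inner[OF that(1,2,2)] by auto
  then have "0 \<notin> ?Y" by force
  then obtain v where "\<forall>y\<in>?Y. inner v y \<noteq> 0" using ex_generic[of ?Y] by auto
  then have "generic v" by (force simp: generic_def pt_def inner_commute)
  then show ?thesis by blast
qed

lemma prod_pt_nonzero: "generic v \<Longrightarrow> I \<in> facets \<Longrightarrow> (\<Prod>i\<in>I. pt v I i) \<noteq> 0"
  by (auto simp: generic_def)

text \<open>Expanding v along the facet and pairing with the normal of \<open>J\<close> leaves only
  the vertex i outside \<open>J\<close>. The right side is common to all facets at the
  ridge.\<close>

lemma pt_normal_vec:
  assumes I: "insert i J \<in> facets" and i: "i \<notin> J"
  shows "pt v (insert i J) i * char_det e lam (insert i J) * sg i J = inner v (normal_vec e lam J)"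
proof -
  have J: "finite J" "Suc (card J) = DIM('a)" using facetD(2)[OF I] i DIM by auto
  have "inner v (normal_vec e lam J)
      = inner (\<Sum>k\<in>insert i J. pt v (insert i J) k *\<^sub>R lam k) (normal_vec e lam J)"
    using pt_expand[OF I, of v] by simp
  also have "\<dots> = pt v (insert i J) i * inner (lam i) (normal_vec e lam J)"
    using i normal_vec_orthogonal[OF J] by (simp add: inner_add_left inner_sum_left)
  also have "\<dots> = pt v (insert i J) i * char_det e lam (insert i J) * sg i J"
    by (simp add: char_det_insert[OF J i, symmetric] sg_def mult.assoc)
  finally show ?thesis by simp
qed

end

section \<open>Poincare duality\<close>

text \<open>Representatives of a basis of the quotient of \<open>W\<close> by \<open>U\<close>,
  optionally through a prescribed vector outside \<open>U\<close>; the last clause says independence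
  modulo \<open>U\<close>.\<close>

lemma (in vector_space) complement_basis:
  assumes U: "subspace U" and W: "subspace W" "finite F" "W \<subseteq> span F" and "U \<subseteq> W"
    and S: "S = {} \<or> (\<exists>a. a \<in> W \<and> a \<notin> U \<and> S = {a})"
  obtains B where "finite B" "B \<subseteq> W" "S \<subseteq> B" "card B + dim U = dim W"
    "\<And>x. x \<in> W \<Longrightarrow> \<exists>u s. u \<in> U \<and> s \<in> span B \<and> x = u + s"
    "\<And>B' b u s. B' \<subseteq> B \<Longrightarrow> b \<in> B \<Longrightarrow> b \<notin> B' \<Longrightarrow> u \<in> U \<Longrightarrow> s \<in> span B' \<Longrightarrow> b \<noteq> u + s"
proof -
  obtain BU where BU: "BU \<subseteq> U" "independent BU" "span BU = U" "finite BU" "card BU = dim U"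
    by (rule finite_basis_extend[OF U W(2) subset_trans[OF \<open>U \<subseteq> W\<close> W(3)] empty_subsetI independent_empty])
      auto
  have ind: "independent (S \<union> BU)" using S BU(2,3) by (auto simp: independent_insertI)
  have sub: "S \<union> BU \<subseteq> W" using S BU(1) \<open>U \<subseteq> W\<close> by auto
  obtain BW where BW: "S \<union> BU \<subseteq> BW" "BW \<subseteq> W" "independent BW" "span BW = W" "finite BW"
    "card BW = dim W"
    by (rule finite_basis_extend[OF W sub ind])
  show ?thesis
  proof (rule that[of "BW - BU"])
    show "finite (BW - BU)" "BW - BU \<subseteq> W" using BW by auto
    show "S \<subseteq> BW - BU" using S BU(1) BW(1) by auto
    show "card (BW - BU) + dim U = dim W"
      using BW BU card_mono[OF BW(5), of BU] by (simp add: card_Diff_subset)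
    show "\<exists>u s. u \<in> U \<and> s \<in> span (BW - BU) \<and> x = u + s" if "x \<in> W" for x
    proof -
      have "BU \<union> (BW - BU) = BW" using BW(1) by auto
      then have "x \<in> span (BU \<union> (BW - BU))" using BW(4) that by simp
      then show ?thesis unfolding span_Un BU(3) by auto
    qed
    show "b \<noteq> u + s" if B': "B' \<subseteq> BW - BU" "b \<in> BW - BU" "b \<notin> B'" "u \<in> U" "s \<in> span B'" for B' b u s
    proof
      assume b: "b = u + s"
      have "u + s \<in> span (BU \<union> B')" unfolding span_Un BU(3) using B'(4,5) by auto
      moreover have "BU \<union> B' \<subseteq> BW - {b}" using B' BW(1) by auto
      ultimately have "b \<in> span (BW - {b})" using b by (metis span_mono subsetD)
      then show False using BW(3) B'(2) unfolding dependent_def by auto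
    qed
  qed
qed

text \<open>The bound is strict, so \<open>low 0\<close> is zero and the filtration of functions on
  the facets starts at 0.\<close>

definition low :: "nat \<Rightarrow> 'v::finite mpoly set" where
  "low k = {p. \<forall>\<alpha>\<in>Poly_Mapping.keys p. tdeg \<alpha> < k}"

lemma low_0 [simp]: "low 0 = {0}"
  by (auto simp: low_def intro!: poly_mapping_eqI simp: in_keys_iff)

lemma mp_subspace_low: "mp.subspace (low k)"
proof (rule mp_subspaceI)
  fix x y :: "'a mpoly" and r
  assume x: "x \<in> low k"
  then show "const r * x \<in> low k" using keys_const_mult[of r x] by (auto simp: low_def)
  assume "y \<in> low k"
  then show "x + y \<in> low k" using x keys_add[of x y] by (auto simp: low_def)
qed (simp add: low_def)

lemma hdeg_low: "p \<in> hdeg d \<Longrightarrow> d < k \<Longrightarrow> p \<in> low k"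
  by (auto simp: hdeg_def low_def)

lemma low_mult:
  assumes "p \<in> low j" "q \<in> low k" "j + k \<le> Suc m"
  shows "p * q \<in> low m"
  unfolding low_def
proof (intro CollectI ballI)
  fix \<alpha> assume "\<alpha> \<in> Poly_Mapping.keys (p * q)"
  from subsetD[OF keys_mult this] obtain a b where "\<alpha> = a + b" "a \<in> Poly_Mapping.keys p" "b \<in> Poly_Mapping.keys q"
    by auto
  then have "tdeg a < j" "tdeg b < k" "tdeg \<alpha> = tdeg a + tdeg b"
    using assms(1,2) by (auto simp: low_def tdeg_add)
  then show "tdeg \<alpha> < m" using assms(3) by linarith
qed

lemma low_Suc_decomp:
  assumes "p \<in> low (Suc k)"
  shows "p - hcomp k p \<in> low k"
  using assms by (fastforce simp: low_def in_keys_iff lookup_minus less_Suc_eq split: if_splits)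

context multifan
begin

section \<open>The filtration of functions on the facets by degree\<close>

definition facet_space :: "'v chain set" where
  "facet_space = {x. \<forall>I. I \<notin> facets \<longrightarrow> x $ I = 0}"

lemma dim_facet_space: "dim facet_space = card facets"
  unfolding facet_space_def by (rule dim_coordinate_subspace)

lemma subspace_facet_space: "subspace facet_space"
  by (auto simp: subspace_def facet_space_def)

definition ev :: "'a \<Rightarrow> 'v mpoly \<Rightarrow> 'v chain" where
  "ev v p = (\<chi> I. if I \<in> facets then poly_eval (pt v I) p else 0)"

lemma ev_nth: "ev v p $ I = (if I \<in> facets then poly_eval (pt v I) p else 0)"
  by (simp add: ev_def)

lemma ev_add: "ev v (p + q) = ev v p + ev v q"
  by (simp add: Finite_Cartesian_Product.vec_eq_iff ev_nth eval.subst_add)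

lemma ev_diff: "ev v (p - q) = ev v p - ev v q"
  by (simp add: Finite_Cartesian_Product.vec_eq_iff ev_nth eval.subst_diff)

lemma ev_const_mult: "ev v (const r * p) = r *\<^sub>R ev v p"
  by (simp add: Finite_Cartesian_Product.vec_eq_iff ev_nth poly_eval_const_mult)

lemma ev_0: "ev v 0 = 0"
  by (simp add: Finite_Cartesian_Product.vec_eq_iff ev_nth eval.subst_0)

lemma ev_sum: "ev v (sum f A) = (\<Sum>x\<in>A. ev v (f x))"
  by (induction A rule: infinite_finite_induct) (auto simp: ev_add ev_0)

lemma ev_theta: "ev v (theta lam u * q) = inner u v *\<^sub>R ev v q"
  by (simp add: Finite_Cartesian_Product.vec_eq_iff ev_nth eval.subst_mult poly_eval_theta)

lemma ev_nonface: "p \<in> nonface_polys \<Longrightarrow> ev v p = 0"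
  by (simp add: Finite_Cartesian_Product.vec_eq_iff ev_nth poly_eval_nonface)

lemma ev_facet_space: "ev v p \<in> facet_space"
  by (simp add: facet_space_def ev_nth)

lemma subspace_ev_image: "mp.subspace S \<Longrightarrow> subspace (ev v ` S)"
  unfolding subspace_def mp.subspace_def
proof (intro conjI ballI allI; elim conjE)
  assume "0 \<in> S" then show "0 \<in> ev v ` S" by (intro image_eqI[of _ _ 0]) (auto simp: ev_0)
next
  fix x y assume "\<forall>x\<in>S. \<forall>y\<in>S. x + y \<in> S" "x \<in> ev v ` S" "y \<in> ev v ` S"
  then show "x + y \<in> ev v ` S" by (auto simp: ev_add[symmetric])
next
  fix c x assume "\<forall>c. \<forall>x\<in>S. const c * x \<in> S" "x \<in> ev v ` S"
  then show "c *\<^sub>R x \<in> ev v ` S" by (auto simp: ev_const_mult[symmetric])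
qed

lemma ev_span:
  assumes "s \<in> mp.span B"
  shows "ev v s \<in> span (ev v ` B)"
  using assms
proof (induction rule: mp.span_induct_alt)
  case base
  then show ?case by (simp add: ev_0 span_zero)
next
  case (step c x y)
  have "ev v x \<in> span (ev v ` B)" using step(1) by (intro span_base imageI)
  then have "c *\<^sub>R ev v x + ev v y \<in> span (ev v ` B)" using step(2) by (intro span_add span_scale)
  then show ?case by (simp add: ev_add ev_const_mult)
qed

definition gspace :: "'a \<Rightarrow> nat \<Rightarrow> 'v chain set" where
  "gspace v k = ev v ` low k"

lemma subspace_gspace: "subspace (gspace v k)"
  unfolding gspace_def by (rule subspace_ev_image[OF mp_subspace_low])

lemma gspace_subset: "gspace v k \<subseteq> facet_space"
  unfolding gspace_def using ev_facet_space by auto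

lemma gspace_0: "gspace v 0 = {0}"
  by (simp add: gspace_def ev_0)

lemma gspace_Suc:
  assumes "y \<in> gspace v (Suc k)"
  obtains p q where "p \<in> low k" "q \<in> hdeg k" "y = ev v p + ev v q"
proof -
  obtain p where p: "p \<in> low (Suc k)" "y = ev v p" using assms by (auto simp: gspace_def)
  then have "y = ev v (p - hcomp k p) + ev v (hcomp k p)" by (simp add: ev_diff)
  then show ?thesis using that[OF low_Suc_decomp[OF p(1)] hcomp_hdeg] by blast
qed

text \<open>Up to nonface terms, a form of degree k in the ideal is a sum of theta times forms of
  degree k - 1. Evaluation makes the thetas scalars and kills nonface terms, so one degree is
  saved.\<close>

lemma ev_theta_sums:
  assumes "x \<in> theta_sums u m" "x \<in> hdeg k"
  shows "ev v x \<in> gspace v k"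
proof -
  obtain s q where x: "x = s + (\<Sum>a<m. theta lam (u a) * q a)" "s \<in> nonface_polys"
    using assms(1) unfolding theta_sums_def by auto
  show ?thesis
  proof (cases k)
    case 0
    have "x = hcomp 0 x" using assms(2) 0 by (simp add: hcomp_eq_self)
    also have "\<dots> = hcomp 0 s" by (simp add: x restr_add restr_sum hcomp_theta_mult)
    finally have "ev v x = 0" using ev_nonface[OF nonface_restr[OF x(2)]] by metis
    then show ?thesis by (simp add: 0 gspace_0)
  next
    case (Suc d)
    have "x = hcomp (Suc d) x" using assms(2) Suc by (simp add: hcomp_eq_self)
    also have "\<dots> = hcomp (Suc d) s + (\<Sum>a<m. theta lam (u a) * hcomp d (q a))"
      by (simp add: x restr_add restr_sum hcomp_theta_mult)
    finally have "ev v x = ev v (hcomp (Suc d) s + (\<Sum>a<m. theta lam (u a) * hcomp d (q a)))"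
      by (rule arg_cong)
    also have "\<dots> = (\<Sum>a<m. inner (u a) v *\<^sub>R ev v (hcomp d (q a)))"
      by (simp add: ev_add ev_sum ev_theta ev_nonface[OF nonface_restr[OF x(2)]])
    also have "\<dots> \<in> gspace v k"
      using hdeg_low[OF hcomp_hdeg, of d k]
      by (intro subspace_sum[OF subspace_gspace] subspace_scale[OF subspace_gspace])
        (auto simp: Suc gspace_def)
    finally show ?thesis .
  qed
qed

text \<open>The squarefree monomial of a facet has degree n and vanishes at the points of all other
  facets but not at its own, so it evaluates to a multiple of a unit vector.\<close>

lemma gspace_top:
  assumes "generic v"
  shows "gspace v (Suc n) = facet_space"
proof
  show "facet_space \<subseteq> gspace v (Suc n)"
  proof
    fix x assume x: "x \<in> facet_space"
    have ev: "ev v (mono (expo I)) = (\<Prod>i\<in>I. pt v I i) *\<^sub>R axis I 1" if I: "I \<in> facets" for I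
    proof -
      have "(\<Prod>i\<in>I. pt v I' i) = 0" if "I' \<in> facets" "I' \<noteq> I" for I'
      proof -
        have "\<not> I \<subseteq> I'" using facet_eq[OF I that(1)] that(2) by auto
        then obtain i where "i \<in> I" "i \<notin> I'" by auto
        then show ?thesis by (intro prod_zero) (auto simp: pt_def)
      qed
      then show ?thesis using I
        by (auto simp: Finite_Cartesian_Product.vec_eq_iff ev_nth poly_eval_expo axis_def)
    qed
    have ax: "axis I 1 \<in> gspace v (Suc n)" if I: "I \<in> facets" for I
    proof -
      have "mono (expo I) \<in> low (Suc n)"
        by (rule hdeg_low[OF hdeg_single]) (auto simp: tdeg_expo facetD(2)[OF I])
      then have "ev v (mono (expo I)) \<in> gspace v (Suc n)" by (simp add: gspace_def)
      then have "(1 / (\<Prod>i\<in>I. pt v I i)) *\<^sub>R ev v (mono (expo I)) \<in> gspace v (Suc n)"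
        by (rule subspace_scale[OF subspace_gspace])
      then show ?thesis using prod_pt_nonzero[OF assms I] by (simp add: ev[OF I])
    qed
    have "x $ J = (\<Sum>I\<in>facets. x $ I *\<^sub>R axis I 1) $ J" for J
    proof -
      have "(\<Sum>I\<in>facets. x $ I *\<^sub>R axis I 1) $ J = (\<Sum>I\<in>facets. if I = J then x $ I else 0)"
        unfolding sum_component by (rule sum.cong[OF refl]) (simp add: axis_def)
      then show ?thesis using x by (simp add: sum.delta facet_space_def)
    qed
    then have "x = (\<Sum>I\<in>facets. x $ I *\<^sub>R axis I 1)"
      by (intro iffD2[OF Finite_Cartesian_Product.vec_eq_iff] allI)
    also have "\<dots> \<in> gspace v (Suc n)"
      using ax by (intro subspace_sum[OF subspace_gspace] subspace_scale[OF subspace_gspace])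
    finally show "x \<in> gspace v (Suc n)" .
  qed
qed (rule gspace_subset)

definition hval :: "nat \<Rightarrow> int" where
  "hval k = Polynomial.coeff h_poly k"

text \<open>The Hilbert function in the form used for counting: \<open>hval k\<close> forms
  representing a basis of degree k of R/J, possibly through a prescribed form.\<close>

lemma hdeg_complement:
  assumes u: "flag n u" and S: "S = {} \<or> (\<exists>a. a \<in> hdeg k \<and> a \<notin> theta_sums u n \<and> S = {a})"
  obtains B where "finite B" "B \<subseteq> hdeg k" "S \<subseteq> B" "int (card B) = hval k"
    "\<And>x. x \<in> hdeg k \<Longrightarrow> \<exists>s t. s \<in> theta_sums u n \<inter> hdeg k \<and> t \<in> mp.span B \<and> x = s + t"
    "\<And>B' b s t. B' \<subseteq> B \<Longrightarrow> b \<in> B \<Longrightarrow> b \<notin> B' \<Longrightarrow> s \<in> theta_sums u n \<inter> hdeg k \<Longrightarrow> t \<in> mp.span B' \<Longrightarrow> b \<noteq> s + t"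
proof -
  obtain F :: "'v mpoly set" where F: "finite F" "hdeg k \<subseteq> mp.span F" by (rule hdeg_fin)
  have U: "mp.subspace (theta_sums u n \<inter> hdeg k)"
    by (intro mp_subspace_Int mp_subspace_theta_sums mp_subspace_hdeg)
  have S': "S = {} \<or> (\<exists>a. a \<in> hdeg k \<and> a \<notin> theta_sums u n \<inter> hdeg k \<and> S = {a})" using S by auto
  show thesis
  proof (rule mp.complement_basis[OF U mp_subspace_hdeg F Int_lower2 S'])
    fix B
    assume B: "finite B" "B \<subseteq> hdeg k" "S \<subseteq> B"
      and card: "card B + mp.dim (theta_sums u n \<inter> hdeg k) = mp.dim (hdeg k :: 'v mpoly set)"
      and span: "\<And>x. x \<in> hdeg k \<Longrightarrow> \<exists>s t. s \<in> theta_sums u n \<inter> hdeg k \<and> t \<in> mp.span B \<and> x = s + t"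
      and indep: "\<And>B' b s t. B' \<subseteq> B \<Longrightarrow> b \<in> B \<Longrightarrow> b \<notin> B' \<Longrightarrow> s \<in> theta_sums u n \<inter> hdeg k
        \<Longrightarrow> t \<in> mp.span B' \<Longrightarrow> b \<noteq> s + t"
    show thesis
    proof (rule that[OF B])
      show "int (card B) = hval k"
        using card quot_dim_h_poly[OF u, of k] by (simp add: quot_dim_def hval_def)
      show "\<exists>s t. s \<in> theta_sums u n \<inter> hdeg k \<and> t \<in> mp.span B \<and> x = s + t" if "x \<in> hdeg k" for x
        by (rule span[OF that])
      show "b \<noteq> s + t" if "B' \<subseteq> B" "b \<in> B" "b \<notin> B'" "s \<in> theta_sums u n \<inter> hdeg k" "t \<in> mp.span B'"
        for B' b s t
        by (rule indep[OF that])
    qed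
  qed
qed

text \<open>Ideal elements of degree k add nothing to \<open>gspace v k\<close>, by
  \<open>ev_theta_sums\<close>. With \<open>C\<close> all of \<open>B\<close> this bounds the
  growth; discarding elements whose values are already present sharpens the bound.\<close>

lemma dim_gspace_step:
  assumes "B \<subseteq> hdeg k" "finite B" and C: "C \<subseteq> B" "\<And>b. b \<in> B - C \<Longrightarrow> ev v b \<in> gspace v k"
    and B: "\<And>x. x \<in> hdeg k \<Longrightarrow> \<exists>s t. s \<in> theta_sums u n \<inter> hdeg k \<and> t \<in> mp.span B \<and> x = s + t"
  shows "dim (gspace v (Suc k)) \<le> dim (gspace v k) + card C"
proof -
  obtain BG where BG: "BG \<subseteq> gspace v k" "independent BG" "gspace v k \<subseteq> span BG" "card BG = dim (gspace v k)"
    by (rule basis_exists)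
  have finBG: "finite BG" using BG(2) by (rule finiteI_independent)
  let ?S = "span (BG \<union> ev v ` C)"
  have gk: "gspace v k \<subseteq> ?S" using BG(3) span_mono[of BG "BG \<union> ev v ` C"] by auto
  have evB: "ev v ` B \<subseteq> ?S"
  proof
    fix y assume "y \<in> ev v ` B"
    then obtain b where b: "b \<in> B" "y = ev v b" by auto
    show "y \<in> ?S"
    proof (cases "b \<in> C")
      case True
      then show ?thesis using b by (intro span_base) auto
    next
      case False
      then show ?thesis using C(2)[of b] b gk by auto
    qed
  qed
  have "gspace v (Suc k) \<subseteq> ?S"
  proof
    fix y assume "y \<in> gspace v (Suc k)"
    then obtain p q where pq: "p \<in> low k" "q \<in> hdeg k" "y = ev v p + ev v q" by (rule gspace_Suc)
    obtain s t where st: "s \<in> theta_sums u n" "s \<in> hdeg k" "t \<in> mp.span B" "q = s + t"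
      using B[OF pq(2)] by auto
    have "ev v t \<in> ?S"
      using ev_span[OF st(3), of v] span_minimal[OF evB subspace_span] by auto
    moreover have "ev v s \<in> ?S" using ev_theta_sums[OF st(1,2)] gk by auto
    moreover have "ev v p \<in> ?S" using pq(1) gk by (auto simp: gspace_def)
    ultimately show "y \<in> ?S" by (simp add: pq(3) st(4) ev_add span_add)
  qed
  moreover have "finite C" using C(1) assms(2) by (rule finite_subset)
  ultimately have "dim (gspace v (Suc k)) \<le> card (BG \<union> ev v ` C)"
    using finBG by (intro dim_le_card) auto
  also have "\<dots> \<le> card BG + card C"
    using card_Un_le[of BG "ev v ` C"] card_image_le[OF \<open>finite C\<close>, of "ev v"] by linarith
  finally show ?thesis using BG(4) by simp
qed

lemma dim_gspace_le:
  assumes u: "flag n u"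
  shows "int (dim (gspace v (Suc k))) \<le> int (dim (gspace v k)) + hval k"
proof -
  obtain B where B: "finite B" "B \<subseteq> hdeg k" "int (card B) = hval k"
    "\<And>x. x \<in> hdeg k \<Longrightarrow> \<exists>s t. s \<in> theta_sums u n \<inter> hdeg k \<and> t \<in> mp.span B \<and> x = s + t"
    using hdeg_complement[OF u, of "{}" k] by metis
  have "dim (gspace v (Suc k)) \<le> dim (gspace v k) + card B"
    by (rule dim_gspace_step[OF B(2,1) subset_refl _ B(4)]) auto
  then show ?thesis using B(3) by linarith
qed

lemma dim_gspace:
  assumes v: "generic v" and "k \<le> Suc n"
  shows "int (dim (gspace v k)) = (\<Sum>i<k. hval i)"
proof -
  obtain u where u: "flag n u" using ex_flag by auto
  have upper: "int (dim (gspace v k)) \<le> (\<Sum>i<k. hval i)" for k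
  proof (induction k)
    case (Suc k)
    then show ?case using dim_gspace_le[OF u, of v k] by simp
  qed (simp add: gspace_0)
  \<comment> \<open>The growth from k on is bounded as well. \<open>gspace_top\<close> fixes the
    total at n + 1, so neither bound can be strict.\<close>
  have lower: "int (dim (gspace v (k + m))) \<le> int (dim (gspace v k)) + (\<Sum>i<m. hval (k + i))" for k m
  proof (induction m)
    case (Suc m)
    then show ?case using dim_gspace_le[OF u, of v "k + m"] by simp
  qed simp
  have "(\<Sum>i<Suc n. hval i) = int (card facets)"
    using sum_h_poly by (simp add: hval_def lessThan_Suc_atMost)
  then have "int (dim (gspace v (Suc n))) = (\<Sum>i<Suc n. hval i)"
    using gspace_top[OF v] dim_facet_space by simp
  moreover have "(\<Sum>i<Suc n. hval i) = (\<Sum>i<k. hval i) + (\<Sum>i<Suc n - k. hval (k + i))"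
    using \<open>k \<le> Suc n\<close> sum.nat_group[of hval] sum.atLeastLessThan_concat[of 0 k "Suc n" hval]
      sum.shift_bounds_nat_ivl[of hval 0 k "Suc n - k"]
    by (simp add: lessThan_atLeast0 add.commute)
  ultimately show ?thesis
    using upper[of k] lower[of k "Suc n - k"] \<open>k \<le> Suc n\<close> by simp
qed

text \<open>The associated graded ideal of the ideal of the points is the ideal generated by the linear forms.\<close>

lemma ev_leading_form:
  assumes u: "flag n u" and v: "generic v" and "k \<le> n" and a: "a \<in> hdeg k" "ev v a \<in> gspace v k"
  shows "a \<in> theta_sums u n"
proof (rule ccontr)
  assume "a \<notin> theta_sums u n"
  then have "{a} = {} \<or> (\<exists>a'. a' \<in> hdeg k \<and> a' \<notin> theta_sums u n \<and> {a} = {a'})" using a by auto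
  from hdeg_complement[OF u this] obtain B where B: "finite B" "B \<subseteq> hdeg k" "{a} \<subseteq> B" "int (card B) = hval k"
    "\<And>x. x \<in> hdeg k \<Longrightarrow> \<exists>s t. s \<in> theta_sums u n \<inter> hdeg k \<and> t \<in> mp.span B \<and> x = s + t"
    by metis
  \<comment> \<open>Since the values of a lie in \<open>gspace v k\<close>, it can be left out of
    the basis; the growth would then be smaller than \<open>hval k\<close>.\<close>
  have "dim (gspace v (Suc k)) \<le> dim (gspace v k) + card (B - {a})"
    by (rule dim_gspace_step[OF B(2,1) Diff_subset _ B(5)]) (use a in auto)
  moreover have "card B = Suc (card (B - {a}))" using B(3) by (intro card.remove[OF B(1)]) simp
  ultimately have "int (dim (gspace v (Suc k))) < int (dim (gspace v k)) + hval k" using B(4) by linarith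
  moreover have "int (dim (gspace v k)) = (\<Sum>i<k. hval i)" "int (dim (gspace v (Suc k))) = (\<Sum>i<Suc k. hval i)"
    using \<open>k \<le> n\<close> by (auto intro!: dim_gspace[OF v] simp del: sum.lessThan_Suc)
  ultimately show False by simp
qed

end

context multifan
begin

section \<open>The integration functional and its independence of v\<close>

text \<open>Coefficients of the multi-fan integral: by \<open>w_over_det\<close>, w(I) over |det|
  equals the orientation sign over the signed determinant.\<close>

definition wt :: "'a \<Rightarrow> 'v chain" where
  "wt v = (\<chi> I. if I \<in> facets then \<epsilon> $ I / (char_det e lam I * (\<Prod>i\<in>I. pt v I i)) else 0)"

definition lf :: "'a \<Rightarrow> 'v mpoly \<Rightarrow> real" where
  "lf v x = inner (wt v) (ev v x)"

lemma inner_chain: "inner (x :: 'v chain) y = (\<Sum>I\<in>UNIV. x $ I * y $ I)"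
  by (simp add: inner_vec_def)

lemma lf_sum_facets:
  "lf v x = (\<Sum>I\<in>facets. \<epsilon> $ I / (char_det e lam I * (\<Prod>i\<in>I. pt v I i)) * poly_eval (pt v I) x)"
  unfolding lf_def inner_chain
  by (rule sum.mono_neutral_cong_right) (auto simp: wt_def ev_nth)

lemma lf_add: "lf v (x + y) = lf v x + lf v y"
  by (simp add: lf_def ev_add inner_add_right)

lemma lf_const_mult: "lf v (const r * x) = r * lf v x"
  by (simp add: lf_def ev_const_mult)

lemma lf_sum: "lf v (sum f A) = (\<Sum>x\<in>A. lf v (f x))"
  by (simp add: lf_def ev_sum inner_sum_right)

lemma wt_nonzero: "generic v \<Longrightarrow> I \<in> facets \<Longrightarrow> wt v $ I \<noteq> 0"
  using eps_sq[of I] char_det_nonzero[of I] prod_pt_nonzero[of v I] by (auto simp: wt_def)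

lemma hval_0: "hval 0 = 1" and hval_n: "hval n = 1"
  using h_poly_coeff_0 dehn_sommerville[of 0] by (simp_all add: hval_def)

lemma sum_hval: "(\<Sum>i<Suc n. hval i) = int (card facets)"
  using sum_h_poly by (simp add: hval_def lessThan_Suc_atMost)

text \<open>A functional vanishing on the polynomials of degree less than \<open>n\<close> is, up to the
  normalising factors, a cycle: test it on the monomial of a ridge.  As the cycles are spanned
  by the orientation, it is a multiple of the integration functional.\<close>

lemma orthogonal_cycle:
  assumes \<psi>: "\<psi> \<in> facet_space" "\<And>y. y \<in> gspace v n \<Longrightarrow> inner \<psi> y = 0"
  defines "c \<equiv> (\<chi> I. \<psi> $ I * (\<Prod>i\<in>I. pt v I i) * char_det e lam I)"
  shows "boundary c = 0"
proof -
  have "boundary c $ J = 0" for J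
  proof (cases "Suc (card J) = n")
    case False
    then have "insert i J \<notin> facets" if "i \<notin> J" for i using that by (auto simp: facets_def)
    then show ?thesis using \<psi>(1)
      by (auto simp: boundary_nth c_def facet_space_def intro!: sum.neutral)
  next
    case True
    let ?N = "inner v (normal_vec e lam J)"
    let ?g = "\<lambda>I. \<psi> $ I * (\<Prod>k\<in>J. pt v I k)"
    \<comment> \<open>By \<open>pt_normal_vec\<close> all that depends on the added vertex combines
      to \<open>?N\<close>. The boundary at \<open>J\<close> becomes \<open>?N\<close> times the
      functional at the ridge monomial, which has degree n - 1.\<close>
    have tm: "sg i J * c $ insert i J = ?N * ?g (insert i J)" if "i \<notin> J" for i
    proof (cases "insert i J \<in> facets")
      case True
      show ?thesis
        unfolding pt_normal_vec[OF True that, symmetric] using that by (simp add: c_def)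
    next
      case False
      then show ?thesis using \<psi>(1) by (simp add: c_def facet_space_def)
    qed
    have g0: "?g I = 0" if "\<not> (J \<subseteq> I \<and> I \<in> facets)" for I
    proof (cases "I \<in> facets")
      case True
      then obtain k where "k \<in> J" "k \<notin> I" using \<open>\<not> (J \<subseteq> I \<and> I \<in> facets)\<close> by auto
      then have "(\<Prod>k\<in>J. pt v I k) = 0" by (intro prod_zero) (auto simp: pt_def)
      then show ?thesis by simp
    next
      case False
      then show ?thesis using \<psi>(1) by (simp add: facet_space_def)
    qed
    have "boundary c $ J = ?N * (\<Sum>i\<in>-J. ?g (insert i J))"
      by (simp add: boundary_nth tm sum_distrib_left)
    also have "(\<Sum>i\<in>-J. ?g (insert i J)) = sum ?g ((\<lambda>i. insert i J) ` (-J))"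
    proof -
      have "inj_on (\<lambda>i. insert i J) (-J)" by (auto simp: inj_on_def)
      then show ?thesis by (simp add: sum.reindex)
    qed
    also have "\<dots> = sum ?g UNIV"
    proof (rule sum.mono_neutral_left)
      show "\<forall>I\<in>UNIV - (\<lambda>i. insert i J) ` (-J). ?g I = 0"
      proof
        fix I assume I: "I \<in> UNIV - (\<lambda>i. insert i J) ` (-J)"
        have "\<not> (J \<subseteq> I \<and> I \<in> facets)"
        proof
          assume J: "J \<subseteq> I \<and> I \<in> facets"
          then have "card (I - J) = 1" using True facetD(2)[of I] by (simp add: card_Diff_subset)
          then obtain i where "I - J = {i}" by (auto simp: card_1_singleton_iff)
          then have "I = insert i J" "i \<notin> J" using J by auto
          then show False using I by auto
        qed
        then show "?g I = 0" by (rule g0)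
      qed
    qed auto
    also have "\<dots> = inner \<psi> (ev v (mono (expo J)))"
      unfolding inner_chain using \<psi>(1)
      by (intro sum.cong) (auto simp: ev_nth poly_eval_expo facet_space_def)
    also have "\<dots> = 0"
    proof (rule \<psi>(2))
      have "mono (expo J) \<in> low n"
        by (rule hdeg_low[OF hdeg_single]) (use True in \<open>auto simp: tdeg_expo\<close>)
      then show "ev v (mono (expo J)) \<in> gspace v n" by (simp add: gspace_def)
    qed
    finally show ?thesis by simp
  qed
  then show ?thesis by (simp add: Finite_Cartesian_Product.vec_eq_iff)
qed

text \<open>As h_n = 1, \<open>gspace v n\<close> is a hyperplane of \<open>facet_space\<close>, so
  a nonzero functional kills it. Its cycle is a multiple of the orientation, which makes it a
  nonzero multiple of \<open>wt v\<close>.\<close>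

lemma wt_orthogonal:
  assumes v: "generic v" and y: "y \<in> gspace v n"
  shows "inner (wt v) y = 0"
proof -
  have "int (dim (gspace v n)) < int (dim facet_space)"
    using dim_gspace[OF v, of n] sum_hval hval_n by (simp add: dim_facet_space)
  then have "gspace v n \<noteq> facet_space" by auto
  then have "span (gspace v n) \<subset> span facet_space"
    using gspace_subset[of v n]
    by (simp add: span_eq_iff[THEN iffD2, OF subspace_gspace] span_eq_iff[THEN iffD2, OF subspace_facet_space]
        psubset_eq)
  then have "\<exists>\<psi>. \<psi> \<noteq> 0 \<and> \<psi> \<in> span facet_space \<and> (\<forall>y\<in>span (gspace v n). inner \<psi> y = 0)"
    by (rule orthogonal_to_subspace_exists_gen) (auto simp: Linear_Algebra.orthogonal_def)
  then obtain \<psi> where \<psi>: "\<psi> \<noteq> 0" "\<psi> \<in> span facet_space"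
    "\<forall>y\<in>span (gspace v n). inner \<psi> y = 0" by (elim exE conjE)
  have \<psi>F: "\<psi> \<in> facet_space"
    using \<psi>(2) by (simp add: span_eq_iff[THEN iffD2, OF subspace_facet_space])
  have \<psi>0: "inner \<psi> y = 0" if "y \<in> gspace v n" for y
    using \<psi>(3) span_base[OF that] by (rule bspec)
  define c where "c = (\<chi> I. \<psi> $ I * (\<Prod>i\<in>I. pt v I i) * char_det e lam I)"
  have "boundary c = 0" unfolding c_def by (rule orthogonal_cycle[OF \<psi>F \<psi>0])
  moreover have "c $ I = 0" if "I \<notin> facets" for I
    using that \<psi>F by (simp add: c_def facet_space_def)
  ultimately have "c \<in> star_cycles K {} n"
    by (auto simp: star_cycles_def star_chains_def star_boundary_nth facets_def
        Finite_Cartesian_Product.vec_eq_iff)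
  then obtain r where r: "c = r *\<^sub>R star_eps {}"
    using star_cycles_top[OF sphere card_face_le empty_face _ star_eps_cycle star_eps_nonzero[OF empty_face]]
    by blast
  have \<psi>w: "\<psi> $ I = r * wt v $ I" for I
  proof (cases "I \<in> facets")
    case True
    have "\<psi> $ I * (\<Prod>i\<in>I. pt v I i) * char_det e lam I = r * \<epsilon> $ I"
      using arg_cong[OF r, of "\<lambda>x. x $ I"] by (simp add: c_def star_eps_def)
    then show ?thesis
      using True prod_pt_nonzero[OF v True] char_det_nonzero[OF True] by (simp add: wt_def field_simps)
  next
    case False
    then show ?thesis using \<psi>F by (simp add: facet_space_def wt_def)
  qed
  have "\<psi> = r *\<^sub>R wt v" by (simp add: Finite_Cartesian_Product.vec_eq_iff \<psi>w)
  moreover from this have "r \<noteq> 0" using \<psi>(1) by auto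
  ultimately show ?thesis using \<psi>0[OF y] by simp
qed

lemma lf_low: "generic v \<Longrightarrow> p \<in> low n \<Longrightarrow> lf v p = 0"
  unfolding lf_def by (rule wt_orthogonal) (auto simp: gspace_def)

lemma lf_theta_sums:
  assumes "generic v" "x \<in> theta_sums u m" "x \<in> hdeg n"
  shows "lf v x = 0"
  unfolding lf_def by (rule wt_orthogonal[OF assms(1) ev_theta_sums[OF assms(2,3)]])

text \<open>Only the term of \<open>I\<close> survives and its factors in v cancel; this nonzero
  value normalises the integral.\<close>

lemma lf_facet:
  assumes "generic v" "I \<in> facets"
  shows "lf v (mono (expo I)) = \<epsilon> $ I / char_det e lam I"
proof -
  have "(\<Prod>i\<in>I. pt v I' i) = 0" if "I' \<in> facets - {I}" for I'
  proof -
    have "\<not> I \<subseteq> I'" using facet_eq[OF assms(2), of I'] that by auto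
    then obtain i where "i \<in> I" "i \<notin> I'" by auto
    then show ?thesis by (intro prod_zero) (auto simp: pt_def)
  qed
  then have "lf v (mono (expo I)) = (\<Sum>I'\<in>{I}. \<epsilon> $ I' / (char_det e lam I' * (\<Prod>i\<in>I'. pt v I' i)) * (\<Prod>i\<in>I. pt v I' i))"
    unfolding lf_sum_facets poly_eval_expo
    by (intro sum.mono_neutral_right) (use assms(2) in auto)
  then show ?thesis using prod_pt_nonzero[OF assms] by simp
qed

text \<open>Modulo the ideal, which \<open>lf v\<close> and \<open>lf v'\<close> both kill in degree
  n, the forms of degree n are multiples of one facet monomial, and there the value is free of
  v.\<close>

lemma lf_independent:
  assumes v: "generic v" "generic v'" and x: "x \<in> hdeg n"
  shows "lf v x = lf v' x"
proof -
  obtain u where u: "flag n u" using ex_flag by auto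
  obtain I where I: "I \<in> facets" using ex_facet[OF empty_face] by auto
  let ?m = "mono (expo I)"
  have m: "?m \<in> hdeg n" by (rule hdeg_single) (simp add: tdeg_expo facetD(2)[OF I])
  have "?m \<notin> theta_sums u n"
    using lf_theta_sums[OF v(1) _ m] lf_facet[OF v(1) I] eps_sq[OF I] char_det_nonzero[OF I] by auto
  then have "{?m} = {} \<or> (\<exists>a. a \<in> hdeg n \<and> a \<notin> theta_sums u n \<and> {?m} = {a})" using m by auto
  from hdeg_complement[OF u this] obtain B where B: "finite B" "{?m} \<subseteq> B" "int (card B) = hval n"
    "\<And>x. x \<in> hdeg n \<Longrightarrow> \<exists>s t. s \<in> theta_sums u n \<inter> hdeg n \<and> t \<in> mp.span B \<and> x = s + t"
    by metis
  have "card B = 1" using B(3) hval_n by simp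
  then have "B = {?m}" using B(2) by (auto simp: card_1_singleton_iff)
  then obtain s t where st: "s \<in> theta_sums u n" "s \<in> hdeg n" "t \<in> mp.span {?m}" "x = s + t"
    using B(4)[OF x] by auto
  obtain r where "t = const r * ?m" using st(3) unfolding mp.span_singleton by auto
  then show ?thesis
    using st lf_theta_sums[OF v(1) st(1,2)] lf_theta_sums[OF v(2) st(1,2)] lf_facet[OF v(1) I] lf_facet[OF v(2) I]
    by (simp add: lf_add lf_const_mult)
qed

section \<open>The pairing on functions and the annihilator of the integral\<close>

text \<open>Turns the standard inner product into the bilinear form sending p and q to
  \<open>lf v (p * q)\<close>; for generic v the weights have no zeros on the facets.\<close>

definition wt_mult :: "'a \<Rightarrow> 'v chain \<Rightarrow> 'v chain" where
  "wt_mult v y = (\<chi> I. wt v $ I * y $ I)"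

lemma linear_wt_mult: "linear (wt_mult v)"
  by (intro linearI) (simp_all add: Finite_Cartesian_Product.vec_eq_iff wt_mult_def distrib_left)

lemma inner_wt_mult: "inner (wt_mult v (ev v p)) (ev v q) = lf v (p * q)"
  unfolding lf_def inner_chain
  by (rule sum.cong) (auto simp: wt_mult_def ev_nth eval.subst_mult)

lemma inj_wt_mult:
  assumes "generic v" "x \<in> facet_space" "wt_mult v x = 0"
  shows "x = 0"
proof -
  have "x $ I = 0" for I
  proof (cases "I \<in> facets")
    case True
    have "wt v $ I * x $ I = 0" using arg_cong[OF assms(3), of "\<lambda>y. y $ I"] by (simp add: wt_mult_def)
    then show ?thesis using wt_nonzero[OF assms(1) True] by simp
  next
    case False
    then show ?thesis using assms(2) by (simp add: facet_space_def)
  qed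
  then show ?thesis by (simp add: Finite_Cartesian_Product.vec_eq_iff)
qed

text \<open>In view of \<open>dim_gspace\<close>: complementary steps of the filtration have
  dimensions adding up to the number of facets.\<close>

lemma sum_hval_symmetric:
  assumes "j \<le> n"
  shows "(\<Sum>i<j. hval i) + (\<Sum>i<Suc n - j. hval i) = (\<Sum>i<Suc n. hval i)"
proof -
  have "(\<Sum>i<j. hval i) = (\<Sum>i\<in>{Suc n - j..<Suc n}. hval i)"
  proof (rule sum.reindex_bij_witness[of _ "\<lambda>i. n - i" "\<lambda>i. n - i"])
    show "hval (n - i) = hval i" if "i \<in> {..<j}" for i
      using dehn_sommerville[of i] that assms by (simp add: hval_def)
  qed (use assms in auto)
  then show ?thesis
    using sum.atLeastLessThan_concat[of 0 "Suc n - j" "Suc n" hval]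
    by (simp add: lessThan_atLeast0 add.commute)
qed

text \<open>The weighted \<open>gspace v j\<close> is orthogonal to
  \<open>gspace v (Suc n - j)\<close> since products have degree below n, and by dimension it is the
  whole complement. So D has the values of a polynomial of degree below j, and
  \<open>ev_leading_form\<close> puts it into the ideal.\<close>

lemma pairing_nondegenerate:
  assumes u: "flag n u" and v: "generic v" and "j \<le> n" and D: "D \<in> hdeg j"
    and pair: "\<And>x. x \<in> hdeg (n - j) \<Longrightarrow> lf v (D * x) = 0"
  shows "D \<in> theta_sums u n"
proof -
  let ?A = "gspace v (Suc n - j)"
  let ?P = "{y \<in> facet_space. \<forall>x\<in>?A. Linear_Algebra.orthogonal x y}"
  have subP: "subspace ?P"
    using subspace_facet_space by (auto simp: subspace_def Linear_Algebra.orthogonal_def inner_add_right)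
  have wtF: "wt_mult v y \<in> facet_space" for y
    by (auto simp: facet_space_def wt_mult_def wt_def)
  have orth: "wt_mult v (ev v p) \<in> ?P" if "\<And>q. q \<in> low (Suc n - j) \<Longrightarrow> lf v (p * q) = 0" for p
  proof -
    have "inner (ev v q) (wt_mult v (ev v p)) = 0" if "q \<in> low (Suc n - j)" for q
      by (subst inner_commute) (simp add: inner_wt_mult \<open>\<And>q. q \<in> low (Suc n - j) \<Longrightarrow> lf v (p * q) = 0\<close> that)
    then show ?thesis using wtF by (auto simp: gspace_def Linear_Algebra.orthogonal_def)
  qed
  have sub: "wt_mult v ` gspace v j \<subseteq> ?P"
  proof
    fix y assume "y \<in> wt_mult v ` gspace v j"
    then obtain p where p: "p \<in> low j" "y = wt_mult v (ev v p)" by (auto simp: gspace_def)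
    have "lf v (p * q) = 0" if "q \<in> low (Suc n - j)" for q
      using low_mult[OF p(1) that, of n] \<open>j \<le> n\<close> by (intro lf_low[OF v]) simp
    then show "y \<in> ?P" unfolding p(2) by (rule orth)
  qed
  have "dim (wt_mult v ` gspace v j) = dim (gspace v j)"
  proof -
    have "{x \<in> gspace v j. wt_mult v x = 0} = {0}"
      using inj_wt_mult[OF v] gspace_subset[of v j] subspace_0[OF subspace_gspace] linear_0[OF linear_wt_mult]
      by auto
    then show ?thesis using dim_ker_image[OF linear_wt_mult[of v] subspace_gspace[of v j]] by simp
  qed
  moreover have "dim ?P + dim ?A = dim facet_space"
    by (rule dim_subspace_orthogonal_to_vectors[OF subspace_gspace subspace_facet_space gspace_subset])
  moreover have "int (dim ?A) + int (dim (gspace v j)) = int (dim facet_space)"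
    using dim_gspace[OF v, of j] dim_gspace[OF v, of "Suc n - j"] sum_hval_symmetric[OF \<open>j \<le> n\<close>] sum_hval \<open>j \<le> n\<close>
    by (simp add: dim_facet_space)
  ultimately have "dim ?P \<le> dim (wt_mult v ` gspace v j)" by linarith
  then have eq: "wt_mult v ` gspace v j = ?P"
    using subspace_dim_equal[OF linear_subspace_image[OF linear_wt_mult subspace_gspace] subP sub] by simp
  have "wt_mult v (ev v D) \<in> wt_mult v ` gspace v j"
    unfolding eq
  proof (rule orth)
    \<comment> \<open>The hypothesis covers the component of q of degree n - j; the lower terms
      times D have degree below n and integrate to 0.\<close>
    fix q :: "'v mpoly" assume q: "q \<in> low (Suc n - j)"
    then have q': "q - hcomp (n - j) q \<in> low (n - j)"
      using low_Suc_decomp[of q "n - j"] \<open>j \<le> n\<close> by (simp add: Suc_diff_le)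
    have "D \<in> low (Suc j)" by (rule hdeg_low[OF D]) simp
    then have "D * (q - hcomp (n - j) q) \<in> low n" using low_mult[OF _ q', of D "Suc j" n] \<open>j \<le> n\<close> by simp
    then have "lf v (D * (q - hcomp (n - j) q) + D * hcomp (n - j) q) = 0"
      using lf_low[OF v] pair[OF hcomp_hdeg] by (simp add: lf_add)
    then show "lf v (D * q) = 0" by (simp add: right_diff_distrib)
  qed
  then obtain y where y: "y \<in> gspace v j" "wt_mult v (ev v D) = wt_mult v y" by auto
  have "ev v D - y = 0"
  proof (rule inj_wt_mult[OF v])
    show "ev v D - y \<in> facet_space"
      using ev_facet_space y(1) gspace_subset subspace_diff[OF subspace_facet_space] by blast
    show "wt_mult v (ev v D - y) = 0" by (simp add: linear_diff[OF linear_wt_mult] y(2))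
  qed
  then show ?thesis using ev_leading_form[OF u v \<open>j \<le> n\<close> D] y(1) by simp
qed

text \<open>\<open>hval k\<close> vanishes above n, leaving no room for a form outside the
  ideal.\<close>

lemma hdeg_high_subset:
  assumes u: "flag n u" and "n < k" and "x \<in> hdeg k"
  shows "x \<in> theta_sums u n"
proof (rule ccontr)
  assume "x \<notin> theta_sums u n"
  then have "{x} = {} \<or> (\<exists>a. a \<in> hdeg k \<and> a \<notin> theta_sums u n \<and> {x} = {a})" using assms by auto
  from hdeg_complement[OF u this] obtain B where "finite B" "{x} \<subseteq> B" "int (card B) = hval k" by metis
  moreover have "hval k = 0" unfolding hval_def by (rule degree_h_poly[OF \<open>n < k\<close>])
  ultimately show False by auto
qed

definition v0 :: 'a where "v0 = (SOME v. generic v)"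

lemma generic_v0: "generic v0"
  unfolding v0_def by (rule someI_ex[OF ex_generic_point])

text \<open>Extended by 0 to the other degrees, so that annihilators can be tested against arbitrary
  polynomials.\<close>

definition top_integral :: "'v mpoly \<Rightarrow> real" where
  "top_integral x = lf v0 (hcomp n x)"

lemma top_integral_sum: "top_integral (sum f A) = (\<Sum>x\<in>A. top_integral (f x))"
  by (simp add: top_integral_def restr_sum lf_sum)

lemma top_integral_const_mult: "top_integral (const r * x) = r * top_integral x"
  by (simp add: top_integral_def restr_const_mult lf_const_mult)

lemma theta_sums_sum: "(\<And>x. x \<in> A \<Longrightarrow> f x \<in> theta_sums u k) \<Longrightarrow> sum f A \<in> theta_sums u k"
  by (induction A rule: infinite_finite_induct) (auto simp: theta_sums_0 theta_sums_add)

lemma annihilator_eq: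
  assumes u: "flag n u"
  shows "(\<forall>x. top_integral (D * x) = 0) \<longleftrightarrow> D \<in> theta_sums u n"
proof
  assume "D \<in> theta_sums u n"
  then have mem: "hcomp n (D * x) \<in> theta_sums u n" for x
    using theta_sums_hcomp[OF theta_sums_mult] by (simp add: mult.commute)
  show "\<forall>x. top_integral (D * x) = 0"
    unfolding top_integral_def by (intro allI lf_theta_sums[OF generic_v0 mem hcomp_hdeg])
next
  assume D: "\<forall>x. top_integral (D * x) = 0"
  have "hcomp j D \<in> theta_sums u n" for j
  proof (cases "j \<le> n")
    case True
    show ?thesis
    proof (rule pairing_nondegenerate[OF u generic_v0 True hcomp_hdeg])
      fix x :: "'v mpoly" assume x: "x \<in> hdeg (n - j)"
      \<comment> \<open>D may be inhomogeneous; a test form of degree n - j isolates its component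
        of degree j.\<close>
      have "hcomp n (D * x) = hcomp j D * x"
        using hcomp_mult_hdeg[OF x, of j D] True by (simp add: mult.commute)
      then show "lf v0 (hcomp j D * x) = 0" using spec[OF D, of x] by (simp add: top_integral_def)
    qed
  next
    case False
    then show ?thesis by (intro hdeg_high_subset[OF u _ hcomp_hdeg]) simp
  qed
  moreover obtain N where "D = (\<Sum>d\<le>N. hcomp d D)" using ex_sum_hcomp by blast
  ultimately show "D \<in> theta_sums u n" using theta_sums_sum[of "{..N}" "\<lambda>d. hcomp d D" u n] by simp
qed

end

section \<open>The volume polynomial\<close>

lemma lkp_var_mult:
  "lkp (var i * q) \<gamma> = (if lkp \<gamma> i = 0 then 0 else lkp q (\<gamma> - Poly_Mapping.single i 1))"
proof (induction q rule: mpoly_induct)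
  case (single \<alpha> c)
  have "Poly_Mapping.single i 1 + \<alpha> = \<gamma> \<longleftrightarrow> lkp \<gamma> i \<noteq> 0 \<and> \<alpha> = \<gamma> - Poly_Mapping.single i 1"
  proof
    assume "lkp \<gamma> i \<noteq> 0 \<and> \<alpha> = \<gamma> - Poly_Mapping.single i 1"
    then show "Poly_Mapping.single i 1 + \<alpha> = \<gamma>"
      by (intro poly_mapping_eqI) (auto simp: lookup_add lookup_minus lookup_single when_def)
  qed (auto simp: lookup_add)
  then show ?case by (auto simp: var_def mult_single lookup_single when_def)
qed (simp add: distrib_left lookup_add)

text \<open>Coefficient of a monomial in the exponential series of the linear form with coefficients
  c.\<close>

definition exp_coeff :: "('v::finite \<Rightarrow> real) \<Rightarrow> ('v \<Rightarrow>\<^sub>0 nat) \<Rightarrow> real" where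
  "exp_coeff c \<alpha> = (\<Prod>i\<in>UNIV. c i ^ lkp \<alpha> i / fact (lkp \<alpha> i))"

lemma exp_coeff_step:
  assumes "lkp \<gamma> i \<noteq> 0"
  shows "c i * exp_coeff c (\<gamma> - Poly_Mapping.single i 1) = lkp \<gamma> i * exp_coeff c \<gamma>"
proof -
  obtain k where k: "lkp \<gamma> i = Suc k" using assms not0_implies_Suc by blast
  have a1: "exp_coeff c (\<gamma> - Poly_Mapping.single i 1)
      = (c i ^ k / fact k) * (\<Prod>j\<in>UNIV - {i}. c j ^ lkp \<gamma> j / fact (lkp \<gamma> j))"
    unfolding exp_coeff_def
    by (subst prod.remove[of UNIV i])
      (auto simp: k lookup_minus lookup_single when_def intro!: prod.cong)
  have a2: "exp_coeff c \<gamma>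
      = (c i ^ Suc k / fact (Suc k)) * (\<Prod>j\<in>UNIV - {i}. c j ^ lkp \<gamma> j / fact (lkp \<gamma> j))"
    unfolding exp_coeff_def by (subst prod.remove[of UNIV i]) (auto simp: k)
  have f: "real (Suc k) * (c i ^ Suc k / fact (Suc k)) = c i * (c i ^ k / fact k)"
    by (simp del: of_nat_Suc)
  show ?thesis unfolding a1 a2 k by (simp only: mult.assoc[symmetric] f)
qed

text \<open>The multinomial theorem. In the induction the i-th summand carries the factor
  \<open>lkp \<gamma> i\<close>, and these factors add up to d + 1.\<close>

lemma lkp_linear_power:
  fixes c :: "'v::finite \<Rightarrow> real"
  shows "lkp ((\<Sum>i\<in>UNIV. const (c i) * var i) ^ d) \<gamma> = (if tdeg \<gamma> = d then fact d * exp_coeff c \<gamma> else 0)"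
proof (induction d arbitrary: \<gamma>)
  case 0
  have "\<gamma> = 0" if "tdeg \<gamma> = 0"
    using that by (intro poly_mapping_eqI) (simp add: tdeg_def)
  moreover have "exp_coeff c 0 = 1" by (simp add: exp_coeff_def)
  ultimately show ?case by (auto simp: lookup_one when_def)
next
  case (Suc d)
  let ?s = "\<Sum>i\<in>UNIV. const (c i) * var i"
  have t: "tdeg \<gamma> = Suc (tdeg (\<gamma> - Poly_Mapping.single i 1))" if "lkp \<gamma> i \<noteq> 0" for i
  proof -
    have "\<gamma> = (\<gamma> - Poly_Mapping.single i 1) + Poly_Mapping.single i 1"
      using that by (intro poly_mapping_eqI) (auto simp: lookup_add lookup_minus lookup_single when_def)
    then have "tdeg \<gamma> = tdeg (\<gamma> - Poly_Mapping.single i 1) + tdeg (Poly_Mapping.single i (1::nat))"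
      by (metis tdeg_add)
    then show ?thesis by simp
  qed
  have "lkp (?s ^ Suc d) \<gamma> = (\<Sum>i\<in>UNIV. c i * lkp (var i * ?s ^ d) \<gamma>)"
    by (simp add: sum_distrib_right lookup_sum mult.assoc)
  also have "\<dots> = (\<Sum>i\<in>UNIV. if tdeg \<gamma> = Suc d then lkp \<gamma> i * (fact d * exp_coeff c \<gamma>) else 0)"
  proof (rule sum.cong[OF refl])
    fix i
    show "c i * lkp (var i * ?s ^ d) \<gamma> = (if tdeg \<gamma> = Suc d then lkp \<gamma> i * (fact d * exp_coeff c \<gamma>) else 0)"
    proof (cases "lkp \<gamma> i = 0")
      case False
      have "c i * (fact d * exp_coeff c (\<gamma> - Poly_Mapping.single i 1)) = lkp \<gamma> i * (fact d * exp_coeff c \<gamma>)"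
        using exp_coeff_step[OF False, of c] by (metis mult.left_commute)
      then show ?thesis using False t[OF False] by (simp add: lkp_var_mult Suc)
    qed (simp add: lkp_var_mult)
  qed
  also have "\<dots> = (if tdeg \<gamma> = Suc d then fact (Suc d) * exp_coeff c \<gamma> else 0)"
  proof (cases "tdeg \<gamma> = Suc d")
    case True
    have "(\<Sum>i\<in>UNIV. real (lkp \<gamma> i) * (fact d * exp_coeff c \<gamma>)) = real (tdeg \<gamma>) * (fact d * exp_coeff c \<gamma>)"
      by (simp add: tdeg_def sum_distrib_right)
    then show ?thesis using True by simp
  qed simp
  finally show ?case .
qed

text \<open>Eliminates one variable at a time, using the univariate result.\<close>

lemma poly_eval_zero_imp_zero:
  fixes p :: "'v::finite mpoly"
  assumes "\<And>c. poly_eval c p = 0"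
  shows "p = 0"
proof -
  have "p = 0" if "finite S" "\<And>\<alpha>. \<alpha> \<in> Poly_Mapping.keys p \<Longrightarrow> supp \<alpha> \<subseteq> S" "\<And>c. poly_eval c p = 0"
    for S and p :: "'v mpoly"
    using that
  proof (induction S arbitrary: p rule: finite_induct)
    case empty
    have e: "p = const (lkp p 0)"
    proof (rule poly_mapping_eqI)
      fix \<alpha>
      show "lkp p \<alpha> = lkp (const (lkp p 0)) \<alpha>"
        using empty(1)[of \<alpha>] by (auto simp: const_def lookup_single when_def in_keys_iff)
    qed
    have "poly_eval (\<lambda>_. 0) p = lkp p 0" by (subst e) (rule eval.subst_const)
    then have "lkp p 0 = 0" using empty(2) by simp
    then show ?case by (subst e) simp
  next
    case (insert i S)
    \<comment> \<open>The coefficient of the k-th power of x_i, a polynomial in the remaining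
      variables.\<close>
    define q where "q k = (\<Sum>\<alpha>\<in>{\<alpha>\<in>Poly_Mapping.keys p. lkp \<alpha> i = k}.
        Poly_Mapping.single (\<alpha> - Poly_Mapping.single i k) (lkp p \<alpha>))" for k
    define N where "N = Max (insert 0 ((\<lambda>\<alpha>. lkp \<alpha> i) ` Poly_Mapping.keys p))"
    have N: "lkp \<alpha> i \<le> N" if "\<alpha> \<in> Poly_Mapping.keys p" for \<alpha>
      unfolding N_def using that by (intro Max_ge) auto
    have red: "(\<Prod>j\<in>UNIV. c j ^ lkp \<alpha> j) = c i ^ lkp \<alpha> i * (\<Prod>j\<in>UNIV. c j ^ lkp (\<alpha> - Poly_Mapping.single i (lkp \<alpha> i)) j)"
      for \<alpha> and c :: "'v \<Rightarrow> real"
    proof -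
      have "(\<Prod>j\<in>UNIV. c j ^ lkp (\<alpha> - Poly_Mapping.single i (lkp \<alpha> i)) j) = (\<Prod>j\<in>UNIV - {i}. c j ^ lkp \<alpha> j)"
        by (subst prod.remove[of UNIV i]) (auto simp: lookup_minus lookup_single when_def intro!: prod.cong)
      then show ?thesis by (simp only:) (rule prod.remove, auto)
    qed
    have pe: "poly_eval c p = (\<Sum>k\<le>N. poly_eval c (q k) * c i ^ k)" for c
    proof -
      have "poly_eval c p = (\<Sum>\<alpha>\<in>Poly_Mapping.keys p. lkp p \<alpha> * (\<Prod>j\<in>UNIV. c j ^ lkp \<alpha> j))"
        by (simp add: poly_eval_def)
      also have "\<dots> = (\<Sum>k\<le>N. \<Sum>\<alpha>\<in>{\<alpha>\<in>Poly_Mapping.keys p. lkp \<alpha> i = k}. lkp p \<alpha> * (\<Prod>j\<in>UNIV. c j ^ lkp \<alpha> j))"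
        using N by (intro sum.group[symmetric]) auto
      also have "\<dots> = (\<Sum>k\<le>N. poly_eval c (q k) * c i ^ k)"
      proof (rule sum.cong[OF refl])
        fix k
        have "lkp p \<alpha> * (\<Prod>j\<in>UNIV. c j ^ lkp \<alpha> j)
            = lkp p \<alpha> * (\<Prod>j\<in>UNIV. c j ^ lkp (\<alpha> - Poly_Mapping.single i k) j) * c i ^ k"
          if "\<alpha> \<in> {\<alpha>\<in>Poly_Mapping.keys p. lkp \<alpha> i = k}" for \<alpha>
          using that red[of c \<alpha>] by simp
        then have "(\<Sum>\<alpha>\<in>{\<alpha>\<in>Poly_Mapping.keys p. lkp \<alpha> i = k}. lkp p \<alpha> * (\<Prod>j\<in>UNIV. c j ^ lkp \<alpha> j))
            = (\<Sum>\<alpha>\<in>{\<alpha>\<in>Poly_Mapping.keys p. lkp \<alpha> i = k}.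
                lkp p \<alpha> * (\<Prod>j\<in>UNIV. c j ^ lkp (\<alpha> - Poly_Mapping.single i k) j) * c i ^ k)"
          by (rule sum.cong[OF refl])
        then show "(\<Sum>\<alpha>\<in>{\<alpha>\<in>Poly_Mapping.keys p. lkp \<alpha> i = k}. lkp p \<alpha> * (\<Prod>j\<in>UNIV. c j ^ lkp \<alpha> j))
            = poly_eval c (q k) * c i ^ k"
          by (simp only: q_def eval.subst_sum eval.subst_single sum_distrib_right)
      qed
      finally show ?thesis .
    qed
    have supp_q: "supp \<beta> \<subseteq> S" if \<beta>: "\<beta> \<in> Poly_Mapping.keys (q k)" for \<beta> k
    proof -
      from subsetD[OF keys_sum_subset \<beta>[unfolded q_def]] obtain \<alpha> where
        \<alpha>: "\<alpha> \<in> Poly_Mapping.keys p" "lkp \<alpha> i = k" "\<beta> = \<alpha> - Poly_Mapping.single i k"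
        by (auto split: if_splits)
      show ?thesis
      proof
        fix x assume "x \<in> supp \<beta>"
        then have x: "lkp \<alpha> x - lkp (Poly_Mapping.single i k) x \<noteq> 0"
          by (simp add: \<alpha>(3) in_keys_iff lookup_minus)
        then have "x \<noteq> i" using \<alpha>(2) by auto
        moreover have "x \<in> supp \<alpha>" using x by (auto simp: in_keys_iff)
        ultimately show "x \<in> S" using insert(4)[OF \<alpha>(1)] by auto
      qed
    qed
    have eq: "poly_eval c (q k) = poly_eval (c(i := t)) (q k)" for c k t
    proof -
      have "(\<Prod>j\<in>UNIV. c j ^ lkp \<beta> j) = (\<Prod>j\<in>UNIV. (c(i := t)) j ^ lkp \<beta> j)"
        if "\<beta> \<in> Poly_Mapping.keys (q k)" for \<beta>
      proof -
        have "lkp \<beta> i = 0" using supp_q[OF that] insert(2) by (auto simp: in_keys_iff)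
        then show ?thesis by (intro prod.cong) auto
      qed
      then show ?thesis by (simp add: poly_eval_def)
    qed
    have q0: "q k = 0" for k
    proof (rule insert.IH)
      show "supp \<beta> \<subseteq> S" if "\<beta> \<in> Poly_Mapping.keys (q k)" for \<beta> using supp_q[OF that] .
      show "poly_eval c (q k) = 0" for c
      proof (cases "k \<le> N")
        case True
        have "(\<Sum>k\<le>N. poly_eval c (q k) * t ^ k) = 0" for t
          using pe[of "c(i := t)"] insert.prems(2)[of "c(i := t)"] by (simp add: eq[of c _ t])
        then show ?thesis using polyfun_eq_0[of "\<lambda>k. poly_eval c (q k)" N] True by auto
      next
        case False
        then have "{\<alpha>\<in>Poly_Mapping.keys p. lkp \<alpha> i = k} = {}" using N by auto
        then show ?thesis unfolding q_def by (simp add: eval.subst_0 del: Collect_empty_eq)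
      qed
    qed
    show ?case
    proof (rule poly_mapping_eqI)
      fix \<alpha> :: "'v \<Rightarrow>\<^sub>0 nat"
      let ?k = "lkp \<alpha> i"
      have "lkp (q ?k) (\<alpha> - Poly_Mapping.single i ?k) = lkp p \<alpha>"
      proof -
        \<comment> \<open>Among exponents with equal i-entry, erasing that entry is injective; so
          each coefficient of p reappears unchanged in one of the q.\<close>
        have inj: "\<alpha>' = \<alpha>" if "lkp \<alpha>' i = ?k" "\<alpha>' - Poly_Mapping.single i ?k = \<alpha> - Poly_Mapping.single i ?k" for \<alpha>'
        proof (rule poly_mapping_eqI)
          fix j
          show "lkp \<alpha>' j = lkp \<alpha> j"
            using that(1) arg_cong[OF that(2), of "\<lambda>x. lkp x j"]
            by (cases "j = i") (auto simp: lookup_minus lookup_single when_def)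
        qed
        have "lkp (q ?k) (\<alpha> - Poly_Mapping.single i ?k)
            = (\<Sum>\<alpha>'\<in>{\<alpha>'\<in>Poly_Mapping.keys p. lkp \<alpha>' i = ?k}. if \<alpha>' = \<alpha> then lkp p \<alpha>' else 0)"
          unfolding q_def lookup_sum using inj
          by (intro sum.cong) (auto simp: lookup_single when_def)
        then show ?thesis by (auto simp: in_keys_iff)
      qed
      then show "lkp p \<alpha> = lkp 0 \<alpha>" by (simp add: q0)
    qed
  qed
  from this[of UNIV p] show ?thesis using assms by auto
qed

section \<open>Differential operators in terms of coefficients\<close>

lemma lkp_partial: "lkp (partial i p) \<gamma> = (real (lkp \<gamma> i) + 1) * lkp p (\<gamma> + Poly_Mapping.single i 1)"
proof -
  let ?e = "Poly_Mapping.single i (1::nat)"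
  \<comment> \<open>Subtraction of exponents truncates, leaving a monomial without x_i in place; its
    factor \<open>lkp \<alpha> i\<close> is 0, so it never counts.\<close>
  have eq: "(\<alpha> - ?e = \<gamma> \<and> lkp \<alpha> i \<noteq> 0) \<longleftrightarrow> \<alpha> = \<gamma> + ?e" for \<alpha>
  proof
    assume a: "\<alpha> - ?e = \<gamma> \<and> lkp \<alpha> i \<noteq> 0"
    show "\<alpha> = \<gamma> + ?e"
      unfolding conjunct1[OF a, symmetric] using a
      by (intro poly_mapping_eqI) (auto simp: lookup_add lookup_minus lookup_single when_def)
  qed (auto simp: lookup_add)
  have "lkp (partial i p) \<gamma> = (\<Sum>\<alpha>\<in>Poly_Mapping.keys p. if \<alpha> - ?e = \<gamma> then real (lkp \<alpha> i) * lkp p \<alpha> else 0)"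
    by (simp add: partial_def lookup_sum lookup_single when_def)
  also have "\<dots> = (\<Sum>\<alpha>\<in>Poly_Mapping.keys p. if \<alpha> = \<gamma> + ?e then real (lkp \<alpha> i) * lkp p \<alpha> else 0)"
  proof (rule sum.cong[OF refl])
    fix \<alpha>
    show "(if \<alpha> - ?e = \<gamma> then real (lkp \<alpha> i) * lkp p \<alpha> else 0) = (if \<alpha> = \<gamma> + ?e then real (lkp \<alpha> i) * lkp p \<alpha> else 0)"
      using eq[of \<alpha>] by (cases "lkp \<alpha> i = 0") auto
  qed
  also have "\<dots> = (real (lkp \<gamma> i) + 1) * lkp p (\<gamma> + ?e)"
    by (auto simp: in_keys_iff lookup_add)
  finally show ?thesis .
qed

lemma lkp_partial_power:
  "lkp ((partial i ^^ k) p) \<gamma> * fact (lkp \<gamma> i) = fact (lkp \<gamma> i + k) * lkp p (\<gamma> + Poly_Mapping.single i k)"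
proof (induction k arbitrary: \<gamma>)
  case (Suc k)
  have "lkp ((partial i ^^ Suc k) p) \<gamma> * fact (lkp \<gamma> i)
      = lkp ((partial i ^^ k) p) (\<gamma> + Poly_Mapping.single i 1) * fact (lkp (\<gamma> + Poly_Mapping.single i 1) i)"
    by (simp add: lkp_partial lookup_add algebra_simps)
  also have "\<dots> = fact (lkp \<gamma> i + Suc k) * lkp p (\<gamma> + Poly_Mapping.single i (Suc k))"
    unfolding Suc by (simp add: lookup_add add.assoc flip: single_add)
  finally show ?case .
qed simp

lemma lkp_partial_foldr:
  assumes "distinct xs"
  shows "lkp (foldr (\<lambda>i. partial i ^^ lkp \<alpha> i) xs p) \<gamma> * (\<Prod>i\<in>set xs. fact (lkp \<gamma> i))
    = (\<Prod>i\<in>set xs. fact (lkp \<gamma> i + lkp \<alpha> i)) * lkp p (\<gamma> + (\<Sum>i\<in>set xs. Poly_Mapping.single i (lkp \<alpha> i)))"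
  using assms
proof (induction xs arbitrary: \<gamma>)
  case (Cons x xs)
  let ?g = "\<gamma> + Poly_Mapping.single x (lkp \<alpha> x)" and ?f = "foldr (\<lambda>i. partial i ^^ lkp \<alpha> i) xs p"
  have g: "lkp ?g i = lkp \<gamma> i" if "i \<in> set xs" for i
    using that Cons.prems by (auto simp: lookup_add lookup_single when_def)
  have "lkp (foldr (\<lambda>i. partial i ^^ lkp \<alpha> i) (x # xs) p) \<gamma> * (\<Prod>i\<in>set (x # xs). fact (lkp \<gamma> i))
      = (lkp ((partial x ^^ lkp \<alpha> x) ?f) \<gamma> * fact (lkp \<gamma> x)) * (\<Prod>i\<in>set xs. fact (lkp \<gamma> i))"
    using Cons.prems by (simp add: mult.assoc)
  also have "\<dots> = fact (lkp \<gamma> x + lkp \<alpha> x) * (lkp ?f ?g * (\<Prod>i\<in>set xs. fact (lkp ?g i)))"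
    by (simp add: lkp_partial_power g mult.assoc)
  also have "lkp ?f ?g * (\<Prod>i\<in>set xs. fact (lkp ?g i))
      = (\<Prod>i\<in>set xs. fact (lkp ?g i + lkp \<alpha> i)) * lkp p (?g + (\<Sum>i\<in>set xs. Poly_Mapping.single i (lkp \<alpha> i)))"
    using Cons by simp
  also have "(\<Prod>i\<in>set xs. fact (lkp ?g i + lkp \<alpha> i)) = (\<Prod>i\<in>set xs. fact (lkp \<gamma> i + lkp \<alpha> i) :: real)"
    by (rule prod.cong) (simp_all add: g)
  finally show ?case using Cons.prems by (simp add: mult.assoc add.assoc)
qed simp

text \<open>Once coefficients are scaled by the factorials of their exponents, differentiation by a
  monomial is a mere shift by its exponent.\<close>

lemma lkp_diff_op:
  fixes D p :: "'v::{finite,linorder} mpoly"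
  shows "lkp (diff_op D p) \<gamma> * (\<Prod>i\<in>UNIV. fact (lkp \<gamma> i))
    = (\<Sum>\<alpha>\<in>Poly_Mapping.keys D. lkp D \<alpha> * ((\<Prod>i\<in>UNIV. fact (lkp (\<gamma> + \<alpha>) i)) * lkp p (\<gamma> + \<alpha>)))"
proof -
  have s: "(\<Sum>i\<in>UNIV. Poly_Mapping.single i (lkp \<alpha> i)) = \<alpha>" for \<alpha> :: "'v \<Rightarrow>\<^sub>0 nat"
    by (rule poly_mapping_eqI) (simp add: lookup_sum lookup_single when_def sum.delta')
  have "lkp (foldr (\<lambda>i. partial i ^^ lkp \<alpha> i) (sorted_list_of_set UNIV) p) \<gamma> * (\<Prod>i\<in>UNIV. fact (lkp \<gamma> i))
      = (\<Prod>i\<in>UNIV. fact (lkp (\<gamma> + \<alpha>) i)) * lkp p (\<gamma> + \<alpha>)" for \<alpha>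
    using lkp_partial_foldr[of "sorted_list_of_set (UNIV :: 'v set)" \<alpha> p \<gamma>] by (simp add: s lookup_add)
  then show ?thesis
    by (simp add: diff_op_def lookup_sum sum_distrib_right mult.assoc)
qed

context multifan
begin

section \<open>Identification of the volume polynomial\<close>

lemma w_nonzero_iff: "w I \<noteq> 0 \<longleftrightarrow> I \<in> facets"
  by (simp add: w multifan_weight_def DIM simplices_facets)

lemma w_over_det:
  assumes "I \<in> facets"
  shows "w I / \<bar>char_det e lam I\<bar> = \<epsilon> $ I / char_det e lam I"
  using eps_sq[OF assms] char_det_nonzero[OF assms] assms
  by (auto simp: w multifan_weight_def DIM simplices_facets sgn_if abs_if)

text \<open>The definite description is met: \<open>lf_independent\<close> gives constancy over all
  generic v, and the existence of one generic vector gives uniqueness.\<close>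

lemma mf_integral_eq:
  assumes "x \<in> hdeg n"
  shows "mf_integral e w lam x = lf v0 x"
proof -
  have gen: "(\<forall>I. w I \<noteq> 0 \<longrightarrow> (\<forall>i\<in>I. iota lam I (var i) v \<noteq> 0)) \<longleftrightarrow> generic v" for v
    by (auto simp: w_nonzero_iff generic_def iota_pt eval.subst_var)
  have sum: "(\<Sum>I | w I \<noteq> 0. w I * iota lam I x v / (\<bar>char_det e lam I\<bar> * (\<Prod>i\<in>I. iota lam I (var i) v))) = lf v x" for v
  proof -
    have "w I * iota lam I x v / (\<bar>char_det e lam I\<bar> * (\<Prod>i\<in>I. iota lam I (var i) v))
        = \<epsilon> $ I / (char_det e lam I * (\<Prod>i\<in>I. pt v I i)) * poly_eval (pt v I) x" if "I \<in> facets" for I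
    proof -
      have "w I * iota lam I x v / (\<bar>char_det e lam I\<bar> * (\<Prod>i\<in>I. iota lam I (var i) v))
          = (w I / \<bar>char_det e lam I\<bar>) * (poly_eval (pt v I) x / (\<Prod>i\<in>I. pt v I i))"
        by (simp add: iota_pt eval.subst_var)
      then show ?thesis by (simp add: w_over_det[OF that])
    qed
    then show ?thesis by (simp add: w_nonzero_iff lf_sum_facets)
  qed
  show ?thesis
    unfolding mf_integral_def gen sum
  proof (rule the_equality)
    show "\<forall>v. generic v \<longrightarrow> lf v x = lf v0 x" using lf_independent[OF _ generic_v0 assms] by simp
    fix c assume "\<forall>v. generic v \<longrightarrow> lf v x = c"
    then show "c = lf v0 x" using generic_v0 by simp
  qed
qed

text \<open>Explicit candidate whose Taylor coefficients are the integrals of the monomials.\<close>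

definition vol :: "'v mpoly" where
  "vol = (\<Sum>\<alpha>\<in>{\<alpha>. tdeg \<alpha> = n}. Poly_Mapping.single \<alpha> (lf v0 (mono \<alpha>) / (\<Prod>i\<in>UNIV. fact (lkp \<alpha> i))))"

lemma lkp_vol: "lkp vol \<alpha> = top_integral (mono \<alpha>) / (\<Prod>i\<in>UNIV. fact (lkp \<alpha> i))"
proof -
  have "lkp vol \<alpha> = (if tdeg \<alpha> = n then lf v0 (mono \<alpha>) / (\<Prod>i\<in>UNIV. fact (lkp \<alpha> i)) else 0)"
    by (simp add: vol_def lookup_sum lookup_single when_def finite_tdeg)
  then show ?thesis
    by (auto simp: top_integral_def restr_single lf_def ev_0)
qed

text \<open>The multinomial theorem shows that \<open>vol\<close> has the required values, and a
  real polynomial is determined by its values.\<close>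

lemma volume_polynomial_eq: "volume_polynomial e w lam = vol"
proof -
  have ev: "poly_eval c vol = mf_integral e w lam ((\<Sum>i\<in>UNIV. const (c i) * var i) ^ DIM('a)) / fact DIM('a)" for c
  proof -
    let ?s = "(\<Sum>i\<in>UNIV. const (c i) * var i) ^ n"
    have keys: "Poly_Mapping.keys ?s \<subseteq> {\<alpha>. tdeg \<alpha> = n}"
      by (auto simp: in_keys_iff lkp_linear_power split: if_splits)
    then have s: "?s \<in> hdeg n" by (simp add: hdeg_keys)
    have "lf v0 ?s = (\<Sum>\<alpha>\<in>Poly_Mapping.keys ?s. lkp ?s \<alpha> * lf v0 (mono \<alpha>))"
      by (subst mpoly_eq_sum[of ?s]) (simp add: lf_sum lf_const_mult)
    also have "\<dots> = (\<Sum>\<alpha>\<in>{\<alpha>. tdeg \<alpha> = n}. lkp ?s \<alpha> * lf v0 (mono \<alpha>))"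
      using keys finite_tdeg by (intro sum.mono_neutral_left) (auto simp: in_keys_iff)
    also have "\<dots> = (\<Sum>\<alpha>\<in>{\<alpha>. tdeg \<alpha> = n}. fact n * (lf v0 (mono \<alpha>) / (\<Prod>i\<in>UNIV. fact (lkp \<alpha> i)) * (\<Prod>i\<in>UNIV. c i ^ lkp \<alpha> i)))"
      by (rule sum.cong) (auto simp: lkp_linear_power exp_coeff_def prod_dividef)
    also have "\<dots> = fact n * poly_eval c vol"
      by (simp add: vol_def eval.subst_sum eval.subst_single sum_distrib_left)
    finally show ?thesis using mf_integral_eq[OF s] by (simp add: DIM)
  qed
  show ?thesis
    unfolding volume_polynomial_def
  proof (rule the_equality)
    fix p assume "\<forall>c. poly_eval c p = mf_integral e w lam ((\<Sum>i\<in>UNIV. const (c i) * var i) ^ DIM('a)) / fact DIM('a)"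
    then have "poly_eval c (p - vol) = 0" for c using ev[of c] by (simp add: eval.subst_diff)
    then have "p - vol = 0" by (rule poly_eval_zero_imp_zero)
    then show "p = vol" by simp
  qed (use ev in blast)
qed

text \<open>Up to factorials, the coefficient of D applied to \<open>vol\<close> at
  \<open>\<gamma>\<close> is the integral of D times that monomial, so vanishing means orthogonality
  to all monomials.\<close>

lemma diff_op_vol: "diff_op D (volume_polynomial e w lam) = 0 \<longleftrightarrow> (\<forall>x. top_integral (D * x) = 0)"
proof -
  have coeff: "lkp (diff_op D vol) \<gamma> * (\<Prod>i\<in>UNIV. fact (lkp \<gamma> i)) = top_integral (D * mono \<gamma>)" for \<gamma>
  proof -
    have "D * mono \<gamma> = (\<Sum>\<alpha>\<in>Poly_Mapping.keys D. const (lkp D \<alpha>) * mono (\<gamma> + \<alpha>))"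
      by (subst mpoly_eq_sum[of D]) (simp add: sum_distrib_right mult.assoc mult_single add.commute)
    then show ?thesis
      by (simp add: lkp_diff_op lkp_vol top_integral_sum top_integral_const_mult)
  qed
  have "diff_op D vol = 0 \<longleftrightarrow> (\<forall>\<gamma>. lkp (diff_op D vol) \<gamma> = 0)"
    by (auto intro: poly_mapping_eqI)
  also have "\<dots> \<longleftrightarrow> (\<forall>\<gamma>. top_integral (D * mono \<gamma>) = 0)"
    by (simp flip: coeff)
  also have "\<dots> \<longleftrightarrow> (\<forall>x. top_integral (D * x) = 0)"
  proof
    assume a: "\<forall>\<gamma>. top_integral (D * mono \<gamma>) = 0"
    show "\<forall>x. top_integral (D * x) = 0"
    proof
      fix x
      have "D * x = (\<Sum>\<alpha>\<in>Poly_Mapping.keys x. const (lkp x \<alpha>) * (D * mono \<alpha>))"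
        by (subst mpoly_eq_sum[of x]) (simp add: sum_distrib_left mult.left_commute)
      then show "top_integral (D * x) = 0"
        using a by (simp add: top_integral_sum top_integral_const_mult)
    qed
  qed blast
  finally show ?thesis by (simp add: volume_polynomial_eq)
qed

end

section \<open>Quotient algebras\<close>

lemma poly_algebra_simps [simp]:
  "carrier poly_algebra = UNIV" "mult poly_algebra = (*)" "one poly_algebra = 1"
  "zero poly_algebra = 0" "add poly_algebra = (+)"
  "scalar poly_algebra = const" "component poly_algebra = homogeneous"
  by (simp_all add: poly_algebra_def)

lemma cring_poly_algebra: "cring (poly_algebra :: 'v::finite mpoly graded_algebra)"
proof (rule cringI)
  show "abelian_group (poly_algebra :: 'v mpoly graded_algebra)"
  proof (rule abelian_groupI)
    fix x :: "'v mpoly"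
    show "\<exists>y\<in>carrier poly_algebra. y \<oplus>\<^bsub>poly_algebra\<^esub> x = \<zero>\<^bsub>poly_algebra\<^esub>"
      by (intro bexI[of _ "- x"]) auto
  qed (auto simp: add.assoc add.commute)
  show "comm_monoid (poly_algebra :: 'v mpoly graded_algebra)"
    by (rule comm_monoidI) (auto simp: mult.assoc mult.commute)
qed (auto simp: distrib_right)

lemma ring_poly_algebra: "ring poly_algebra"
  using cring_poly_algebra by (rule cring.axioms)

lemma poly_algebra_minus: "a_inv poly_algebra x = - x"
proof -
  interpret ring poly_algebra by (rule ring_poly_algebra)
  show ?thesis by (rule minus_equality) auto
qed

lemma ideal_poly_algebraI:
  fixes J :: "'v::finite mpoly set"
  assumes "0 \<in> J" "\<And>x y. x \<in> J \<Longrightarrow> y \<in> J \<Longrightarrow> x + y \<in> J" "\<And>p x. x \<in> J \<Longrightarrow> p * x \<in> J"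
  shows "ideal J poly_algebra"
proof (rule idealI[OF ring_poly_algebra])
  show "subgroup J (add_monoid poly_algebra)"
  proof
    fix x assume "x \<in> J"
    then have "(- 1) * x \<in> J" by (rule assms(3))
    then show "inv\<^bsub>add_monoid poly_algebra\<^esub> x \<in> J"
      using poly_algebra_minus[of x] by (simp add: a_inv_def)
  qed (auto simp: assms)
  fix a x :: "'v mpoly" assume "a \<in> J"
  then have "x * a \<in> J" by (rule assms(3))
  then show "x \<otimes>\<^bsub>poly_algebra\<^esub> a \<in> J" "a \<otimes>\<^bsub>poly_algebra\<^esub> x \<in> J"
    by (simp_all add: mult.commute)
qed

lemma quotient_algebra_simps [simp]:
  "carrier (quotient_algebra A I) = carrier (A Quot I)"
  "mult (quotient_algebra A I) = mult (A Quot I)"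
  "one (quotient_algebra A I) = one (A Quot I)"
  "zero (quotient_algebra A I) = zero (A Quot I)"
  "add (quotient_algebra A I) = add (A Quot I)"
  "scalar (quotient_algebra A I) = (\<lambda>r. I +>\<^bsub>A\<^esub> scalar A r)"
  "component (quotient_algebra A I) = (\<lambda>d. (\<lambda>a. I +>\<^bsub>A\<^esub> a) ` component A d)"
  by (simp_all add: quotient_algebra_def)

text \<open>\<open>quotient_algebra\<close> adds fields to the record of the factor ring, so the
  ring axioms are moved over field by field.\<close>

lemma ring_same_fields:
  assumes "ring R" "carrier S = carrier R" "mult S = mult R" "one S = one R" "zero S = zero R" "add S = add R"
  shows "ring S"
proof (rule ringI)
  interpret ring R by fact
  show "abelian_group S"
  proof (rule abelian_groupI)
    fix x assume "x \<in> carrier S"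
    then show "\<exists>y\<in>carrier S. y \<oplus>\<^bsub>S\<^esub> x = \<zero>\<^bsub>S\<^esub>"
      by (intro bexI[of _ "\<ominus>\<^bsub>R\<^esub> x"]) (auto simp: assms(2-) l_neg)
  qed (auto simp: assms(2-) a_ac)
  show "Group.monoid S"
    by (rule monoidI) (auto simp: assms(2-) m_assoc)
qed (insert assms(1), auto simp: assms(2-) ring.ring_simprules)

lemma ring_quotient_algebra:
  assumes "ideal I A"
  shows "ring (quotient_algebra A I)"
  by (rule ring_same_fields[OF ideal.quotient_is_ring[OF assms]]) auto

context
  fixes A :: "'b graded_algebra" and I :: "'b set"
  assumes I: "ideal I A"
begin

interpretation ideal I A by (rule I)

lemma quot_carrier: "carrier (quotient_algebra A I) = (\<lambda>a. I +>\<^bsub>A\<^esub> a) ` carrier A"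
  by (auto simp: FactRing_def A_RCOSETS_def')

lemma quot_mult:
  "a \<in> carrier A \<Longrightarrow> b \<in> carrier A \<Longrightarrow>
    (I +>\<^bsub>A\<^esub> a) \<otimes>\<^bsub>quotient_algebra A I\<^esub> (I +>\<^bsub>A\<^esub> b) = I +>\<^bsub>A\<^esub> (a \<otimes>\<^bsub>A\<^esub> b)"
  by (simp add: FactRing_def rcoset_mult_add)

lemma quot_add:
  "a \<in> carrier A \<Longrightarrow> b \<in> carrier A \<Longrightarrow>
    (I +>\<^bsub>A\<^esub> a) \<oplus>\<^bsub>quotient_algebra A I\<^esub> (I +>\<^bsub>A\<^esub> b) = I +>\<^bsub>A\<^esub> (a \<oplus>\<^bsub>A\<^esub> b)"
  by (simp add: FactRing_def a_rcos_sum)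

lemma quot_one: "\<one>\<^bsub>quotient_algebra A I\<^esub> = I +>\<^bsub>A\<^esub> \<one>\<^bsub>A\<^esub>"
  by (simp add: FactRing_def)

lemma quot_zero: "\<zero>\<^bsub>quotient_algebra A I\<^esub> = I +>\<^bsub>A\<^esub> \<zero>\<^bsub>A\<^esub>"
  by (simp add: FactRing_def a_rcos_zero[OF I additive_subgroup.zero_closed[OF ideal.axioms(1)[OF I]]])

lemma quot_eq_iff:
  assumes "a \<in> carrier A" "b \<in> carrier A"
  shows "I +>\<^bsub>A\<^esub> a = I +>\<^bsub>A\<^esub> b \<longleftrightarrow> a \<ominus>\<^bsub>A\<^esub> b \<in> I"
  using quotient_eq_iff_same_a_r_cos[OF I assms] by simp

end

lemma poly_coset_eq_iff:
  assumes "ideal J poly_algebra"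
  shows "J +>\<^bsub>poly_algebra\<^esub> p = J +>\<^bsub>poly_algebra\<^esub> q \<longleftrightarrow> p - q \<in> J"
  using quot_eq_iff[OF assms, of p q] by (simp add: a_minus_def poly_algebra_minus)

context sphere_char
begin

section \<open>The Stanley-Reisner ideal and the ideal of the linear forms\<close>

lemma ideal_nonface: "ideal nonface_polys poly_algebra"
  by (rule ideal_poly_algebraI) (simp_all add: nonface_0 nonface_add nonface_mult)

text \<open>A monomial with nonface support is a multiple of the squarefree monomial of that
  support, which is a generator.\<close>

lemma SR_ideal_eq: "SR_ideal K = nonface_polys"
proof
  interpret ring "poly_algebra :: 'v mpoly graded_algebra" by (rule ring_poly_algebra)
  let ?G = "{\<Prod>i\<in>S. var i | S. S \<notin> K} :: 'v mpoly set"
  have "?G \<subseteq> nonface_polys" by (auto simp: prod_var nonface_polys_def supp_expo)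
  then show "SR_ideal K \<subseteq> nonface_polys"
    unfolding SR_ideal_def by (rule genideal_minimal[OF ideal_nonface])
  have id: "ideal (SR_ideal K) poly_algebra" unfolding SR_ideal_def by (rule genideal_ideal) simp
  then interpret I: ideal "SR_ideal K" "poly_algebra :: 'v mpoly graded_algebra" .
  have gen: "?G \<subseteq> SR_ideal K" unfolding SR_ideal_def by (rule genideal_self) simp
  have mult: "p * x \<in> SR_ideal K" if "x \<in> SR_ideal K" for p x
    using I.I_l_closed[OF that, of p] by simp
  have z: "0 \<in> SR_ideal K" using I.zero_closed by simp
  have add: "x + y \<in> SR_ideal K" if "x \<in> SR_ideal K" "y \<in> SR_ideal K" for x y
    using I.a_closed[OF that] by simp
  have sum: "sum f S \<in> SR_ideal K" if "\<And>x. x \<in> S \<Longrightarrow> f x \<in> SR_ideal K" for f and S :: "('v \<Rightarrow>\<^sub>0 nat) set"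
    using that
    by (induction S rule: infinite_finite_induct) (simp_all add: z add)
  show "nonface_polys \<subseteq> SR_ideal K"
  proof
    fix p assume p: "p \<in> nonface_polys"
    have "const (lkp p \<alpha>) * mono \<alpha> \<in> SR_ideal K" if "\<alpha> \<in> Poly_Mapping.keys p" for \<alpha>
    proof -
      have "mono (expo (supp \<alpha>)) \<in> SR_ideal K"
        using gen p that unfolding prod_var nonface_polys_def by blast
      moreover have "(\<alpha> - expo (supp \<alpha>)) + expo (supp \<alpha>) = \<alpha>"
        by (rule poly_mapping_eqI) (auto simp: lookup_add lookup_minus lkp_expo in_keys_iff)
      then have "mono \<alpha> = mono (\<alpha> - expo (supp \<alpha>)) * mono (expo (supp \<alpha>))"
        by (simp add: mult_single)
      ultimately show ?thesis using mult by simp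
    qed
    then show "p \<in> SR_ideal K" by (subst mpoly_eq_sum) (rule sum)
  qed
qed

lemma ideal_theta_sums: "ideal (theta_sums u k) poly_algebra"
  by (rule ideal_poly_algebraI) (simp_all add: theta_sums_0 theta_sums_add theta_sums_mult)

lemma nonface_theta_sums:
  assumes "p \<in> nonface_polys"
  shows "p \<in> theta_sums u k"
  using theta_sumsI[OF assms, where u = u and k = k and q = "\<lambda>_. 0"] by simp

lemma theta_add: "theta lam (x + y) = theta lam x + theta lam y"
  by (simp add: theta_def inner_add_left const_add distrib_right sum.distrib)

lemma theta_scale: "theta lam (c *\<^sub>R x) = const c * theta lam x"
  unfolding theta_def sum_distrib_left
  by (rule sum.cong[OF refl]) (simp only: inner_scaleR_left const_mult mult.assoc)

text \<open>The dual vectors on one facet make the n functionals independent. Hence the ideal of a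
  flag contains theta of every functional and does not depend on the flag.\<close>

lemma flag_spans:
  assumes u: "flag n u"
  shows "span (u ` {..<n}) = UNIV"
proof -
  obtain I where I: "I \<in> facets" using ex_facet[OF empty_face] by auto
  have "min n (card I) = n" using facetD(2)[OF I] by simp
  then obtain y where y: "\<And>a b. a < n \<Longrightarrow> b < n \<Longrightarrow> inner (u a) (y b) = (if a = b then 1 else 0)"
    using bspec[OF u[unfolded flag_def] facetD(1)[OF I]] by auto
  have inj: "inj_on u {..<n}"
  proof (rule inj_onI)
    fix a b assume "a \<in> {..<n}" "b \<in> {..<n}" "u a = u b"
    then show "a = b" using y[of a b] y[of b b] by (auto split: if_splits)
  qed
  have "independent (u ` {..<n})"
    unfolding dependent_def
  proof
    assume "\<exists>x\<in>u ` {..<n}. x \<in> span (u ` {..<n} - {x})"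
    then obtain b where b: "b < n" "u b \<in> span (u ` {..<n} - {u b})" by auto
    have "inner x (y b) = 0" if "x \<in> span (u ` {..<n} - {u b})" for x
      using that
    proof (induction rule: span_induct_alt)
      case (step c x z)
      then obtain a where "a < n" "x = u a" "a \<noteq> b" by auto
      then show ?case using step y[of a b] b(1) by (simp add: inner_add_left)
    qed simp
    then have "inner (u b) (y b) = 0" using b(2) by blast
    then show False using y[OF b(1) b(1)] by simp
  qed
  moreover have "card (u ` {..<n}) = DIM('a)" using inj DIM by (simp add: card_image)
  ultimately show ?thesis
    using card_ge_dim_independent[of "u ` {..<n}" UNIV] by (auto simp: dim_UNIV)
qed

lemma theta_in_theta_sums:
  assumes "flag n u"
  shows "theta lam x \<in> theta_sums u n"
proof -
  have "x \<in> span (u ` {..<n})" using flag_spans[OF assms] by simp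
  then show ?thesis
  proof (induction rule: span_induct_alt)
    case base
    have "theta lam 0 = 0" by (simp add: theta_def)
    then show ?case by (simp add: theta_sums_0)
  next
    case (step c x z)
    then obtain a where a: "a < n" "x = u a" by auto
    have e: "theta lam (u a) = 0 + (\<Sum>b<n. theta lam (u b) * (if b = a then 1 else 0))"
      using a by (simp add: if_distrib[of "\<lambda>t. _ * t"] cong: if_cong)
    have "theta lam (u a) \<in> theta_sums u n" by (subst e) (rule theta_sumsI[OF nonface_0])
    then show ?case
      unfolding theta_add theta_scale a(2) by (intro theta_sums_add theta_sums_mult step(2))
  qed
qed

lemma SR_ring_ring: "ring (SR_ring K)"
  unfolding SR_ring_def SR_ideal_eq by (rule ring_quotient_algebra[OF ideal_nonface])

abbreviation face_class :: "'v mpoly \<Rightarrow> 'v mpoly set" where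
  "face_class p \<equiv> nonface_polys +>\<^bsub>poly_algebra\<^esub> p"

lemma SR_carrier: "carrier (SR_ring K) = range face_class"
  unfolding SR_ring_def SR_ideal_eq quot_carrier[OF ideal_nonface] by simp

lemma SR_mult: "face_class p \<otimes>\<^bsub>SR_ring K\<^esub> face_class q = face_class (p * q)"
  unfolding SR_ring_def SR_ideal_eq by (subst quot_mult[OF ideal_nonface]) simp_all

lemma SR_add: "face_class p \<oplus>\<^bsub>SR_ring K\<^esub> face_class q = face_class (p + q)"
  unfolding SR_ring_def SR_ideal_eq by (subst quot_add[OF ideal_nonface]) simp_all

lemma SR_one: "\<one>\<^bsub>SR_ring K\<^esub> = face_class 1"
  unfolding SR_ring_def SR_ideal_eq quot_one[OF ideal_nonface] by simp

lemma SR_zero: "\<zero>\<^bsub>SR_ring K\<^esub> = face_class 0"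
  unfolding SR_ring_def SR_ideal_eq quot_zero[OF ideal_nonface] by simp

lemma face_class_eq_iff: "face_class p = face_class q \<longleftrightarrow> p - q \<in> nonface_polys"
  by (rule poly_coset_eq_iff[OF ideal_nonface])

lemma SR_minus: "a_inv (SR_ring K) (face_class p) = face_class (- p)"
proof -
  interpret ring "SR_ring K" by (rule SR_ring_ring)
  show ?thesis by (rule minus_equality) (auto simp: SR_carrier SR_add SR_zero)
qed

lemma theta_ideal_eq:
  assumes u: "flag n u"
  shows "theta_ideal K lam = face_class ` theta_sums u n"
proof
  interpret ring "SR_ring K" by (rule SR_ring_ring)
  let ?G = "{face_class (theta lam x) | x. x \<in> UNIV}"
  have T: "theta_ideal K lam = genideal (SR_ring K) ?G"
    by (simp add: theta_ideal_def SR_ideal_eq theta_def)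
  have G: "?G \<subseteq> carrier (SR_ring K)" by (auto simp: SR_carrier)
  have "ideal (face_class ` theta_sums u n) (SR_ring K)"
  proof (rule idealI[OF SR_ring_ring])
    show "subgroup (face_class ` theta_sums u n) (add_monoid (SR_ring K))"
    proof
      fix X assume "X \<in> face_class ` theta_sums u n"
      then obtain p where p: "p \<in> theta_sums u n" "X = face_class p" by auto
      have "(- 1) * p \<in> theta_sums u n" by (rule theta_sums_mult[OF p(1)])
      then show "inv\<^bsub>add_monoid (SR_ring K)\<^esub> X \<in> face_class ` theta_sums u n"
        using SR_minus[of p] by (simp add: a_inv_def p(2))
    qed (auto simp: SR_carrier SR_add SR_zero theta_sums_0 theta_sums_add)
    fix X Y assume "X \<in> face_class ` theta_sums u n" "Y \<in> carrier (SR_ring K)"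
    then obtain p q where pq: "p \<in> theta_sums u n" "X = face_class p" "Y = face_class q"
      by (auto simp: SR_carrier)
    have "q * p \<in> theta_sums u n" by (rule theta_sums_mult[OF pq(1)])
    then show "Y \<otimes>\<^bsub>SR_ring K\<^esub> X \<in> face_class ` theta_sums u n"
      "X \<otimes>\<^bsub>SR_ring K\<^esub> Y \<in> face_class ` theta_sums u n"
      by (simp_all add: pq SR_mult mult.commute)
  qed
  moreover have "?G \<subseteq> face_class ` theta_sums u n" using theta_in_theta_sums[OF u] by auto
  ultimately show "theta_ideal K lam \<subseteq> face_class ` theta_sums u n"
    unfolding T by (rule genideal_minimal)
  interpret T: ideal "theta_ideal K lam" "SR_ring K" unfolding T by (rule genideal_ideal[OF G])
  have gen: "face_class (theta lam x) \<in> theta_ideal K lam" for x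
    using genideal_self[OF G] unfolding T by blast
  show "face_class ` theta_sums u n \<subseteq> theta_ideal K lam"
  proof
    fix X assume "X \<in> face_class ` theta_sums u n"
    then obtain s q where X: "X = face_class (s + (\<Sum>a<n. theta lam (u a) * q a))" "s \<in> nonface_polys"
      unfolding theta_sums_def by auto
    have m: "face_class (theta lam (u a) * q a) \<in> theta_ideal K lam" for a
      using T.I_r_closed[OF gen[of "u a"], of "face_class (q a)"] by (simp add: SR_carrier SR_mult)
    have "face_class (\<Sum>a<k. theta lam (u a) * q a) \<in> theta_ideal K lam" for k
    proof (induction k)
      case 0
      then show ?case using T.zero_closed by (simp add: SR_zero)
    next
      case (Suc k)
      then show ?case using T.a_closed[OF Suc m[of k]] by (simp add: SR_add)
    qed
    moreover have "X = face_class (\<Sum>a<n. theta lam (u a) * q a)"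
      unfolding X(1) face_class_eq_iff using X(2) by simp
    ultimately show "X \<in> theta_ideal K lam" by simp
  qed
qed

lemma ideal_theta_ideal: "ideal (theta_ideal K lam) (SR_ring K)"
proof -
  interpret ring "SR_ring K" by (rule SR_ring_ring)
  have "{SR_ideal K +>\<^bsub>poly_algebra\<^esub> (\<Sum>i\<in>UNIV. const (inner u (lam i)) * var i) | u. u \<in> UNIV}
      \<subseteq> carrier (SR_ring K)"
    by (auto simp: SR_carrier SR_ideal_eq)
  then show ?thesis unfolding theta_ideal_def by (rule genideal_ideal)
qed

text \<open>The composite of the two quotient maps through R[K]; its kernel is
  \<open>theta_sums u n\<close> for any flag.\<close>

definition theta_class :: "'v mpoly \<Rightarrow> 'v mpoly set set" where
  "theta_class p = theta_ideal K lam +>\<^bsub>SR_ring K\<^esub> face_class p"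

lemma theta_class_eq_iff:
  assumes "flag n u"
  shows "theta_class p = theta_class q \<longleftrightarrow> p - q \<in> theta_sums u n"
proof -
  have "theta_class p = theta_class q \<longleftrightarrow> face_class (p - q) \<in> theta_ideal K lam"
    unfolding theta_class_def
    by (subst quot_eq_iff[OF ideal_theta_ideal]) (auto simp: SR_carrier a_minus_def SR_minus SR_add)
  also have "\<dots> \<longleftrightarrow> p - q \<in> theta_sums u n"
  proof
    assume "face_class (p - q) \<in> theta_ideal K lam"
    then obtain r where r: "r \<in> theta_sums u n" "p - q - r \<in> nonface_polys"
      unfolding theta_ideal_eq[OF assms] by (auto simp: face_class_eq_iff)
    have "(p - q - r) + r \<in> theta_sums u n"
      by (rule theta_sums_add[OF nonface_theta_sums[OF r(2)] r(1)])
    then show "p - q \<in> theta_sums u n" by simp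
  qed (simp add: theta_ideal_eq[OF assms])
  finally show ?thesis .
qed

end

context multifan
begin

section \<open>The isomorphism and the dimensions\<close>

lemma multifan_ideal:
  assumes "flag n u"
  shows "multifan_algebra e w lam = quotient_algebra poly_algebra (theta_sums u n)"
  unfolding multifan_algebra_def diff_op_vol annihilator_eq[OF assms] by simp

text \<open>Both algebras are quotients of the polynomial ring by the same ideal, one directly and
  the other in two stages.\<close>

lemma multifan_iso:
  "\<exists>\<phi>. \<phi> \<in> graded_algebra_iso (multifan_algebra e w lam) (quotient_algebra (SR_ring K) (theta_ideal K lam))"
proof -
  obtain u where u: "flag n u" using ex_flag by auto
  note J = ideal_theta_sums[of u n] and T = ideal_theta_ideal
  let ?A = "quotient_algebra poly_algebra (theta_sums u n)"
  let ?C = "quotient_algebra (SR_ring K) (theta_ideal K lam)"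
  let ?cos = "\<lambda>p. theta_sums u n +>\<^bsub>poly_algebra\<^esub> p"
  \<comment> \<open>The choice of a representative is harmless: both cosets depend only on the class
    modulo \<open>theta_sums u n\<close>.\<close>
  define \<phi> where "\<phi> X = theta_class (SOME p. X = ?cos p)" for X
  have \<phi>: "\<phi> (?cos p) = theta_class p" for p
  proof -
    have "?cos p = ?cos (SOME q. ?cos p = ?cos q)" by (rule someI[of "\<lambda>q. ?cos p = ?cos q"]) simp
    then have "p - (SOME q. ?cos p = ?cos q) \<in> theta_sums u n" by (simp add: poly_coset_eq_iff[OF J])
    then show ?thesis unfolding \<phi>_def using theta_class_eq_iff[OF u] by metis
  qed
  have carrA: "carrier ?A = range ?cos" unfolding quot_carrier[OF J] by simp
  have fc: "face_class p \<in> carrier (SR_ring K)" for p by (simp add: SR_carrier)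
  have carrC: "carrier ?C = range theta_class"
    unfolding quot_carrier[OF T] SR_carrier theta_class_def by (simp add: image_image)
  have hom: "\<phi> \<in> Ring.ring_hom ?A ?C"
  proof (rule ring_hom_memI)
    fix X Y assume "X \<in> carrier ?A" "Y \<in> carrier ?A"
    then obtain p q where pq: "X = ?cos p" "Y = ?cos q" unfolding carrA by auto
    show "\<phi> X \<in> carrier ?C" unfolding pq \<phi> carrC by simp
    have "X \<otimes>\<^bsub>?A\<^esub> Y = ?cos (p * q)" unfolding pq by (subst quot_mult[OF J]) auto
    moreover have "theta_class p \<otimes>\<^bsub>?C\<^esub> theta_class q = theta_class (p * q)"
      unfolding theta_class_def by (subst quot_mult[OF T fc fc]) (simp add: SR_mult)
    ultimately show "\<phi> (X \<otimes>\<^bsub>?A\<^esub> Y) = \<phi> X \<otimes>\<^bsub>?C\<^esub> \<phi> Y" by (simp only: pq \<phi>)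
    have "X \<oplus>\<^bsub>?A\<^esub> Y = ?cos (p + q)" unfolding pq by (subst quot_add[OF J]) auto
    moreover have "theta_class p \<oplus>\<^bsub>?C\<^esub> theta_class q = theta_class (p + q)"
      unfolding theta_class_def by (subst quot_add[OF T fc fc]) (simp add: SR_add)
    ultimately show "\<phi> (X \<oplus>\<^bsub>?A\<^esub> Y) = \<phi> X \<oplus>\<^bsub>?C\<^esub> \<phi> Y" by (simp only: pq \<phi>)
  next
    have "\<phi> (\<one>\<^bsub>?A\<^esub>) = theta_class 1" unfolding quot_one[OF J] by (simp add: \<phi>)
    then show "\<phi> (\<one>\<^bsub>?A\<^esub>) = \<one>\<^bsub>?C\<^esub>" unfolding quot_one[OF T] SR_one theta_class_def .
  qed
  have bij: "bij_betw \<phi> (carrier ?A) (carrier ?C)"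
  proof (rule bij_betw_imageI)
    show "inj_on \<phi> (carrier ?A)"
    proof (rule inj_onI)
      fix X Y assume XY: "X \<in> carrier ?A" "Y \<in> carrier ?A" "\<phi> X = \<phi> Y"
      from XY(1,2) obtain p q where pq: "X = ?cos p" "Y = ?cos q" unfolding carrA by auto
      have "theta_class p = theta_class q" using XY(3) by (simp only: pq \<phi>)
      then show "X = Y" unfolding pq poly_coset_eq_iff[OF J] theta_class_eq_iff[OF u] .
    qed
    show "\<phi> ` carrier ?A = carrier ?C" unfolding carrA carrC image_image \<phi> ..
  qed
  have scal: "\<phi> (scalar ?A r) = scalar ?C r" for r
    by (simp add: \<phi> theta_class_def SR_ring_def SR_ideal_eq)
  have comp: "\<phi> ` component ?A d = component ?C d" for d
    by (simp add: image_image \<phi> theta_class_def SR_ring_def SR_ideal_eq)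
  show ?thesis
    unfolding multifan_ideal[OF u] graded_algebra_iso_def ring_iso_def
    using hom bij scal comp by (intro exI[of _ \<phi>] CollectI conjI allI)
qed

text \<open>The cosets of a basis from \<open>hdeg_complement\<close> are added one at a time, since
  the dimension is built from line extensions over the image of the reals.\<close>

lemma multifan_dim:
  assumes "j \<le> n"
  shows "\<exists>k. component_dim (multifan_algebra e w lam) (2 * j) k \<and> int k = h_number n K j"
proof -
  obtain u where u: "flag n u" using ex_flag by auto
  note J = ideal_theta_sums[of u n]
  let ?A = "quotient_algebra poly_algebra (theta_sums u n)"
  let ?cos = "\<lambda>p. theta_sums u n +>\<^bsub>poly_algebra\<^esub> p"
  interpret R: ring ?A by (rule ring_quotient_algebra[OF J])
  let ?K = "range (scalar ?A)"
  show ?thesis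
  proof (rule hdeg_complement[OF u, of "{}" j])
    fix B assume B: "finite B" "B \<subseteq> hdeg j" "int (card B) = hval j"
      and span: "\<And>x. x \<in> hdeg j \<Longrightarrow> \<exists>s t. s \<in> theta_sums u n \<inter> hdeg j \<and> t \<in> mp.span B \<and> x = s + t"
      and indep: "\<And>B' b s t. B' \<subseteq> B \<Longrightarrow> b \<in> B \<Longrightarrow> b \<notin> B' \<Longrightarrow> s \<in> theta_sums u n \<inter> hdeg j
        \<Longrightarrow> t \<in> mp.span B' \<Longrightarrow> b \<noteq> s + t"
    have sub: "mp.span B' \<subseteq> hdeg j" if "B' \<subseteq> B" for B'
      using that B(2) by (intro mp.span_minimal mp_subspace_hdeg) auto
    have "R.dimension (card B') ?K (?cos ` mp.span B')" if "finite B'" "B' \<subseteq> B" for B'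
      using that
    proof (induction B' rule: finite_induct)
      case empty
      have "?cos ` mp.span {} = {\<zero>\<^bsub>?A\<^esub>}" unfolding quot_zero[OF J] by simp
      then show ?case using R.zero_dim[of ?K] by simp
    next
      case (insert b B')
      have b: "?cos b \<in> carrier ?A" unfolding quot_carrier[OF J] by simp
      \<comment> \<open>Otherwise b would be an ideal element of degree j plus a combination of the
        earlier basis elements, which the choice of \<open>B\<close> excludes.\<close>
      have notin: "?cos b \<notin> ?cos ` mp.span B'"
      proof
        assume "?cos b \<in> ?cos ` mp.span B'"
        then obtain t where t: "t \<in> mp.span B'" "?cos b = ?cos t" by auto
        have "b - t \<in> theta_sums u n" using t(2) by (simp add: poly_coset_eq_iff[OF J])
        moreover have "b \<in> hdeg j" "t \<in> hdeg j" using insert.prems B(2) sub[of B'] t(1) by auto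
        then have "b - t \<in> hdeg j" by (rule mp.subspace_diff[OF mp_subspace_hdeg])
        ultimately show False using indep[of B' b "b - t" t] insert t(1) by auto
      qed
      have "R.line_extension ?K (?cos b) (?cos ` mp.span B') = ?cos ` mp.span (insert b B')"
      proof -
        have line: "?cos (const r) \<otimes>\<^bsub>?A\<^esub> ?cos b \<oplus>\<^bsub>?A\<^esub> ?cos t = ?cos (const r * b + t)" for r t
          by (subst quot_mult[OF J], simp, simp, subst quot_add[OF J], auto)
        have K: "?K = range (\<lambda>r. ?cos (const r))" by simp
        have "R.line_extension ?K (?cos b) (?cos ` mp.span B') = {?cos (const r * b + t) |r t. t \<in> mp.span B'}"
        proof (rule Set.set_eqI)
          fix X
          have "X \<in> R.line_extension ?K (?cos b) (?cos ` mp.span B') \<longleftrightarrow>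
              (\<exists>r t. t \<in> mp.span B' \<and> X = ?cos (const r) \<otimes>\<^bsub>?A\<^esub> ?cos b \<oplus>\<^bsub>?A\<^esub> ?cos t)"
            unfolding R.line_extension_mem_iff K by (auto simp del: quotient_algebra_simps)
          then show "X \<in> R.line_extension ?K (?cos b) (?cos ` mp.span B')
              \<longleftrightarrow> X \<in> {?cos (const r * b + t) |r t. t \<in> mp.span B'}"
            unfolding line by auto
        qed
        also have "\<dots> = ?cos ` mp.span (insert b B')"
          unfolding mp.span_insert
        proof (intro equalityI subsetI)
          fix X assume "X \<in> {?cos (const r * b + t) |r t. t \<in> mp.span B'}"
          then obtain r t where "X = ?cos (const r * b + t)" "t \<in> mp.span B'" by auto
          then show "X \<in> ?cos ` {x. \<exists>k. x - const k * b \<in> mp.span B'}"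
            by (intro image_eqI[of _ _ "const r * b + t"] CollectI exI[of _ r]) simp_all
        next
          fix X assume "X \<in> ?cos ` {x. \<exists>k. x - const k * b \<in> mp.span B'}"
          then obtain x k where "X = ?cos x" "x - const k * b \<in> mp.span B'" by auto
          then show "X \<in> {?cos (const r * b + t) |r t. t \<in> mp.span B'}"
            by (intro CollectI exI[of _ k] exI[of _ "x - const k * b"]) simp
        qed
        finally show ?thesis .
      qed
      then show ?case
        using R.Suc_dim[OF b notin, of "card B'" ?K] insert by simp
    qed
    from this[of B] have "R.dimension (card B) ?K (?cos ` mp.span B)" using B(1) by simp
    also have "?cos ` mp.span B = ?cos ` hdeg j"
    proof
      show "?cos ` hdeg j \<subseteq> ?cos ` mp.span B"
      proof
        fix X assume "X \<in> ?cos ` hdeg j"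
        then obtain x where x: "x \<in> hdeg j" "X = ?cos x" by auto
        obtain s t where "s \<in> theta_sums u n" "t \<in> mp.span B" "x = s + t" using span[OF x(1)] by auto
        then have "?cos x = ?cos t" by (simp add: poly_coset_eq_iff[OF J])
        then show "X \<in> ?cos ` mp.span B" using x(2) \<open>t \<in> mp.span B\<close> by auto
      qed
    qed (use sub[of B] in auto)
    finally have "R.dimension (card B) ?K (component ?A (2 * j))"
      by (simp add: homogeneous_even)
    moreover have "int (card B) = h_number n K j"
      using B(3) h_number_h_poly[OF assms] by (simp add: hval_def)
    ultimately show ?thesis
      unfolding component_dim_def multifan_ideal[OF u] by blast
  qed simp
qed

end

theorem theorem8p2:
  fixes n :: nat
    and K :: "'v::{finite,linorder} set set"
    and \<epsilon> :: "'v chain"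
    and e :: "'a::euclidean_space list"
    and lam :: "'v \<Rightarrow> 'a"
    and w :: "'v set \<Rightarrow> real"
  assumes "DIM('a) = n"
    and "orthonormal_basis e"
    and "abstract_simplicial_complex K"
    and "has_dimension K (int n - 1)"
    and "homology_sphere n K"
    and "orientation n K \<epsilon>"
    and "characteristic_function K lam"
    and "w = multifan_weight e K \<epsilon> lam"
  shows "(\<exists>\<phi>. \<phi> \<in> graded_algebra_iso (multifan_algebra e w lam)
                  (quotient_algebra (SR_ring K) (theta_ideal K lam)))
    \<and> (\<forall>j\<le>n. \<exists>k. component_dim (multifan_algebra e w lam) (2 * j) k \<and> int k = h_number n K j)"
proof -
  interpret multifan n K \<epsilon> lam e w
    by (intro multifan.intro sphere_char.intro multifan_axioms.intro) (fact assms)+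
  show ?thesis by (intro conjI allI impI multifan_iso multifan_dim)
qed

end
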